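(* Let $d\ge1$, $\nu>0$, $\beta\in(0,1)$, $\alpha\in(0,2)$. Let $\sigma:\mathbb{R}\to\mathbb{R}$ be a locally Lipschitz function for which there is $\gamma>0$ with $\sigma(x)\ge|x|^{1+\gamma}$ for all $x\in\mathbb{R}$. Let $\dot F$ be a Gaussian noise, white in time and colored in space with spatial correlation $f$ (as described in the context), and assume that for fixed $R>0$ there is a positive number $K_f$ (depending on $R$) with $\inf_{x,y\in B(0,R)}f(x,y)\ge K_f$. For a nonnegative bounded deterministic function $u_0$ on $\mathbb{R}^d$, put $\kappa:=\inf_{x\in\mathbb{R}^d}u_0(x)$, and let $u_t(x)$ be the solution of $$\partial_t^\beta u_t(x)=-\nu(-\Delta)^{\alpha/2}u_t(x)+I^{1-\beta}[\sigma(u)\dot F(t,x)],\qquad t>0,\ x\in\mathbb{R}^d,$$ with initial condition $u_0$. Fix $t_0>0$. Then there exists a positive number $\kappa_0$ such that for all $\kappa\ge\kappa_0$ and all $x\in\mathbb{R}^d$, $$\mathbb{E}|u_t(x)|^2=\infty\quad\text{whenever } t\ge t_0.$$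
   Context: $\partial_t^\beta$ is the Caputo derivative, $\partial_t^\beta u_t(x)=\frac{1}{\Gamma(1-\beta)}\int_0^t\frac{\partial u_r(x)}{\partial r}\frac{dr}{(t-r)^\beta}$, and $I^{\gamma'}h(t)=\frac{1}{\Gamma(\gamma')}\int_0^t(t-\tau)^{\gamma'-1}h(\tau)\,d\tau$ for $\gamma'>0$. The operator $-\nu(-\Delta)^{\alpha/2}$ is the generator of the isotropic $\alpha$-stable Lévy process $X$ with transition density $p(t,x)$ determined by $\int_{\mathbb{R}^d}e^{i\xi\cdot x}p(t,x)\,dx=e^{-t\nu|\xi|^\alpha}$. Let $D$ be a $\beta$-stable subordinator independent of $X$ ($\mathbb{E}e^{-\lambda D_r}=e^{-r\lambda^\beta}$), $E_t=\inf\{r: D_r>t\}$ its first passage time with density $f_{E_t}$, and let $G_t(x)=\int_0^\infty p(s,x)f_{E_t}(s)\,ds$ be the density of $X_{E_t}$. $B(0,R)$ is the ball of radius $R$ centered at $0$ in $\mathbb{R}^d$. The noise $\dot F$ is centered Gaussian with $\mathbb{E}[\dot F(s,x)\dot F(t,y)]=\delta_0(t-s)f(x,y)$, where $f(x,y)\le g(x-y)$ and $g$ is a locally integrable function on $\mathbb{R}^d$ with a possible singularity at $0$ satisfying $\int_{\mathbb{R}^d}\frac{\hat g(\xi)}{1+|\xi|^\alpha}\,d\xi<\infty$ ($\hat g$ is the Fourier transform of $g$). The solution is understood as the mild solution in the sense of Walsh: $u$ is adapted to the filtration generated by the noise and satisfies $$u_t(x)=\int_{\mathbb{R}^d}G_t(x-y)u_0(y)\,dy+\int_{\mathbb{R}^d}\int_0^tG_{t-s}(x-y)\sigma(u_s(y))\,F(ds\,dy).$$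 *)

theory Defs
  imports "HOL-Probability.Probability"
begin

section \<open>The kernel \<open>G\<close>\<close>

text \<open>
  The transition density is only determined almost everywhere by its characteristic function;
  continuity selects the usual version.
\<close>

definition stable_density :: "real \<Rightarrow> real \<Rightarrow> (real \<Rightarrow> 'a::euclidean_space \<Rightarrow> real) \<Rightarrow> bool" where
  "stable_density \<nu> \<alpha> p \<longleftrightarrow>
     (\<forall>t>0. continuous_on UNIV (p t) \<and> (\<forall>x. 0 \<le> p t x) \<and> integrable lborel (p t) \<and>
       (\<forall>\<xi>. (\<integral>x. exp (\<i> * complex_of_real (\<xi> \<bullet> x)) * complex_of_real (p t x) \<partial>lborel)
             = complex_of_real (exp (- t * \<nu> * norm \<xi> powr \<alpha>))))"

definition stable_subordinator :: "'v measure \<Rightarrow> real \<Rightarrow> (real \<Rightarrow> 'v \<Rightarrow> real) \<Rightarrow> bool" where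
  "stable_subordinator N \<beta> D \<longleftrightarrow>
     prob_space N \<and>
     (\<forall>r\<ge>0. D r \<in> borel_measurable N) \<and>
     (AE \<omega> in N. D 0 \<omega> = 0 \<and> mono_on {0..} (\<lambda>r. D r \<omega>) \<and>
        (\<forall>r\<ge>0. continuous (at_right r) (\<lambda>r. D r \<omega>))) \<and>
     (\<forall>(\<tau> :: nat \<Rightarrow> real) n. 0 \<le> \<tau> 0 \<and> mono \<tau> \<longrightarrow>
        prob_space.indep_vars N (\<lambda>_. borel) (\<lambda>i \<omega>. D (\<tau> (Suc i)) \<omega> - D (\<tau> i) \<omega>) {..<n}) \<and>
     (\<forall>r\<ge>0. \<forall>h\<ge>0. distr N borel (\<lambda>\<omega>. D (r + h) \<omega> - D r \<omega>) = distr N borel (D h)) \<and>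
     (\<forall>r\<ge>0. \<forall>l\<ge>0. (\<integral>\<omega>. exp (- l * D r \<omega>) \<partial>N) = exp (- r * l powr \<beta>))"

definition first_passage :: "(real \<Rightarrow> 'v \<Rightarrow> real) \<Rightarrow> real \<Rightarrow> 'v \<Rightarrow> real" where
  "first_passage D t \<omega> = Inf {r. 0 \<le> r \<and> t < D r \<omega>}"

definition first_passage_density ::
  "'v measure \<Rightarrow> (real \<Rightarrow> 'v \<Rightarrow> real) \<Rightarrow> (real \<Rightarrow> real \<Rightarrow> real) \<Rightarrow> bool" where
  "first_passage_density N D fE \<longleftrightarrow>
     (\<forall>t>0. (\<forall>s. 0 \<le> fE t s) \<and>
        distributed N lborel (first_passage D t) (\<lambda>s. ennreal (fE t s)))"

text \<open>
  For \<open>d \<ge> \<alpha>\<close> the integral diverges at \<open>x = 0\<close>, where the formal value is then \<open>0\<close>. The kernel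
  is only ever integrated in \<open>x\<close>, so the value at this single point is irrelevant.
\<close>

definition time_changed_kernel ::
  "(real \<Rightarrow> 'a::euclidean_space \<Rightarrow> real) \<Rightarrow> (real \<Rightarrow> real \<Rightarrow> real) \<Rightarrow> real \<Rightarrow> 'a \<Rightarrow> real" where
  "time_changed_kernel p fE t x = (LINT s:{0<..}|lborel. p s x * fE t s)"


section \<open>Fourier transform of a locally integrable function\<close>

text \<open>
  A locally integrable function such as a Riesz kernel need not be integrable; its Fourier
  transform is taken in the sense of tempered distributions, by duality with Schwartz functions.
\<close>

primrec iter_deriv :: "'a::euclidean_space list \<Rightarrow> ('a \<Rightarrow> complex) \<Rightarrow> 'a \<Rightarrow> complex" where
  "iter_deriv [] \<phi> = \<phi>"
| "iter_deriv (b # bs) \<phi> = (\<lambda>x. frechet_derivative (iter_deriv bs \<phi>) (at x) b)"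

definition schwartz :: "('a::euclidean_space \<Rightarrow> complex) \<Rightarrow> bool" where
  "schwartz \<phi> \<longleftrightarrow>
     (\<forall>bs. set bs \<subseteq> Basis \<longrightarrow>
        (\<forall>x. iter_deriv bs \<phi> differentiable (at x)) \<and>
        (\<forall>k::nat. bounded (range (\<lambda>x. norm x ^ k *\<^sub>R iter_deriv bs \<phi> x))))"

definition fourier :: "('a::euclidean_space \<Rightarrow> complex) \<Rightarrow> 'a \<Rightarrow> complex" where
  "fourier \<phi> \<xi> = (\<integral>x. exp (- \<i> * complex_of_real (\<xi> \<bullet> x)) * \<phi> x \<partial>lborel)"

definition locally_integrable :: "('a::euclidean_space \<Rightarrow> real) \<Rightarrow> bool" where
  "locally_integrable g \<longleftrightarrow> (\<forall>C. compact C \<longrightarrow> set_integrable lborel C g)"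

definition is_fourier_transform ::
  "('a::euclidean_space \<Rightarrow> real) \<Rightarrow> ('a \<Rightarrow> complex) \<Rightarrow> bool" where
  "is_fourier_transform g g_hat \<longleftrightarrow>
     (\<forall>\<phi>. schwartz \<phi> \<longrightarrow>
        integrable lborel (\<lambda>x. complex_of_real (g x) * fourier \<phi> x) \<and>
        integrable lborel (\<lambda>\<xi>. g_hat \<xi> * \<phi> \<xi>) \<and>
        (\<integral>x. complex_of_real (g x) * fourier \<phi> x \<partial>lborel) = (\<integral>\<xi>. g_hat \<xi> * \<phi> \<xi> \<partial>lborel))"


section \<open>The noise\<close>

definition bounded_borel :: "'b::real_normed_vector set set" where
  "bounded_borel = {A \<in> sets borel. bounded A}"

definition noise_sets :: "(real \<times> 'a::euclidean_space) set set" where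
  "noise_sets = {B \<in> bounded_borel. B \<subseteq> {0..} \<times> UNIV}"

definition centered_gaussian :: "'w measure \<Rightarrow> ('w \<Rightarrow> real) \<Rightarrow> bool" where
  "centered_gaussian M Z \<longleftrightarrow>
     Z \<in> borel_measurable M \<and>
     ((AE \<omega> in M. Z \<omega> = 0) \<or> (\<exists>s>0. distributed M lborel Z (normal_density 0 s)))"

text \<open>
  The noise is the family of random variables \<open>F B\<close>, the integral of the generalised field over
  the bounded Borel set \<open>B\<close> of space-time. The formal covariance \<open>\<delta>\<^sub>0 (t - s) f (x, y)\<close>, integrated
  over \<open>A \<times> B\<close>, is the triple integral below. The correlation \<open>f\<close> may be singular on the
  diagonal (Riesz kernels), which is a null set of \<open>\<real>\<^sup>d \<times> \<real>\<^sup>d\<close>; its real value there carries no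
  information, and pointwise bounds on \<open>f\<close> are to be imposed off the diagonal.
\<close>

definition gaussian_noise ::
  "'w measure \<Rightarrow> ('a::euclidean_space \<Rightarrow> 'a \<Rightarrow> real) \<Rightarrow> ((real \<times> 'a) set \<Rightarrow> 'w \<Rightarrow> real) \<Rightarrow> bool" where
  "gaussian_noise M f F \<longleftrightarrow>
     prob_space M \<and>
     (\<forall>\<B> c. finite \<B> \<and> \<B> \<subseteq> noise_sets \<longrightarrow>
        centered_gaussian M (\<lambda>\<omega>. \<Sum>B\<in>\<B>. c B * F B \<omega>)) \<and>
     (\<forall>A\<in>noise_sets. \<forall>B\<in>noise_sets.
        (\<integral>\<omega>. F A \<omega> * F B \<omega> \<partial>M) =
        (\<integral>s. (\<integral>x. (\<integral>y. indicator A (s, x) * f x y * indicator B (s, y) \<partial>lborel) \<partial>lborel) \<partial>lborel))"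

text \<open>The filtration generated by the noise, augmented by the null sets.\<close>

definition noise_filtration ::
  "'w measure \<Rightarrow> ((real \<times> 'a::euclidean_space) set \<Rightarrow> 'w \<Rightarrow> real) \<Rightarrow> real \<Rightarrow> 'w measure" where
  "noise_filtration M F t =
     sigma (space M)
       ({F B -` S \<inter> space M | B S. B \<in> noise_sets \<and> B \<subseteq> {0..t} \<times> UNIV \<and> S \<in> sets borel}
        \<union> null_sets M)"


section \<open>The Walsh integral\<close>

text \<open>
  A simple process is a finite sum of terms \<open>X(\<omega>) 1\<^bsub>(a,b]\<^esub>(s) 1\<^bsub>A\<^esub>(y)\<close>, represented by the list of
  its data \<open>(a, b, A, X)\<close>, with \<open>X\<close> bounded and measurable with respect to the past up to time \<open>a\<close>.
\<close>

type_synonym ('a, 'w) simple_process = "(real \<times> real \<times> 'a set \<times> ('w \<Rightarrow> real)) list"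

definition simple_process ::
  "'w measure \<Rightarrow> ((real \<times> 'a::euclidean_space) set \<Rightarrow> 'w \<Rightarrow> real) \<Rightarrow> ('a, 'w) simple_process \<Rightarrow> bool" where
  "simple_process M F S \<longleftrightarrow>
     (\<forall>(a, b, A, X) \<in> set S.
        0 \<le> a \<and> a \<le> b \<and> A \<in> bounded_borel \<and>
        X \<in> borel_measurable (noise_filtration M F a) \<and> (\<exists>C. \<forall>\<omega>\<in>space M. \<bar>X \<omega>\<bar> \<le> C))"

definition simple_value :: "('a, 'w) simple_process \<Rightarrow> real \<Rightarrow> 'a \<Rightarrow> 'w \<Rightarrow> real" where
  "simple_value S s y \<omega> =
     (\<Sum>(a, b, A, X)\<leftarrow>S. X \<omega> * indicator {a<..b} s * indicator A y)"

definition simple_integral ::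
  "((real \<times> 'a) set \<Rightarrow> 'w \<Rightarrow> real) \<Rightarrow> ('a, 'w) simple_process \<Rightarrow> 'w \<Rightarrow> real" where
  "simple_integral F S \<omega> = (\<Sum>(a, b, A, X)\<leftarrow>S. X \<omega> * F ({a<..b} \<times> A) \<omega>)"

text \<open>The square of Walsh's norm, for the dominating measure \<open>\<bar>f (y, z)\<bar> dy dz ds\<close>.\<close>

definition walsh_norm2 ::
  "'w measure \<Rightarrow> ('a::euclidean_space \<Rightarrow> 'a \<Rightarrow> real) \<Rightarrow> (real \<Rightarrow> 'a \<Rightarrow> 'w \<Rightarrow> real) \<Rightarrow> ennreal" where
  "walsh_norm2 M f \<Phi> =
     (\<integral>\<^sup>+\<omega>. (\<integral>\<^sup>+s. (\<integral>\<^sup>+y. (\<integral>\<^sup>+z.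
        ennreal (\<bar>\<Phi> s y \<omega>\<bar> * \<bar>f y z\<bar> * \<bar>\<Phi> s z \<omega>\<bar>) \<partial>lborel) \<partial>lborel) \<partial>lborel) \<partial>M)"

text \<open>
  The integral of \<open>\<Phi>\<close> over \<open>(0, \<infinity>) \<times> \<real>\<^sup>d\<close> is the \<open>L\<^sup>2\<close> limit of the integrals of simple processes
  converging to \<open>\<Phi>\<close> in Walsh's norm; it is unique up to a null set. There is no further extension
  by localisation: for localised integrals the isometry fails.
\<close>

definition has_walsh_integral ::
  "'w measure \<Rightarrow> ('a::euclidean_space \<Rightarrow> 'a \<Rightarrow> real) \<Rightarrow> ((real \<times> 'a) set \<Rightarrow> 'w \<Rightarrow> real) \<Rightarrow>
   (real \<Rightarrow> 'a \<Rightarrow> 'w \<Rightarrow> real) \<Rightarrow> ('w \<Rightarrow> real) \<Rightarrow> bool" where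
  "has_walsh_integral M f F \<Phi> I \<longleftrightarrow>
     (\<lambda>(s, y, \<omega>). \<Phi> s y \<omega>) \<in> borel_measurable (borel \<Otimes>\<^sub>M borel \<Otimes>\<^sub>M M) \<and>
     walsh_norm2 M f \<Phi> < \<infinity> \<and>
     I \<in> borel_measurable M \<and>
     (\<exists>S. (\<forall>n. simple_process M F (S n)) \<and>
        (\<lambda>n. walsh_norm2 M f (\<lambda>s y \<omega>. simple_value (S n) s y \<omega> - \<Phi> s y \<omega>)) \<longlonglongrightarrow> 0 \<and>
        (\<lambda>n::nat. \<integral>\<^sup>+\<omega>. ennreal ((simple_integral F (S n) \<omega> - I \<omega>)\<^sup>2) \<partial>M) \<longlonglongrightarrow> 0)"


section \<open>Mild solutions\<close>

text \<open>
  For superlinear \<open>\<sigma>\<close> a solution may exist only up to a finite time, so \<open>u\<close> is considered on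
  \<open>(0, T) \<times> \<real>\<^sup>d\<close>; \<open>T = \<infinity>\<close> gives global solutions. By the isometry a solution has finite second
  moments wherever its Walsh integrals exist, so that an infinite second moment at a time before
  \<open>T\<close> means that no solution reaches that time.
\<close>

definition mild_solution ::
  "'w measure \<Rightarrow> ('a::euclidean_space \<Rightarrow> 'a \<Rightarrow> real) \<Rightarrow> ((real \<times> 'a) set \<Rightarrow> 'w \<Rightarrow> real) \<Rightarrow>
   (real \<Rightarrow> 'a \<Rightarrow> real) \<Rightarrow> (real \<Rightarrow> real) \<Rightarrow> ('a \<Rightarrow> real) \<Rightarrow> ereal \<Rightarrow>
   (real \<Rightarrow> 'a \<Rightarrow> 'w \<Rightarrow> real) \<Rightarrow> bool" where
  "mild_solution M f F G \<sigma> u0 T u \<longleftrightarrow>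
     (\<forall>t x. 0 < t \<and> ereal t < T \<longrightarrow>
        u t x \<in> borel_measurable (noise_filtration M F t) \<and>
        (\<exists>I. has_walsh_integral M f F
               (\<lambda>s y \<omega>. indicator {0<..<t} s * (G (t - s) (x - y) * \<sigma> (u s y \<omega>))) I \<and>
             (AE \<omega> in M. u t x \<omega> = (\<integral>y. G t (x - y) * u0 y \<partial>lborel) + I \<omega>)))"

end

theory Submission imports Defs "HOL-Real_Asymp.Real_Asymp" begin

text \<open>
  By the isometry a mild solution has finite second moments as long as it exists, so the claim is
  that for large \<open>\<kappa>\<close> no solution reaches \<open>t0\<close>. The isometry and the positivity of \<open>f\<close> and \<open>\<sigma>\<close> bound
  \<open>E \<bar>u\<^sub>t(x) u\<^sub>t(x')\<bar>\<close> from below by \<open>\<kappa>\<^sup>2 / 4\<close> plus the double kernel integral of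
  \<open>E \<bar>u\<^sub>s(y) u\<^sub>s(z)\<bar>\<^bsup>1 + \<gamma>\<^esup>\<close>. If the two-point moment is at least \<open>a n\<close> on a ball after a time \<open>\<tau> n\<close>,
  it is therefore at least a constant times \<open>(\<tau> (n + 1) - \<tau> n) (a n)\<^bsup>1 + \<gamma>\<^esup>\<close> on a smaller ball after
  time \<open>\<tau> (n + 1)\<close>, provided that the kernel keeps half of its mass within the gap of the two balls.
  Gaps and time steps can both be chosen geometric with finite total, and for large \<open>\<kappa>\<close> the
  recursion then drives \<open>a n\<close> to infinity before \<open>t0\<close>.

  For the isometry, a combination of the noise after time \<open>a\<close> is independent of the filtration at
  time \<open>a\<close>, being jointly Gaussian and uncorrelated with the past; and Walsh's norm controls the
  mixed form because \<open>f\<close> is positive definite, being a covariance.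
\<close>

section \<open>Stable densities\<close>

text \<open>The recursion runs on two-point moments because the noise correlates different points:
  the isometry expresses the moment at \<open>x\<close>, \<open>x'\<close> through moments at all
  pairs \<open>y\<close>, \<open>z\<close>, and the lower bound on \<open>f\<close> is a bound on
  pairs. Absolute values cost nothing, since \<open>E \<bar>X Y\<bar>\<close> dominates
  \<open>E X Y\<close>, and they let the power \<open>1 + \<gamma>\<close> split over a product. The
  time-changed process spreads over distances of order \<open>t powr (\<beta> / \<alpha>)\<close>.
  Halving the time step therefore shrinks the required gap by the factor
  \<open>2 powr (- \<beta> / \<alpha>)\<close>, which is below 1, while a growth ratio
  \<open>2 powr (1 / \<gamma>)\<close> compensates the halved step. Two obstacles shape the
  preparations. The density \<open>p\<close> is known only through its Fourier transform at each
  fixed time and its continuity in space; both its joint measurability, which Tonelli requires, and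
  its mass in a ball are extracted by Gaussian smoothing. The noise is known only through Gaussian
  laws and covariances; additivity over time intervals, symmetry of spatial covariances and
  independence of the past are all derived from these.\<close>

lemmas LINT_cong = Bochner_Integration.integral_cong[OF refl]

lemma sum_Basis_squares: "(\<Sum>b\<in>Basis. - (x \<bullet> b)\<^sup>2 / 2) = - (norm x)\<^sup>2 / 2"
  unfolding power2_norm_eq_inner
  by (subst euclidean_inner) (simp add: sum_negf sum_divide_distrib power2_eq_square)

text \<open>The standard normal density on the Euclidean space. In product form its integral and its
  Fourier transform factor over coordinates; \<open>gauss_eq\<close> gives the radial form.\<close>

definition gauss :: "'a::euclidean_space \<Rightarrow> real" where
  "gauss x = (\<Prod>b\<in>Basis. std_normal_density (x \<bullet> b))"

lemma gauss_nonneg: "0 \<le> gauss x"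
  by (auto simp: gauss_def intro!: prod_nonneg)

lemma borel_measurable_gauss[measurable]: "gauss \<in> borel_measurable borel"
  unfolding gauss_def[abs_def] by measurable

lemma nn_integral_gauss: "(\<integral>\<^sup>+(x::'a::euclidean_space). ennreal (gauss x) \<partial>lborel) = 1"
proof -
  have "(\<integral>\<^sup>+(x::'a). ennreal (gauss x) \<partial>lborel)
      = (\<integral>\<^sup>+(x::'a). (\<Prod>b\<in>Basis. ennreal (std_normal_density (x \<bullet> b))) \<partial>lborel)"
    by (simp add: gauss_def prod_ennreal)
  also have "\<dots> = (\<Prod>b\<in>(Basis::'a set). (\<integral>\<^sup>+x. ennreal (std_normal_density x) \<partial>lborel))"
    by (rule nn_integral_lborel_prod) auto
  also have "(\<integral>\<^sup>+x. ennreal (std_normal_density x) \<partial>lborel) = 1"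
    by (subst nn_integral_eq_integral) auto
  finally show ?thesis by simp
qed

lemma integrable_gauss: "integrable lborel (gauss :: 'a::euclidean_space \<Rightarrow> real)"
  by (rule integrableI_nonneg) (auto simp: gauss_nonneg nn_integral_gauss)

lemma integral_gauss: "(LINT x|lborel. gauss (x::'a::euclidean_space)) = 1"
  by (simp add: integral_eq_nn_integral nn_integral_gauss gauss_nonneg)

lemma char_gauss:
  fixes x :: "'a::euclidean_space"
  shows "(LINT \<xi>|lborel. exp (\<i> * of_real (\<xi> \<bullet> x)) * of_real (gauss \<xi>))
       = complex_of_real (exp (- (norm x)\<^sup>2 / 2))"
proof -
  interpret product_sigma_finite "\<lambda>b::'a. lborel :: real measure" ..
  define h where "h b r = exp (\<i> * of_real (r * (x \<bullet> b))) * of_real (std_normal_density r)"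
    for b :: 'a and r :: real
  have [measurable]: "h b \<in> borel_measurable borel" for b
    unfolding h_def by measurable
  have int: "integrable lborel (h b)" for b
    unfolding h_def
    by (rule Bochner_Integration.integrable_bound[where f="std_normal_density"])
       (auto simp: norm_mult integrable_normal_density)
  have ih: "(LINT r|lborel. h b r) = complex_of_real (exp (- (x \<bullet> b)\<^sup>2 / 2))" for b
  proof -
    have "char std_normal_distribution (x \<bullet> b) = (LINT r|lborel. h b r)"
      unfolding char_def h_def
      by (subst integral_density) (auto simp: scaleR_conv_of_real mult_ac intro!: Bochner_Integration.integral_cong)
    then show ?thesis by (simp add: char_std_normal_distribution)
  qed
  have "(LINT \<xi>|lborel. exp (\<i> * of_real (\<xi> \<bullet> x)) * of_real (gauss \<xi>))
     = (LINT \<xi>|lborel. (\<Prod>b\<in>Basis. h b (\<xi> \<bullet> b)))"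
  proof (intro LINT_cong)
    fix \<xi> :: 'a
    have "exp (\<i> * of_real (\<xi> \<bullet> x)) = exp (\<Sum>b\<in>Basis. \<i> * of_real ((\<xi> \<bullet> b) * (x \<bullet> b)))"
      by (subst euclidean_inner) (simp add: sum_distrib_left)
    then show "exp (\<i> * of_real (\<xi> \<bullet> x)) * of_real (gauss \<xi>) = (\<Prod>b\<in>Basis. h b (\<xi> \<bullet> b))"
      by (simp add: h_def gauss_def prod.distrib exp_sum)
  qed
  also have "\<dots> = (LINT w|(\<Pi>\<^sub>M b\<in>Basis. lborel). (\<Prod>b\<in>Basis. h b (w b)))"
    by (subst lborel_eq, subst integral_distr)
       (auto intro!: Bochner_Integration.integral_cong prod.cong simp: space_PiM)
  also have "\<dots> = (\<Prod>b\<in>Basis. LINT r|lborel. h b r)"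
    by (rule product_integral_prod) (auto intro: int)
  also have "\<dots> = complex_of_real (exp (\<Sum>b\<in>Basis. - (x \<bullet> b)\<^sup>2 / 2))"
    by (simp add: ih exp_sum)
  finally show ?thesis unfolding sum_Basis_squares .
qed

lemma gauss_eq: "gauss (x::'a::euclidean_space) = gauss (0::'a) * exp (- (norm x)\<^sup>2 / 2)"
proof -
  have "gauss x = (\<Prod>b\<in>Basis. std_normal_density 0 * exp (- (x \<bullet> b)\<^sup>2 / 2))"
    unfolding gauss_def by (intro prod.cong) (auto simp: std_normal_density_def)
  also have "\<dots> = gauss (0::'a) * exp (\<Sum>b\<in>Basis. - (x \<bullet> b)\<^sup>2 / 2)"
    by (simp add: gauss_def prod.distrib exp_sum)
  finally show ?thesis unfolding sum_Basis_squares .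
qed

text \<open>By Fubini, smoothing \<open>p t\<close> with a Gaussian only involves its Fourier transform.\<close>

lemma stable_density_gauss:
  fixes p :: "real \<Rightarrow> 'a::euclidean_space \<Rightarrow> real"
  assumes p: "stable_density \<nu> \<alpha> p" and t: "0 < t"
  shows "complex_of_real (LINT y|lborel. p t y * exp (- (norm (e *\<^sub>R (y - x)))\<^sup>2 / 2))
       = (LINT \<xi>|lborel. complex_of_real (gauss \<xi> * exp (- t * \<nu> * norm (e *\<^sub>R \<xi>) powr \<alpha>))
               * exp (- \<i> * of_real (e * (\<xi> \<bullet> x))))" (is "_ = ?R")
    and "integrable lborel (\<lambda>y. p t y * exp (- (norm (e *\<^sub>R (y - x)))\<^sup>2 / 2))"
proof -
  let ?e = "\<lambda>\<xi>. exp (- \<i> * of_real (e * (\<xi> \<bullet> x)))" and ?n = "\<lambda>y. exp (- (norm (e *\<^sub>R (y - x)))\<^sup>2 / 2)"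
  have int: "integrable lborel (p t)" and nn: "\<And>x. 0 \<le> p t x"
    and ch: "\<And>\<xi>. (LINT x|lborel. exp (\<i> * of_real (\<xi> \<bullet> x)) * of_real (p t x))
             = complex_of_real (exp (- t * \<nu> * norm \<xi> powr \<alpha>))"
    using p t by (auto simp: stable_density_def)
  have [measurable]: "p t \<in> borel_measurable borel"
    using borel_measurable_integrable[OF int] by simp
  define H where "H y \<xi> = complex_of_real (p t y) * (exp (\<i> * of_real (\<xi> \<bullet> (e *\<^sub>R (y - x)))) * of_real (gauss \<xi>))"
    for y \<xi>
  have [measurable]: "(\<lambda>(y, \<xi>). H y \<xi>) \<in> borel_measurable (lborel \<Otimes>\<^sub>M lborel)"
    unfolding H_def by measurable
  have nH: "norm (H y \<xi>) = p t y * gauss \<xi>" for y \<xi>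
    by (simp add: H_def norm_mult nn gauss_nonneg)
  have intH: "integrable (lborel \<Otimes>\<^sub>M lborel) (\<lambda>(y, \<xi>). H y \<xi>)"
  proof (rule integrableI_bounded)
    have "(\<integral>\<^sup>+z. ennreal (norm (case z of (y, \<xi>) \<Rightarrow> H y \<xi>)) \<partial>(lborel \<Otimes>\<^sub>M lborel))
       = (\<integral>\<^sup>+y. \<integral>\<^sup>+(\<xi>::'a). ennreal (p t y) * ennreal (gauss \<xi>) \<partial>lborel \<partial>lborel)"
      by (subst lborel.nn_integral_fst[symmetric])
         (auto simp: nH ennreal_mult nn gauss_nonneg)
    also have "\<dots> = (\<integral>\<^sup>+y. ennreal (p t y) \<partial>lborel)"
      by (simp add: nn_integral_cmult nn_integral_gauss)
    also have "\<dots> < \<infinity>"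
      using int nn by (subst nn_integral_eq_integral) auto
    finally show "(\<integral>\<^sup>+z. ennreal (norm (case z of (y, \<xi>) \<Rightarrow> H y \<xi>)) \<partial>(lborel \<Otimes>\<^sub>M lborel)) < \<infinity>" .
  qed measurable
  have "complex_of_real (LINT y|lborel. p t y * ?n y)
      = (LINT y|lborel. complex_of_real (p t y) * of_real (?n y))"
    by (subst integral_complex_of_real[symmetric]) (simp only: of_real_mult)
  \<comment> \<open>The Gaussian weight is replaced by its own Fourier integral
    (\<open>char_gauss\<close>). In the other order of integration, the inner integral is the
    Fourier transform of \<open>p t\<close> at \<open>e *\<^sub>R \<xi>\<close>.\<close>
  also have "\<dots> = (LINT y|lborel. LINT \<xi>|lborel. H y \<xi>)"
    unfolding H_def char_gauss[symmetric]
    by (subst integral_mult_right_zero) simp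
  also have "\<dots> = (LINT \<xi>|lborel. LINT y|lborel. H y \<xi>)"
    using lborel_pair.Fubini_integral[OF intH] by simp
  also have "\<dots> = ?R"
  proof (intro LINT_cong)
    fix \<xi>
    have "(LINT y|lborel. H y \<xi>) = (LINT y|lborel. (complex_of_real (gauss \<xi>) * ?e \<xi>) *
         (exp (\<i> * of_real ((e *\<^sub>R \<xi>) \<bullet> y)) * of_real (p t y)))"
      unfolding H_def
      by (intro LINT_cong)
         (simp add: inner_diff_right ring_distribs exp_diff exp_minus divide_inverse)
    also have "\<dots> = (complex_of_real (gauss \<xi>) * ?e \<xi>) *
        complex_of_real (exp (- t * \<nu> * norm (e *\<^sub>R \<xi>) powr \<alpha>))"
      by (subst integral_mult_right_zero) (simp only: ch)
    finally show "(LINT y|lborel. H y \<xi>) = complex_of_real (gauss \<xi> * exp (- t * \<nu> * norm (e *\<^sub>R \<xi>) powr \<alpha>))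
               * ?e \<xi>" by simp
  qed
  finally show "complex_of_real (LINT y|lborel. p t y * ?n y) = \<dots>" .
  show "integrable lborel (\<lambda>y. p t y * ?n y)"
    by (rule Bochner_Integration.integrable_bound[OF int])
       (auto simp: nn abs_mult intro!: mult_left_le)
qed

lemma lborel_integral_affine:
  fixes F :: "'a::euclidean_space \<Rightarrow> real"
  assumes [measurable]: "F \<in> borel_measurable borel" and c: "0 < c"
  shows "(LINT y|lborel. F y) = (LINT z|lborel. c ^ DIM('a) * F (t + c *\<^sub>R z))"
proof -
  have "(LINT y|lborel. F y)
      = (\<integral>y. F y \<partial>density (distr lborel borel (\<lambda>z. t + c *\<^sub>R z)) (\<lambda>_. ennreal (\<bar>c\<bar> ^ DIM('a))))"
    by (subst lborel_affine[of c t]) (use c in simp_all)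
  also have "\<dots> = (LINT z|lborel. c ^ DIM('a) * F (t + c *\<^sub>R z))"
    using c by (subst integral_density; measurable?; subst integral_distr; measurable?; simp)
  finally show ?thesis .
qed

lemma stable_densityD:
  assumes "stable_density \<nu> \<alpha> p" "0 < t"
  shows stable_density_nonneg: "0 \<le> p t x"
    and stable_density_integrable: "integrable lborel (p t)"
    and stable_density_continuous: "continuous_on UNIV (p t)"
    and stable_density_integral: "(LINT x|lborel. p t x) = 1"
proof -
  show "0 \<le> p t x" "integrable lborel (p t)" "continuous_on UNIV (p t)"
    using assms by (auto simp: stable_density_def)
  have "\<forall>\<xi>. (LINT x|lborel. exp (\<i> * of_real (\<xi> \<bullet> x)) * of_real (p t x))
      = complex_of_real (exp (- t * \<nu> * norm \<xi> powr \<alpha>))"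
    using assms by (auto simp: stable_density_def)
  \<comment> \<open>At frequency 0 the Fourier transform is the total mass; since
    \<open>0 powr \<alpha> = 0\<close>, its value is 1.\<close>
  from this[rule_format, of 0] have "complex_of_real (LINT x|lborel. p t x) = complex_of_real 1"
    by simp
  then show "(LINT x|lborel. p t x) = 1"
    using of_real_eq_iff by blast
qed

text \<open>The functions \<open>c ^ DIM('a) * gauss (c *\<^sub>R (y - x))\<close> form an
  approximate identity as \<open>c\<close> grows, and \<open>p t\<close> is continuous. By
  \<open>stable_density_gauss\<close> the approximants are explicit integrals of the Fourier
  transform, so \<open>p\<close> becomes a limit of functions that are visibly measurable in time
  and space.\<close>

lemma stable_density_LIMSEQ:
  fixes p :: "real \<Rightarrow> 'a::euclidean_space \<Rightarrow> real"
  assumes p: "stable_density \<nu> \<alpha> p" and t: "0 < t"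
  shows "(\<lambda>n. real (Suc n) ^ DIM('a) * gauss (0::'a) *
            (LINT y|lborel. p t y * exp (- (norm (real (Suc n) *\<^sub>R (y - x)))\<^sup>2 / 2))) \<longlonglongrightarrow> p t x"
proof -
  note int = stable_density_integrable[OF p t] and nn = stable_density_nonneg[OF p t]
  have [measurable]: "p t \<in> borel_measurable borel"
    using borel_measurable_integrable[OF int] by simp
  define c where "c n = real (Suc n)" for n
  have c: "0 < c n" for n by (simp add: c_def)
  \<comment> \<open>No global bound on \<open>p t\<close> is at hand, so the integral is split at
    distance \<open>1 / sqrt (c n)\<close> from \<open>x\<close>. Inside, \<open>p t\<close> is
    bounded by its maximum on \<open>cball x 1\<close> and dominated convergence applies after
    rescaling; outside, the Gaussian is at most \<open>gauss 0 * exp (- c n / 2)\<close>, which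
    beats the factor \<open>c n ^ DIM('a)\<close>.\<close>
  define U where "U n = {y. (norm (c n *\<^sub>R (y - x)))\<^sup>2 < c n}" for n
  have [measurable]: "U n \<in> sets borel" for n unfolding U_def by measurable
  define g where "g n y = p t y * gauss (c n *\<^sub>R (y - x))" for n y
  have [measurable]: "g n \<in> borel_measurable borel" for n unfolding g_def by measurable
  have g_nn: "0 \<le> g n y" for n y unfolding g_def by (simp add: nn gauss_nonneg)
  have ig: "integrable lborel (g n)" for n
    unfolding g_def
  proof (rule Bochner_Integration.integrable_bound[OF integrable_mult_left[OF int, of "gauss (0::'a)"]])
    show "AE y in lborel. norm (p t y * gauss (c n *\<^sub>R (y - x))) \<le> norm (p t y * gauss (0::'a))"
    proof (intro AE_I2)
      fix y
      have "gauss (c n *\<^sub>R (y - x)) \<le> gauss (0::'a)"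
        unfolding gauss_eq[of "c n *\<^sub>R (y - x)"] by (intro mult_left_le) (auto simp: gauss_nonneg)
      then show "norm (p t y * gauss (c n *\<^sub>R (y - x))) \<le> norm (p t y * gauss (0::'a))"
        by (simp add: abs_mult nn gauss_nonneg mult_left_mono)
    qed
  qed measurable
  let ?u = "\<lambda>n. LINT y|lborel. indicator (U n) y * g n y" and ?v = "\<lambda>n. LINT y|lborel. indicator (- U n) y * g n y"
  let ?h = "\<lambda>n z. indicator {z. (norm z)\<^sup>2 < c n} z * (p t (x + (1 / c n) *\<^sub>R z) * gauss z)"
  let ?d = "DIM('a)" and ?g = "gauss (0::'a)"
  have ig1: "integrable lborel (\<lambda>y. indicator (U n) y * g n y)" for n
    by (rule Bochner_Integration.integrable_bound[OF ig[of n]]) (auto simp: indicator_def)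
  have ig2: "integrable lborel (\<lambda>y. indicator (- U n) y * g n y)" for n
    by (rule Bochner_Integration.integrable_bound[OF ig[of n]]) (auto simp: indicator_def)
  have "(\<lambda>n. c n ^ ?d * ?u n) \<longlonglongrightarrow> p t x"
  proof -
    have eq: "c n ^ ?d * ?u n
        = (LINT z|lborel. ?h n z)" for n
    proof -
      have "?u n
          = (LINT z|lborel. (1 / c n) ^ ?d * (indicator (U n) (x + (1 / c n) *\<^sub>R z) * g n (x + (1 / c n) *\<^sub>R z)))"
        using c[of n] by (intro lborel_integral_affine) auto
      also have "\<dots> = (1 / c n) ^ ?d * (LINT z|lborel. ?h n z)"
        using c[of n] unfolding g_def U_def
        by (subst integral_mult_right_zero) (simp add: indicator_def)
      finally show ?thesis using c[of n] by (simp add: power_divide)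
    qed
    obtain B where B: "\<And>y. y \<in> cball x 1 \<Longrightarrow> p t y \<le> B"
    proof -
      have "compact (p t ` cball x 1)"
        by (intro compact_continuous_image continuous_on_subset[OF stable_density_continuous[OF p t]]) auto
      then have "bdd_above (p t ` cball x 1)"
        by (intro bounded_imp_bdd_above compact_imp_bounded)
      then obtain B where "\<forall>y\<in>cball x 1. p t y \<le> B" by (auto simp: bdd_above_def)
      then show ?thesis using that by blast
    qed
    have "(\<lambda>n. LINT z|lborel. ?h n z)
       \<longlonglongrightarrow> (LINT (z::'a)|lborel. p t x * gauss z)"
    proof (rule integral_dominated_convergence[where w="\<lambda>z. B * gauss z"])
      show "integrable lborel (\<lambda>z. B * gauss (z::'a))" using integrable_gauss by auto
      show "AE z in lborel. (\<lambda>n. ?h n z) \<longlonglongrightarrow> p t x * gauss z"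
      proof (intro AE_I2)
        fix z :: 'a
        have l: "(\<lambda>n. x + (1 / c n) *\<^sub>R z) \<longlonglongrightarrow> x + 0 *\<^sub>R z"
          unfolding c_def by (intro tendsto_intros LIMSEQ_Suc[OF lim_1_over_n])
        have "(\<lambda>n. p t (x + (1 / c n) *\<^sub>R z)) \<longlonglongrightarrow> p t x"
          using continuous_on_tendsto_compose[OF stable_density_continuous[OF p t] l] by simp
        then have "(\<lambda>n. p t (x + (1 / c n) *\<^sub>R z) * gauss z) \<longlonglongrightarrow> p t x * gauss z"
          by (intro tendsto_intros)
        moreover have "\<forall>\<^sub>F n in sequentially. (norm z)\<^sup>2 < c n"
        proof -
          obtain m where "(norm z)\<^sup>2 < real m" using reals_Archimedean2 by blast
          then have "\<forall>n\<ge>m. (norm z)\<^sup>2 < c n" by (auto simp: c_def)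
          then show ?thesis by (auto simp: eventually_sequentially)
        qed
        then have "\<forall>\<^sub>F n in sequentially. p t (x + (1 / c n) *\<^sub>R z) * gauss z
            = ?h n z"
          by eventually_elim auto
        ultimately show "(\<lambda>n. ?h n z) \<longlonglongrightarrow> p t x * gauss z"
          by (rule Lim_transform_eventually)
      qed
      show "AE z in lborel. norm (?h n z) \<le> B * gauss z" for n
      proof (intro AE_I2)
        fix z :: 'a
        have "p t x \<le> B" by (rule B) auto
        then have B0: "0 \<le> B" using nn[of x] by linarith
        show "norm (?h n z) \<le> B * gauss z"
        proof (cases "(norm z)\<^sup>2 < c n")
          case True
          also have "c n \<le> (c n)\<^sup>2" by (simp add: c_def power2_eq_square)
          finally have "norm z < c n" using c[of n] by (simp add: power_less_imp_less_base)
          then have "x + (1 / c n) *\<^sub>R z \<in> cball x 1"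
            using c[of n] by (simp add: dist_norm field_simps)
          from B[OF this] show ?thesis using True nn gauss_nonneg[of z]
            by (auto simp: abs_mult intro!: mult_right_mono)
        qed (auto simp: B0 gauss_nonneg)
      qed
    qed measurable
    also have "(LINT (z::'a)|lborel. p t x * gauss z) = p t x"
      by (simp add: integral_gauss)
    finally show ?thesis by (simp add: eq)
  qed
  moreover have "(\<lambda>n. c n ^ ?d * ?v n) \<longlonglongrightarrow> 0"
  proof (rule tendsto_sandwich[OF _ _ tendsto_const])
    show "\<forall>\<^sub>F n in sequentially. 0 \<le> c n ^ ?d * ?v n"
      using c g_nn by (auto intro!: always_eventually mult_nonneg_nonneg simp: less_imp_le)
    show "\<forall>\<^sub>F n in sequentially. c n ^ ?d * ?v n
        \<le> ?g * (c n ^ ?d * exp (- c n / 2))"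
    proof (intro always_eventually allI)
      fix n
      have "?v n \<le> (LINT y|lborel. p t y * (?g * exp (- c n / 2)))"
      proof (rule integral_mono[OF ig2])
        show "integrable lborel (\<lambda>y. p t y * (?g * exp (- c n / 2)))" using int by auto
        fix y show "indicator (- U n) y * g n y \<le> p t y * (?g * exp (- c n / 2))"
          unfolding g_def gauss_eq[of "c n *\<^sub>R (y - x)"]
          by (auto simp: U_def indicator_def nn gauss_nonneg intro!: mult_left_mono)
      qed
      also have "\<dots> = ?g * exp (- c n / 2)"
        by (simp add: stable_density_integral[OF p t])
      finally have "c n ^ ?d * ?v n
          \<le> c n ^ ?d * (?g * exp (- c n / 2))"
        using c[of n] by (intro mult_left_mono) auto
      then show "c n ^ ?d * ?v n
        \<le> ?g * (c n ^ ?d * exp (- c n / 2))" by (simp add: mult_ac)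
    qed
    have "(\<lambda>n. real n ^ ?d * exp (- real n / 2)) \<longlonglongrightarrow> 0"
      by real_asymp
    from tendsto_mult_right_zero[OF LIMSEQ_Suc[OF this], of "?g"]
    show "(\<lambda>n. ?g * (c n ^ ?d * exp (- c n / 2))) \<longlonglongrightarrow> 0"
      by (simp add: c_def)
  qed
  ultimately have "(\<lambda>n. c n ^ ?d * ?u n + c n ^ ?d * ?v n) \<longlonglongrightarrow> p t x + 0"
    by (rule tendsto_add)
  also have "(\<lambda>n. c n ^ ?d * ?u n + c n ^ ?d * ?v n) = (\<lambda>n. c n ^ ?d * (LINT y|lborel. g n y))"
  proof
    fix n
    have "?u n + ?v n = (LINT y|lborel. indicator (U n) y * g n y + indicator (- U n) y * g n y)"
      by (rule Bochner_Integration.integral_add[OF ig1 ig2, symmetric])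
    also have "\<dots> = (LINT y|lborel. g n y)"
      by (intro Bochner_Integration.integral_cong) (auto simp: indicator_def)
    finally show "c n ^ ?d * ?u n + c n ^ ?d * ?v n = c n ^ ?d * (LINT y|lborel. g n y)"
      by (simp only: distrib_left[symmetric])
  qed
  also have "\<dots> = (\<lambda>n. real (Suc n) ^ ?d * ?g *
            (LINT y|lborel. p t y * exp (- (norm (real (Suc n) *\<^sub>R (y - x)))\<^sup>2 / 2)))"
    unfolding g_def c_def by (subst gauss_eq) (simp add: mult_ac)
  finally show ?thesis by simp
qed

text \<open>\<open>stable_density\<close> gives regularity in space for each separate time only.
  Joint measurability comes from the smoothed densities \<open>W n\<close>, whose integrands depend
  measurably on \<open>t\<close> and \<open>x\<close> together.\<close>

lemma borel_measurable_stable_density: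
  fixes p :: "real \<Rightarrow> 'a::euclidean_space \<Rightarrow> real"
  assumes p: "stable_density \<nu> \<alpha> p"
  shows "(\<lambda>(t, x). indicator {0<..} t * p t x) \<in> borel_measurable (borel \<Otimes>\<^sub>M borel)"
proof -
  define W where "W n t x = (LINT \<xi>|lborel. complex_of_real (gauss \<xi> * exp (- t * \<nu> * norm (real (Suc n) *\<^sub>R \<xi>) powr \<alpha>))
               * exp (- \<i> * of_real (real (Suc n) * (\<xi> \<bullet> x))))" for n t and x :: 'a
  have [measurable]: "(\<lambda>(t, x). W n t x) \<in> borel_measurable (borel \<Otimes>\<^sub>M borel)" for n
    unfolding W_def by measurable
  have "(\<lambda>z. indicator {0<..} (fst z) * p (fst z) (snd z)) \<in> borel_measurable (borel \<Otimes>\<^sub>M borel)"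
  proof (rule borel_measurable_LIMSEQ_real)
    show "(\<lambda>n. indicator {0<..} (fst z) * (real (Suc n) ^ DIM('a) * gauss (0::'a) * Re (W n (fst z) (snd z))))
        \<longlonglongrightarrow> indicator {0<..} (fst z) * p (fst z) (snd z)" for z
    proof (cases "0 < fst z")
      case True
      have "W n (fst z) (snd z) = complex_of_real (LINT y|lborel. p (fst z) y * exp (- (norm (real (Suc n) *\<^sub>R (y - snd z)))\<^sup>2 / 2))" for n
        unfolding W_def using stable_density_gauss(1)[OF p True, where e="real (Suc n)" and x="snd z"] by simp
      then show ?thesis using stable_density_LIMSEQ[OF p True, of "snd z"] True by simp
    qed simp
  qed measurable
  then show ?thesis by (simp add: case_prod_beta')
qed

text \<open>Scaling \<open>\<xi>\<close> by \<open>e = 2 / \<rho>\<close> in the Gaussian average of \<open>exp (- t \<nu> \<bar>\<xi>\<bar>\<^sup>\<alpha>)\<close> controls the mass of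
  \<open>p t\<close> outside the ball of radius \<open>\<rho>\<close>, since there \<open>exp (- \<bar>e y\<bar>\<^sup>2 / 2) \<le> 1 / 2\<close>.\<close>

lemma stable_density_ball:
  fixes p :: "real \<Rightarrow> 'a::euclidean_space \<Rightarrow> real"
  assumes p: "stable_density \<nu> \<alpha> p" and "0 < \<nu>" "0 < \<alpha>"
  obtains \<delta> where "0 < \<delta>"
    "\<And>t \<rho>. 0 < t \<Longrightarrow> 0 < \<rho> \<Longrightarrow> t \<le> \<delta> * \<rho> powr \<alpha> \<Longrightarrow> 3 / 4 \<le> (\<integral>\<^sup>+y. ennreal (p t y) * indicator (ball 0 \<rho>) y \<partial>lborel)"
proof -
  define h where "h \<tau> = (LINT (\<xi>::'a)|lborel. gauss \<xi> * exp (- \<tau> * norm \<xi> powr \<alpha>))" for \<tau>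
  have le: "norm (gauss \<xi> * exp (- \<tau> * norm \<xi> powr \<alpha>)) \<le> norm (gauss \<xi>)" if "0 \<le> \<tau>" for \<tau> and \<xi> :: 'a
    using that by (auto simp: abs_mult gauss_nonneg intro!: mult_left_le)
  have ih: "integrable lborel (\<lambda>\<xi>::'a. gauss \<xi> * exp (- \<tau> * norm \<xi> powr \<alpha>))" if "0 \<le> \<tau>" for \<tau>
    using le[OF that] by (intro Bochner_Integration.integrable_bound[OF integrable_gauss]) auto
  have "(\<lambda>n. h (1 / real (Suc n))) \<longlonglongrightarrow> (LINT (\<xi>::'a)|lborel. gauss \<xi>)"
    unfolding h_def
  proof (rule integral_dominated_convergence[where w=gauss])
    show "integrable lborel (gauss :: 'a \<Rightarrow> real)" by (rule integrable_gauss)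
    show "AE \<xi>::'a in lborel. (\<lambda>n. gauss \<xi> * exp (- (1 / real (Suc n)) * norm \<xi> powr \<alpha>)) \<longlonglongrightarrow> gauss \<xi>"
    proof (intro AE_I2)
      fix \<xi> :: 'a
      have "(\<lambda>n. gauss \<xi> * exp (- (1 / real (Suc n)) * norm \<xi> powr \<alpha>)) \<longlonglongrightarrow> gauss \<xi> * exp (- 0 * norm \<xi> powr \<alpha>)"
        by (intro tendsto_intros LIMSEQ_Suc[OF lim_1_over_n])
      then show "(\<lambda>n. gauss \<xi> * exp (- (1 / real (Suc n)) * norm \<xi> powr \<alpha>)) \<longlonglongrightarrow> gauss \<xi>" by simp
    qed
    show "AE \<xi>::'a in lborel. norm (gauss \<xi> * exp (- (1 / real (Suc n)) * norm \<xi> powr \<alpha>)) \<le> gauss \<xi>" for n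
      using le[of "1 / real (Suc n)"] by (intro AE_I2) (simp add: gauss_nonneg)
  qed measurable
  \<comment> \<open>The threshold \<open>7 / 8\<close> is chosen because
    \<open>2 * (7 / 8) - 1 = 3 / 4\<close>.\<close>
  then have "\<forall>\<^sub>F n in sequentially. 7 / 8 < h (1 / real (Suc n))"
    by (intro order_tendstoD) (auto simp: integral_gauss)
  then obtain m where m: "7 / 8 < h (1 / real (Suc m))"
    by (auto simp: eventually_sequentially)
  \<comment> \<open>With \<open>e = 2 / \<rho>\<close>, the condition
    \<open>t \<le> \<delta> * \<rho> powr \<alpha>\<close> says exactly that
    \<open>t * \<nu> * e powr \<alpha> \<le> 1 / real (Suc m)\<close>.\<close>
  define \<delta> where "\<delta> = 1 / (real (Suc m) * \<nu> * 2 powr \<alpha>)"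
  show ?thesis
  proof (rule that)
    show "0 < \<delta>" using assms by (simp add: \<delta>_def)
    fix t \<rho> :: real assume t: "0 < t" and \<rho>: "0 < \<rho>" and le: "t \<le> \<delta> * \<rho> powr \<alpha>"
    note int = stable_density_integrable[OF p t] and nn = stable_density_nonneg[OF p t]
    have [measurable]: "p t \<in> borel_measurable borel"
      using borel_measurable_integrable[OF int] by simp
    define e where "e = 2 / \<rho>"
    define \<tau> where "\<tau> = t * \<nu> * e powr \<alpha>"
    have \<tau>0: "0 \<le> \<tau>" using assms t \<rho> by (auto simp: \<tau>_def)
    have "\<tau> \<le> \<delta> * \<rho> powr \<alpha> * \<nu> * e powr \<alpha>"
      unfolding \<tau>_def using assms by (intro mult_right_mono le) auto
    also have "\<dots> = 1 / real (Suc m)"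
      using assms \<rho> by (simp add: \<delta>_def e_def powr_divide)
    finally have \<tau>1: "\<tau> \<le> 1 / real (Suc m)" .
    have "h (1 / real (Suc m)) \<le> h \<tau>"
      unfolding h_def
      by (rule integral_mono[OF ih ih])
         (use \<tau>0 \<tau>1 in \<open>auto intro!: mult_left_mono gauss_nonneg mult_right_mono simp del: times_divide_eq_left mult_minus_left\<close>)
    let ?q = "\<lambda>y. exp (- (norm (e *\<^sub>R (y - 0)))\<^sup>2 / 2)"
    have "complex_of_real (LINT y|lborel. p t y * ?q y)
       = (LINT (\<xi>::'a)|lborel. complex_of_real (gauss \<xi> * exp (- t * \<nu> * norm (e *\<^sub>R \<xi>) powr \<alpha>)))"
      using stable_density_gauss(1)[OF p t, where e=e and x=0] by simp
    also have "\<dots> = complex_of_real (h \<tau>)"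
      unfolding h_def using \<rho> by (subst integral_complex_of_real)
         (simp add: \<tau>_def e_def powr_mult powr_divide mult_ac)
    finally have eq: "(LINT y|lborel. p t y * ?q y) = h \<tau>"
      using of_real_eq_iff by blast
    have iq: "integrable lborel (\<lambda>y. p t y * ?q y)" by (rule stable_density_gauss(2)[OF p t])
    have ib: "integrable lborel (\<lambda>y. p t y * indicator (ball 0 \<rho>) y)"
      by (rule Bochner_Integration.integrable_bound[OF int]) (auto simp: indicator_def)
    \<comment> \<open>The function \<open>2 * ?q y - 1\<close> lies below the indicator of the ball:
      it is at most 1 everywhere, and at most 0 outside, where
      \<open>?q y \<le> 1 / 2\<close>.\<close>
    have "3 / 4 \<le> 2 * h \<tau> - 1" using m \<open>h (1 / real (Suc m)) \<le> h \<tau>\<close> by simp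
    also have "\<dots> = (LINT y|lborel. 2 * (p t y * ?q y) - p t y)"
      unfolding eq[symmetric] stable_density_integral[OF p t, symmetric] using int iq by simp
    also have "\<dots> \<le> (LINT y|lborel. p t y * indicator (ball 0 \<rho>) y)"
    proof (rule integral_mono[OF _ ib])
      show "integrable lborel (\<lambda>y. 2 * (p t y * ?q y) - p t y)" using int iq by auto
      fix y :: 'a
      show "2 * (p t y * ?q y) - p t y \<le> p t y * indicator (ball 0 \<rho>) y"
      proof (cases "y \<in> ball 0 \<rho>")
        case True
        have "p t y * ?q y \<le> p t y * 1" using nn by (intro mult_left_mono) auto
        then show ?thesis using True by auto
      next
        case False
        then have "2 \<le> norm (e *\<^sub>R (y - 0))" using \<rho> by (simp add: e_def field_simps)
        then have "2\<^sup>2 \<le> (norm (e *\<^sub>R (y - 0)))\<^sup>2" by (rule power_mono) auto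
        then have "?q y \<le> exp (- 2)" by auto
        also have "exp (- 2) \<le> (1::real) / 2"
          using exp_ge_add_one_self[of "2::real"] by (simp add: exp_minus field_simps)
        finally have "p t y * ?q y \<le> p t y * (1 / 2)" using nn by (intro mult_left_mono) auto
        then show ?thesis using False by auto
      qed
    qed
    finally have "ennreal (3 / 4) \<le> ennreal (LINT y|lborel. p t y * indicator (ball 0 \<rho>) y)"
      by (rule ennreal_leI)
    also have "\<dots> = (\<integral>\<^sup>+y. ennreal (p t y * indicator (ball 0 \<rho>) y) \<partial>lborel)"
      using nn by (intro nn_integral_eq_integral[symmetric] ib) auto
    also have "\<dots> = (\<integral>\<^sup>+y. ennreal (p t y) * indicator (ball 0 \<rho>) y \<partial>lborel)"
      by (intro nn_integral_cong) (auto simp: indicator_def)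
    finally show "3 / 4 \<le> (\<integral>\<^sup>+y. ennreal (p t y) * indicator (ball 0 \<rho>) y \<partial>lborel)"
      by (simp add: ennreal_divide_numeral[symmetric] del: ennreal_divide_numeral)
  qed
qed

section \<open>The time-changed kernel\<close>

lemma nn_integral_lborel_reflect:
  fixes F :: "'a::euclidean_space \<Rightarrow> ennreal"
  assumes [measurable]: "F \<in> borel_measurable borel"
  shows "(\<integral>\<^sup>+y. F (x - y) \<partial>lborel) = (\<integral>\<^sup>+y. F y \<partial>lborel)"
proof -
  have "lborel = distr lborel borel (\<lambda>y::'a. x - y)"
    using lborel_affine[of "-1" x] by (simp add: density_1)
  then have "(\<integral>\<^sup>+y. F y \<partial>lborel) = (\<integral>\<^sup>+y. F y \<partial>distr lborel borel (\<lambda>y::'a. x - y))"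
    by simp
  also have "\<dots> = (\<integral>\<^sup>+y. F (x - y) \<partial>lborel)"
    by (rule nn_integral_distr) auto
  finally show ?thesis by simp
qed

text \<open>Chernoff's bound with \<open>l = 1 / r\<close>. The Laplace transform is positive, so the integral exists.\<close>

lemma stable_subordinator_le:
  assumes D: "stable_subordinator N \<beta> D" and r: "0 < r" and s: "0 \<le> s"
  shows "{w \<in> space N. D s w \<le> r} \<in> sets N"
    and "measure N {w \<in> space N. D s w \<le> r} \<le> exp (1 - s * r powr (- \<beta>))"
proof -
  interpret prob_space N using D by (simp add: stable_subordinator_def)
  have [measurable]: "D s \<in> borel_measurable N"
    using D s by (simp add: stable_subordinator_def)
  show "{w \<in> space N. D s w \<le> r} \<in> sets N" by measurable
  have lap: "(LINT w|N. exp (- (1 / r) * D s w)) = exp (- s * (1 / r) powr \<beta>)"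
  proof -
    have "\<forall>r\<ge>0. \<forall>l\<ge>0. (LINT w|N. exp (- l * D r w)) = exp (- r * l powr \<beta>)"
      using D unfolding stable_subordinator_def by (elim conjE)
    then show ?thesis using s r by (metis divide_nonneg_pos zero_le_one)
  qed
  have int: "integrable N (\<lambda>w. exp (- (1 / r) * D s w))"
  proof (rule ccontr)
    assume "\<not> ?thesis"
    from not_integrable_integral_eq[OF this] show False unfolding lap by simp
  qed
  have "prob {w \<in> space N. D s w \<le> r} = (LINT w|N. indicator {w \<in> space N. D s w \<le> r} w)"
    by (simp add: Int_def conj_commute)
  also have "\<dots> \<le> (LINT w|N. exp 1 * exp (- (1 / r) * D s w))"
  proof (rule integral_mono)
    show "integrable N (\<lambda>w. indicat_real {w \<in> space N. D s w \<le> r} w)"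
      by (simp add: emeasure_eq_measure)
    show "integrable N (\<lambda>w. exp 1 * exp (- (1 / r) * D s w))" using int by simp
    fix w
    show "indicat_real {w \<in> space N. D s w \<le> r} w \<le> exp 1 * exp (- (1 / r) * D s w)"
      using r by (auto simp: indicator_def exp_add[symmetric] field_simps simp del: exp_add)
  qed
  also have "\<dots> = exp 1 * exp (- s * (1 / r) powr \<beta>)"
    by (subst integral_mult_right_zero) (simp only: lap)
  also have "\<dots> = exp (1 - s * r powr (- \<beta>))"
    using r by (simp add: exp_add[symmetric] powr_minus inverse_powr divide_inverse)
  finally show "prob {w \<in> space N. D s w \<le> r} \<le> exp (1 - s * r powr (- \<beta>))" .
qed

lemma first_passage_densityD:
  assumes "first_passage_density N D fE" "0 < t"
  shows first_passage_density_nonneg: "0 \<le> fE t s"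
    and first_passage_density_measurable: "fE t \<in> borel_measurable borel"
    and first_passage_density_distributed: "distributed N lborel (first_passage D t) (\<lambda>s. ennreal (fE t s))"
proof -
  show nn: "0 \<le> fE t s" and d: "distributed N lborel (first_passage D t) (\<lambda>s. ennreal (fE t s))" for s
    using assms by (auto simp: first_passage_density_def)
  have "(\<lambda>s. enn2real (ennreal (fE t s))) \<in> borel_measurable borel"
    using distributed_borel_measurable[OF d] by simp
  then show "fE t \<in> borel_measurable borel" by (simp add: nn)
qed

text \<open>If the passage time exceeds \<open>S\<close>, then \<open>D S\<close> has not yet
  exceeded \<open>t\<close>, and Chernoff's bound makes this unlikely. The interval excludes 0
  because the kernel integrates over positive \<open>s\<close> only, so the values 0 and below need
  separate treatment.\<close>

lemma first_passage_mass:
  assumes D: "stable_subordinator N \<beta> D" and fE: "first_passage_density N D fE"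
    and t: "0 < t" and S: "0 < S"
  shows "ennreal (1 - exp (1 - S * t powr (- \<beta>))) \<le> (\<integral>\<^sup>+s. ennreal (fE t s) * indicator {0<..S} s \<partial>lborel)"
    and "(\<integral>\<^sup>+s. ennreal (fE t s) \<partial>lborel) = 1"
proof -
  interpret prob_space N using D by (simp add: stable_subordinator_def)
  note [measurable] = first_passage_density_measurable[OF fE t]
  note dist = first_passage_density_distributed[OF fE t]
  let ?E = "first_passage D t"
  have [measurable]: "?E \<in> borel_measurable N"
    using distributed_measurable[OF dist] by simp
  have em: "emeasure N (?E -` A \<inter> space N) = (\<integral>\<^sup>+s. ennreal (fE t s) * indicator A s \<partial>lborel)"
    if [measurable]: "A \<in> sets borel" for A
  proof -
    have "emeasure N (?E -` A \<inter> space N) = emeasure (distr N lborel ?E) A"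
      by (subst emeasure_distr) auto
    also have "distr N lborel ?E = density lborel (\<lambda>s. ennreal (fE t s))"
      using dist by (simp add: distributed_def)
    finally show ?thesis by (simp add: emeasure_density)
  qed
  from em[of UNIV] show "(\<integral>\<^sup>+s. ennreal (fE t s) \<partial>lborel) = 1"
    by (simp add: emeasure_space_1)
  let ?S = "\<lambda>w. {r. 0 \<le> r \<and> t < D r w}"
  let ?in = "?E -` {0<..S} \<inter> space N" and ?gt = "{w\<in>space N. S < ?E w}"
    and ?eq = "{w\<in>space N. ?E w = 0}" and ?lt = "{w\<in>space N. ?E w < 0}"
  \<comment> \<open>\<open>Inf {}\<close> is an unspecified real and may be negative. A negative
    value forces the set to be empty, so that \<open>D (real n) w \<le> t\<close> for every
    \<open>n\<close>; these events have probabilities tending to 0.\<close>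
  have neg: "prob ?lt = 0"
  proof -
    have "prob ?lt \<le> exp (1 - real n * t powr (- \<beta>))" for n :: nat
    proof -
      have "?lt \<subseteq> {w\<in>space N. D (real n) w \<le> t}"
      proof safe
        fix w assume "?E w < 0"
        show "D (real n) w \<le> t"
        proof (rule ccontr)
          assume "\<not> D (real n) w \<le> t"
          then have "?S w \<noteq> {}" by (auto intro!: exI[of _ "real n"])
          then have "0 \<le> Inf (?S w)" by (rule cInf_greatest) auto
          with \<open>?E w < 0\<close> show False by (simp add: first_passage_def)
        qed
      qed
      from finite_measure_mono[OF this stable_subordinator_le(1)[OF D t]] stable_subordinator_le(2)[OF D t, of "real n"]
      show ?thesis by auto
    qed
    moreover have "(\<lambda>n. exp (1 - real n * t powr (- \<beta>))) \<longlonglongrightarrow> 0"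
    proof -
      have "0 < t powr (- \<beta>)" using t by simp
      then show ?thesis by real_asymp
    qed
    ultimately have "prob ?lt \<le> 0"
      by (intro LIMSEQ_le_const) auto
    then show ?thesis by (simp add: measure_le_0_iff)
  qed
  \<comment> \<open>A law with a Lebesgue density has no atom at 0.\<close>
  have zero: "prob ?eq = 0"
  proof -
    have "AE s in lborel. ennreal (fE t s) * indicator {0} s = 0"
      using AE_lborel_singleton[of 0] by eventually_elim auto
    then have "emeasure N (?E -` {0} \<inter> space N) = 0"
      by (subst em) (auto simp: nn_integral_0_iff_AE)
    moreover have "?E -` {0} \<inter> space N = ?eq" by auto
    ultimately show ?thesis by (simp add: measure_def)
  qed
  have gt: "prob ?gt \<le> exp (1 - S * t powr (- \<beta>))"
  proof -
    have "?gt \<subseteq> {w\<in>space N. D S w \<le> t}"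
    proof safe
      fix w assume "S < ?E w"
      show "D S w \<le> t"
      proof (rule ccontr)
        assume "\<not> D S w \<le> t"
        then have "Inf (?S w) \<le> S" using S by (intro cInf_lower bdd_belowI[of _ 0]) auto
        with \<open>S < ?E w\<close> show False by (simp add: first_passage_def)
      qed
    qed
    from finite_measure_mono[OF this stable_subordinator_le(1)[OF D t]] stable_subordinator_le(2)[OF D t, of S] S
    show ?thesis by auto
  qed
  have "space N = ?in \<union> (?gt \<union> (?eq \<union> ?lt))"
    by auto
  then have "1 = prob (?in \<union> (?gt \<union> (?eq \<union> ?lt)))"
    using prob_space by simp
  also have "\<dots> \<le> prob ?in + (prob ?gt + (prob ?eq + prob ?lt))"
    by (intro order_trans[OF measure_Un_le] add_left_mono) measurable
  also have "\<dots> \<le> prob ?in + exp (1 - S * t powr (- \<beta>))"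
    using gt zero neg by simp
  finally have "ennreal (1 - exp (1 - S * t powr (- \<beta>))) \<le> ennreal (prob ?in)"
    by (intro ennreal_leI) simp
  also have "\<dots> = (\<integral>\<^sup>+s. ennreal (fE t s) * indicator {0<..S} s \<partial>lborel)"
    by (subst em[symmetric]) (auto simp: emeasure_eq_measure)
  finally show "ennreal (1 - exp (1 - S * t powr (- \<beta>))) \<le> (\<integral>\<^sup>+s. ennreal (fE t s) * indicator {0<..S} s \<partial>lborel)" .
qed

lemma time_changed_kernel_nonneg:
  assumes p: "stable_density \<nu> \<alpha> p" and fE: "first_passage_density N D fE" and t: "0 < t"
  shows "0 \<le> time_changed_kernel p fE t x"
  unfolding time_changed_kernel_def set_lebesgue_integral_def
  using stable_density_nonneg[OF p] first_passage_density_nonneg[OF fE t]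
  by (intro integral_nonneg_AE AE_I2) (auto simp: indicator_def)

text \<open>Where the defining integral diverges, the kernel takes the default value 0, so it agrees
  with the nonnegative integral \<open>H\<close> only where \<open>H\<close> is finite. By Tonelli
  \<open>H\<close> has total mass at most 1, hence is finite almost everywhere.\<close>

lemma time_changed_kernel_eq:
  fixes p :: "real \<Rightarrow> 'a::euclidean_space \<Rightarrow> real"
  assumes p: "stable_density \<nu> \<alpha> p" and D: "stable_subordinator N \<beta> D"
    and fE: "first_passage_density N D fE" and t: "0 < t"
  shows time_changed_kernel_measurable: "time_changed_kernel p fE t \<in> borel_measurable borel"
    and time_changed_kernel_AE:
      "AE x in lborel. ennreal (time_changed_kernel p fE t x)
        = (\<integral>\<^sup>+s. ennreal (indicator {0<..} s * p s x) * ennreal (fE t s) \<partial>lborel)"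
    and time_changed_kernel_integrable: "integrable lborel (time_changed_kernel p fE t)"
proof -
  let ?G = "time_changed_kernel p fE t"
  note [measurable] = first_passage_density_measurable[OF fE t] borel_measurable_stable_density[OF p]
  note fnn = first_passage_density_nonneg[OF fE t]
  define q where "q s x = indicator {0<..} s * p s x" for s x
  have [measurable]: "(\<lambda>(s, x). q s x) \<in> borel_measurable (borel \<Otimes>\<^sub>M borel)"
    unfolding q_def by measurable
  have [measurable]: "q s \<in> borel_measurable borel" for s by measurable
  have qnn: "0 \<le> q s x" for s x
    using stable_density_nonneg[OF p, of s x] by (auto simp: q_def indicator_def)
  define H where "H x = (\<integral>\<^sup>+s. ennreal (q s x) * ennreal (fE t s) \<partial>lborel)" for x
  have [measurable]: "H \<in> borel_measurable borel" unfolding H_def by measurable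
  have G: "?G x = enn2real (H x)" for x
  proof -
    have "?G x = (LINT s|lborel. q s x * fE t s)"
      unfolding time_changed_kernel_def set_lebesgue_integral_def q_def by (simp add: mult_ac)
    also have "\<dots> = enn2real (\<integral>\<^sup>+s. ennreal (q s x * fE t s) \<partial>lborel)"
      by (rule integral_eq_nn_integral) (auto simp: qnn fnn)
    finally show ?thesis by (simp add: H_def ennreal_mult qnn fnn)
  qed
  show meas [measurable]: "?G \<in> borel_measurable borel"
    unfolding G[abs_def] by measurable
  have "(\<integral>\<^sup>+x. H x \<partial>lborel) = (\<integral>\<^sup>+s. \<integral>\<^sup>+x. ennreal (q s x) * ennreal (fE t s) \<partial>lborel \<partial>lborel)"
    unfolding H_def by (rule lborel_pair.Fubini') measurable
  also have "\<dots> = (\<integral>\<^sup>+s. ennreal (fE t s) * (\<integral>\<^sup>+x. ennreal (q s x) \<partial>lborel) \<partial>lborel)"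
  proof (intro nn_integral_cong)
    fix s
    have "(\<lambda>x. ennreal (q s x)) \<in> borel_measurable lborel" by measurable
    from nn_integral_multc[OF this, of "ennreal (fE t s)"]
    show "(\<integral>\<^sup>+x. ennreal (q s x) * ennreal (fE t s) \<partial>lborel) = ennreal (fE t s) * (\<integral>\<^sup>+x. ennreal (q s x) \<partial>lborel)"
      by (simp add: mult.commute)
  qed
  also have "\<dots> \<le> (\<integral>\<^sup>+s. ennreal (fE t s) * 1 \<partial>lborel)"
  proof (intro nn_integral_mono mult_left_mono)
    fix s
    show "(\<integral>\<^sup>+x. ennreal (q s x) \<partial>lborel) \<le> 1"
    proof (cases "0 < s")
      case True
      then have "(\<integral>\<^sup>+x. ennreal (q s x) \<partial>lborel) = ennreal (LINT x|lborel. p s x)"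
        by (simp add: q_def nn_integral_eq_integral stable_density_integrable[OF p] stable_density_nonneg[OF p])
      then show ?thesis using True by (simp add: stable_density_integral[OF p])
    qed (simp add: q_def)
  qed auto
  also have "\<dots> = 1" using first_passage_mass(2)[OF D fE t zero_less_one] by simp
  finally have fin: "(\<integral>\<^sup>+x. H x \<partial>lborel) \<le> 1" .
  have "AE x in lborel. H x \<noteq> \<infinity>"
    by (rule nn_integral_PInf_AE) (use fin in \<open>auto simp: top_unique\<close>)
  then have AE: "AE x in lborel. ennreal (?G x) = H x"
    by eventually_elim (simp add: G less_top)
  then show "AE x in lborel. ennreal (?G x)
        = (\<integral>\<^sup>+s. ennreal (indicator {0<..} s * p s x) * ennreal (fE t s) \<partial>lborel)"
    by (simp add: H_def q_def)
  show "integrable lborel ?G"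
  proof (rule integrableI_nonneg)
    have "(\<integral>\<^sup>+x. ennreal (?G x) \<partial>lborel) = (\<integral>\<^sup>+x. H x \<partial>lborel)"
      by (rule nn_integral_cong_AE[OF AE])
    also have "\<dots> < \<infinity>" using fin by (auto simp: less_top[symmetric] top_unique)
    finally show "(\<integral>\<^sup>+x. ennreal (?G x) \<partial>lborel) < \<infinity>" .
  qed (auto simp: time_changed_kernel_nonneg[OF p fE t])
qed

text \<open>With probability at least \<open>3 / 4\<close> the random time is at most
  \<open>4 * t powr \<beta>\<close>, and at any such time the stable process is in the ball with
  probability at least \<open>3 / 4\<close>; the product \<open>9 / 16\<close> exceeds
  \<open>1 / 2\<close>. The factor 4 in the random time is why
  \<open>c = \<delta> / 4\<close>.\<close>

lemma time_changed_kernel_ball: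
  fixes p :: "real \<Rightarrow> 'a::euclidean_space \<Rightarrow> real"
  assumes p: "stable_density \<nu> \<alpha> p" and D: "stable_subordinator N \<beta> D"
    and fE: "first_passage_density N D fE" and "0 < \<nu>" "0 < \<alpha>"
  obtains c where "0 < c"
    "\<And>t \<rho> x. 0 < t \<Longrightarrow> 0 < \<rho> \<Longrightarrow> t powr \<beta> \<le> c * \<rho> powr \<alpha> \<Longrightarrow>
       ennreal (1 / 2) \<le> (\<integral>\<^sup>+y. ennreal (time_changed_kernel p fE t (x - y)) * indicator (ball x \<rho>) y \<partial>lborel)"
proof -
  obtain \<delta> where \<delta>: "0 < \<delta>"
    "\<And>t \<rho>. 0 < t \<Longrightarrow> 0 < \<rho> \<Longrightarrow> t \<le> \<delta> * \<rho> powr \<alpha> \<Longrightarrow> 3 / 4 \<le> (\<integral>\<^sup>+y. ennreal (p t y) * indicator (ball 0 \<rho>) y \<partial>lborel)"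
    using stable_density_ball[OF p \<open>0 < \<nu>\<close> \<open>0 < \<alpha>\<close>] by blast
  show ?thesis
  proof (rule that)
    show "0 < \<delta> / 4" using \<delta>(1) by simp
    fix t \<rho> :: real and x :: 'a
    assume t: "0 < t" and \<rho>: "0 < \<rho>" and le: "t powr \<beta> \<le> \<delta> / 4 * \<rho> powr \<alpha>"
    note [measurable] = first_passage_density_measurable[OF fE t] borel_measurable_stable_density[OF p]
      time_changed_kernel_measurable[OF p D fE t]
    define q where "q s x = indicator {0<..} s * p s x" for s x
    have [measurable]: "(\<lambda>(s, x). q s x) \<in> borel_measurable (borel \<Otimes>\<^sub>M borel)"
      unfolding q_def by measurable
    have [measurable]: "q s \<in> borel_measurable borel" for s by measurable
    have [measurable]: "ball (0::'a) \<rho> \<in> sets borel" by simp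
    let ?f = "\<lambda>s. ennreal (fE t s)" and ?q = "\<lambda>s y. ennreal (q s y)" and ?i = "\<lambda>y. indicator (ball (0::'a) \<rho>) y"
    let ?G = "time_changed_kernel p fE t"
    \<comment> \<open>The factor 4 turns the bound of \<open>first_passage_mass\<close> into
      \<open>1 - exp (- 3)\<close>, which is at least \<open>3 / 4\<close>.\<close>
    define S where "S = 4 * t powr \<beta>"
    have S: "0 < S" using t by (simp add: S_def)
    have "S * t powr (- \<beta>) = 4" using t by (simp add: S_def powr_minus)
    moreover have "exp (1 - 4) \<le> (1::real) / 4"
      using exp_ge_add_one_self[of "3::real"] by (simp add: exp_minus field_simps)
    ultimately have "ennreal (3 / 4) \<le> ennreal (1 - exp (1 - S * t powr (- \<beta>)))"
      by (intro ennreal_leI) simp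
    also note first_passage_mass(1)[OF D fE t S]
    finally have mass: "ennreal (3 / 4) \<le> (\<integral>\<^sup>+s. ?f s * indicator {0<..S} s \<partial>lborel)" .
    have "ennreal (1 / 2) \<le> ennreal (3 / 4 * (3 / 4))" by (intro ennreal_leI) simp
    also have "\<dots> = ennreal (3 / 4) * ennreal (3 / 4)" by (simp add: ennreal_mult[symmetric] del: ennreal_divide_numeral)
    also have "\<dots> \<le> (\<integral>\<^sup>+s. ?f s * indicator {0<..S} s \<partial>lborel) * ennreal (3 / 4)"
      by (intro mult_right_mono mass) auto
    also have "\<dots> = (\<integral>\<^sup>+s. ?f s * indicator {0<..S} s * ennreal (3 / 4) \<partial>lborel)"
      by (rule nn_integral_multc[symmetric]) measurable
    also have "\<dots> \<le> (\<integral>\<^sup>+s. ?f s * (\<integral>\<^sup>+y. ?q s y * ?i y \<partial>lborel) \<partial>lborel)"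
    proof (intro nn_integral_mono)
      fix s
      show "?f s * indicator {0<..S} s * ennreal (3 / 4)
        \<le> ?f s * (\<integral>\<^sup>+y. ?q s y * ?i y \<partial>lborel)"
      proof (cases "s \<in> {0<..S}")
        case True
        then have "0 < s" "s \<le> \<delta> * \<rho> powr \<alpha>" using le by (auto simp: S_def)
        from \<delta>(2)[OF this(1) \<rho> this(2)] True show ?thesis
          by (auto simp: q_def ennreal_divide_numeral[symmetric] simp del: ennreal_divide_numeral intro!: mult_left_mono)
      qed simp
    qed
    also have "\<dots> = (\<integral>\<^sup>+s. (\<integral>\<^sup>+y. ?q s y * ?f s * ?i y \<partial>lborel) \<partial>lborel)"
    proof (intro nn_integral_cong)
      fix s
      have "(\<lambda>y. ?q s y * ?i y) \<in> borel_measurable lborel" by measurable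
      from nn_integral_cmult[OF this, of "ennreal (fE t s)"]
      show "?f s * (\<integral>\<^sup>+y. ?q s y * ?i y \<partial>lborel)
          = (\<integral>\<^sup>+y. ?q s y * ?f s * ?i y \<partial>lborel)"
        by (simp add: mult_ac)
    qed
    also have "\<dots> = (\<integral>\<^sup>+y. (\<integral>\<^sup>+s. ?q s y * ?f s * ?i y \<partial>lborel) \<partial>lborel)"
      by (rule lborel_pair.Fubini'[symmetric]) measurable
    also have "\<dots> = (\<integral>\<^sup>+y. (\<integral>\<^sup>+s. ?q s y * ?f s \<partial>lborel) * ?i y \<partial>lborel)"
      by (subst nn_integral_multc) auto
    also have "\<dots> = (\<integral>\<^sup>+y. ennreal (?G y) * ?i y \<partial>lborel)"
      using time_changed_kernel_AE[OF p D fE t] by (intro nn_integral_cong_AE) (auto simp: q_def)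
    also have "\<dots> = (\<integral>\<^sup>+y. ennreal (?G (x - y)) * ?i (x - y) \<partial>lborel)"
      by (rule nn_integral_lborel_reflect[symmetric]) measurable
    also have "\<dots> = (\<integral>\<^sup>+y. ennreal (?G (x - y)) * indicator (ball x \<rho>) y \<partial>lborel)"
      by (intro nn_integral_cong) (auto simp: indicator_def dist_norm norm_minus_commute)
    finally show "ennreal (1 / 2) \<le> (\<integral>\<^sup>+y. ennreal (?G (x - y)) * indicator (ball x \<rho>) y \<partial>lborel)" .
  qed
qed

section \<open>Independence of past and future noise\<close>

context prob_space begin

text \<open>The degenerate variable has no density, hence two cases. In both, the characteristic
  function at 1 depends on the second moment alone; this is what will turn vanishing correlation
  into factorisation.\<close>

lemma centered_gaussian_moments:
  assumes Z: "centered_gaussian M Z"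
  shows "integrable M (\<lambda>w. (Z w)\<^sup>2)" (is ?I) and "integrable M Z" (is ?J) and "(LINT w|M. Z w) = 0" (is ?E)
    and "(LINT w|M. iexp (Z w)) = complex_of_real (exp (- (LINT w|M. (Z w)\<^sup>2) / 2))" (is ?C)
proof -
  have [measurable]: "Z \<in> borel_measurable M" using Z by (simp add: centered_gaussian_def)
  consider (zero) "AE w in M. Z w = 0" | (normal) s where "0 < s" "distributed M lborel Z (normal_density 0 s)"
    using Z by (auto simp: centered_gaussian_def)
  then have "?I \<and> ?J \<and> ?E \<and> ?C"
  proof cases
    case zero
    have "(LINT w|M. iexp (Z w)) = (LINT w|M. 1)"
      by (rule integral_cong_AE) (use zero in auto)
    moreover have "(LINT w|M. (Z w)\<^sup>2) = (LINT w|M. 0)" "(LINT w|M. Z w) = (LINT w|M. 0)"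
      by (rule integral_cong_AE; use zero in auto)+
    moreover have "integrable M Z"
      by (rule integrable_cong_AE_imp[of _ "\<lambda>_. 0"]) (use zero in auto)
    moreover have "integrable M (\<lambda>w. (Z w)\<^sup>2)"
      by (rule integrable_cong_AE_imp[of _ "\<lambda>_. 0"]) (use zero in auto)
    ultimately show ?thesis by (simp add: prob_space)
  next
    case (normal s)
    note [arith] = \<open>0 < s\<close>
    have i2: "integrable M (\<lambda>w. (Z w)\<^sup>2)"
      using distributed_integrable[OF normal(2), of "\<lambda>x. x\<^sup>2"] integrable_normal_moment[OF normal(1), of 0 2]
      by simp
    have e: "(LINT w|M. Z w) = 0" by (rule normal_distributed_expectation[OF normal])
    have v: "(LINT w|M. (Z w)\<^sup>2) = s\<^sup>2" using normal_distributed_variance[OF normal] e by simp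
    have W: "distributed M lborel (\<lambda>w. Z w / s) std_normal_density"
      using normal(2) normal_standard_normal_convert[OF normal(1), of Z 0] by simp
    have "(LINT w|M. iexp (Z w)) = (LINT w|M. iexp (s * (Z w / s)))"
      using normal(1) by simp
    also have "\<dots> = (\<integral>x. iexp (s * x) \<partial>distr M lborel (\<lambda>w. Z w / s))"
      by (subst integral_distr) auto
    also have "\<dots> = char std_normal_distribution s"
      using W by (simp add: char_def distributed_def)
    also have "\<dots> = complex_of_real (exp (- s\<^sup>2 / 2))" by (simp add: char_std_normal_distribution)
    finally show ?thesis using i2 e v square_integrable_imp_integrable[OF _ i2] by simp
  qed
  then show ?I ?J ?E ?C by auto
qed

text \<open>Levy's uniqueness theorem for the laws of \<open>Z\<close> under the densities \<open>Y\<^sup>+\<close> and \<open>Y\<^sup>-\<close>.\<close>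

lemma char_zero_imp_indicator_zero_real:
  fixes Y Z :: "'a \<Rightarrow> real"
  assumes iY: "integrable M Y" and [measurable]: "Z \<in> borel_measurable M"
    and z: "\<And>c. (LINT w|M. iexp (c * Z w) * of_real (Y w)) = 0"
    and [measurable]: "S \<in> sets borel"
  shows "(LINT w|M. indicator S (Z w) * Y w) = 0"
proof -
  have [measurable]: "Y \<in> borel_measurable M" using iY by auto
  define P where "P w = max 0 (Y w)" for w
  define Q where "Q w = max 0 (- Y w)" for w
  have YPQ: "Y w = P w - Q w" for w by (auto simp: P_def Q_def)
  have nn: "0 \<le> P w" "0 \<le> Q w" for w by (auto simp: P_def Q_def)
  have iP: "integrable M P" and iQ: "integrable M Q"
    unfolding P_def Q_def using iY by (auto intro!: integrable_max)
  have [measurable]: "P \<in> borel_measurable M" "Q \<in> borel_measurable M" using iP iQ by auto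
  \<comment> \<open>The hypothesis at \<open>c = 0\<close> gives both parts of \<open>Y\<close> the
    same mass \<open>m\<close>. If \<open>m = 0\<close> then \<open>Y\<close> vanishes almost
    everywhere; otherwise both densities can be normalised by \<open>m\<close> to probability
    measures.\<close>
  define m where "m = (LINT w|M. P w)"
  have "complex_of_real (LINT w|M. Y w) = 0" using z[of 0] by simp
  then have "(LINT w|M. P w - Q w) = 0" by (simp add: YPQ)
  then have mQ: "m = (LINT w|M. Q w)" using iP iQ by (simp add: m_def)
  show ?thesis
  proof (cases "m = 0")
    case True
    have "AE w in M. P w = 0" using True integral_nonneg_eq_0_iff_AE[OF iP] nn by (auto simp: m_def)
    moreover have "AE w in M. Q w = 0" using True mQ integral_nonneg_eq_0_iff_AE[OF iQ] nn by auto
    ultimately have "AE w in M. indicator S (Z w) * Y w = 0"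
      by eventually_elim (simp add: YPQ)
    then show ?thesis by (simp add: integral_eq_zero_AE)
  next
    case False
    have m0: "0 < m" using False by (simp add: m_def less_le integral_nonneg_AE nn)
    define \<mu> where "\<mu> R = distr (density M (\<lambda>w. ennreal (R w / m))) borel Z" for R :: "'a \<Rightarrow> real"
    have rd: "real_distribution (\<mu> R)"
      if [measurable]: "R \<in> borel_measurable M" and R: "integrable M R" "\<And>w. 0 \<le> R w" "(LINT w|M. R w) = m" for R
    proof -
      let ?d = "density M (\<lambda>w. ennreal (R w / m))"
      have "prob_space ?d"
      proof (rule prob_spaceI)
        have "emeasure ?d (space M) = (\<integral>\<^sup>+w. ennreal (R w / m) \<partial>M)"
          by (subst emeasure_density) (auto intro!: nn_integral_cong)
        also have "\<dots> = ennreal (LINT w|M. R w / m)"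
          using R m0 by (intro nn_integral_eq_integral) auto
        also have "\<dots> = 1" using R m0 by simp
        finally show "emeasure ?d (space ?d) = 1"
          by simp
      qed
      then show ?thesis unfolding \<mu>_def by (rule prob_space.real_distribution_distr) simp
    qed
    have int: "(\<integral>x. k x \<partial>\<mu> R) = (LINT w|M. (R w / m) *\<^sub>R k (Z w))"
      if [measurable]: "R \<in> borel_measurable M" "k \<in> borel_measurable borel" and "\<And>w. 0 \<le> R w"
      for R and k :: "real \<Rightarrow> 'c::{banach, second_countable_topology}"
      unfolding \<mu>_def using that m0
      by (subst integral_distr; simp; subst integral_density; simp)
    have ic: "integrable M (\<lambda>w. iexp (c * Z w) * of_real (R w))"
      if "integrable M R" for c and R :: "'a \<Rightarrow> real"
      using that by (intro Bochner_Integration.integrable_bound[OF that]) (auto simp: norm_mult)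
    have "\<mu> P = \<mu> Q"
    proof (rule Levy_uniqueness)
      show "real_distribution (\<mu> P)" "real_distribution (\<mu> Q)"
        using iP iQ nn mQ by (auto intro!: rd simp: m_def)
      show "char (\<mu> P) = char (\<mu> Q)"
      proof
        fix c
        have ch: "char (\<mu> R) c = (LINT w|M. iexp (c * Z w) * of_real (R w)) / m"
          if [measurable]: "R \<in> borel_measurable M" and "\<And>w. 0 \<le> R w" for R
          unfolding char_def
          by (subst int) (auto simp: that scaleR_conv_of_real mult.commute simp flip: integral_divide_zero)
        have "0 = (LINT w|M. iexp (c * Z w) * of_real (P w) - iexp (c * Z w) * of_real (Q w))"
          using z[of c] by (simp add: YPQ right_diff_distrib)
        also have "\<dots> = (LINT w|M. iexp (c * Z w) * of_real (P w)) - (LINT w|M. iexp (c * Z w) * of_real (Q w))"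
          by (rule Bochner_Integration.integral_diff[OF ic[OF iP] ic[OF iQ]])
        finally show "char (\<mu> P) c = char (\<mu> Q) c" by (simp add: ch nn)
      qed
    qed
    then have "(\<integral>x. indicat_real S x \<partial>\<mu> P) = (\<integral>x. indicat_real S x \<partial>\<mu> Q)" by simp
    then have eq: "(LINT w|M. indicator S (Z w) * P w) = (LINT w|M. indicator S (Z w) * Q w)"
      using m0 int[of P "indicator S :: real \<Rightarrow> real"] int[of Q "indicator S :: real \<Rightarrow> real"]
      by (simp add: nn mult.commute[of "indicator S _"] del: Bochner_Integration.integral_indicator)
    have iS: "integrable M (\<lambda>w. indicator S (Z w) * R w)" if "integrable M R" for R :: "'a \<Rightarrow> real"
      by (rule Bochner_Integration.integrable_bound[OF that]) (use that in \<open>auto simp: indicator_def\<close>)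
    show ?thesis
      by (simp add: YPQ right_diff_distrib Bochner_Integration.integral_diff[OF iS[OF iP] iS[OF iQ]] eq)
  qed
qed

text \<open>The hypothesis over all real \<open>c\<close> is stable under conjugation, because
  \<open>c\<close> may be replaced by \<open>- c\<close>. So it passes to the real part of
  \<open>Y\<close>, and to the imaginary part as the real part of \<open>- \<i> * Y\<close>.\<close>

lemma char_zero_imp_indicator_zero:
  fixes Y :: "'a \<Rightarrow> complex" and Z :: "'a \<Rightarrow> real"
  assumes iY: "integrable M Y" and Zm: "Z \<in> borel_measurable M"
    and z: "\<And>c. (LINT w|M. iexp (c * Z w) * Y w) = 0"
    and S: "S \<in> sets borel"
  shows "(LINT w|M. complex_of_real (indicator S (Z w)) * Y w) = 0"
proof -
  note [measurable] = Zm S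
  have re: "(LINT w|M. indicator S (Z w) * Re (U w)) = 0"
    if U: "integrable M U" and zU: "\<And>c. (LINT w|M. iexp (c * Z w) * U w) = 0" for U :: "'a \<Rightarrow> complex"
  proof (rule char_zero_imp_indicator_zero_real[OF _ Zm _ S])
    show "integrable M (\<lambda>w. Re (U w))" using U by simp
    fix c
    have iE: "integrable M (\<lambda>w. iexp (c * Z w) * X w)" if "integrable M X" for X :: "'a \<Rightarrow> complex"
      using that by (intro Bochner_Integration.integrable_bound[OF that]) (auto simp: norm_mult)
    have icU: "integrable M (\<lambda>w. cnj (U w))" using U by simp
    have "(LINT w|M. iexp (c * Z w) * cnj (U w)) = (LINT w|M. cnj (iexp (- c * Z w) * U w))"
      by (simp add: exp_cnj)
    also have "\<dots> = cnj (LINT w|M. iexp (- c * Z w) * U w)"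
      by (rule Bochner_Integration.integral_cnj)
    finally have zc: "(LINT w|M. iexp (c * Z w) * cnj (U w)) = 0" using zU[of "- c"] by simp
    have "(LINT w|M. iexp (c * Z w) * of_real (Re (U w)))
      = (LINT w|M. (iexp (c * Z w) * U w + iexp (c * Z w) * cnj (U w)) / 2)"
      by (intro LINT_cong) (simp add: distrib_left[symmetric] complex_add_cnj)
    also have "\<dots> = 0"
      unfolding integral_divide_zero Bochner_Integration.integral_add[OF iE[OF U] iE[OF icU]] zU zc by simp
    finally show "(LINT w|M. iexp (c * Z w) * of_real (Re (U w))) = 0" .
  qed
  have "(LINT w|M. iexp (c * Z w) * (- \<i> * Y w)) = 0" for c
  proof -
    have "(LINT w|M. iexp (c * Z w) * (- \<i> * Y w)) = (LINT w|M. - \<i> * (iexp (c * Z w) * Y w))"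
      by (intro LINT_cong) (simp only: mult.left_commute)
    also have "\<dots> = 0" by (subst integral_mult_right_zero) (simp only: z mult_zero_right)
    finally show ?thesis .
  qed
  from re[OF integrable_mult_right[OF iY] this] have "(LINT w|M. indicator S (Z w) * Im (Y w)) = 0" by simp
  moreover note re[OF iY z]
  moreover have "integrable M (\<lambda>w. complex_of_real (indicator S (Z w)) * Y w)"
    by (rule Bochner_Integration.integrable_bound[OF iY]) (use iY in \<open>auto simp: indicator_def norm_mult\<close>)
  ultimately show ?thesis
    by (simp add: complex_eq_iff integral_Re[symmetric] integral_Im[symmetric])
qed

end

text \<open>The bounds are imposed off the diagonal, where \<open>f\<close> may be singular.
  Positivity identifies \<open>\<bar>f\<bar>\<close>, the density of Walsh's dominating measure,
  with \<open>f\<close> up to a null set; the bound by \<open>g\<close> makes the covariances of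
  bounded sets finite.\<close>

locale colored_noise = prob_space M for M :: "'w measure" +
  fixes f :: "'a::euclidean_space \<Rightarrow> 'a \<Rightarrow> real" and g :: "'a \<Rightarrow> real"
    and F :: "(real \<times> 'a) set \<Rightarrow> 'w \<Rightarrow> real"
  assumes f_meas: "(\<lambda>(x, y). f x y) \<in> borel_measurable borel"
    and f_le: "\<And>x y. x \<noteq> y \<Longrightarrow> f x y \<le> g (x - y)"
    and f_pos: "\<And>x y. x \<noteq> y \<Longrightarrow> 0 < f x y"
    and g_int: "locally_integrable g"
    and noise: "gaussian_noise M f F"
begin

lemma borel_measurable_f[measurable]: "(\<lambda>(x, y). f x y) \<in> borel_measurable (borel \<Otimes>\<^sub>M borel)"
  using f_meas by (simp add: borel_prod)

lemma AE_f_eq: "AE y in lborel. \<bar>f x y\<bar> = f x y"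
  using AE_lborel_singleton[of x] by eventually_elim (use f_pos[of x] in \<open>force simp: less_imp_le\<close>)

lemma noise_combination:
  assumes "finite \<B>" "\<B> \<subseteq> noise_sets"
  shows "centered_gaussian M (\<lambda>w. \<Sum>B\<in>\<B>. c B * F B w)"
  using noise assms by (auto simp: gaussian_noise_def)

lemma noise_gaussian:
  assumes "B \<in> noise_sets" shows "centered_gaussian M (F B)"
  using noise_combination[of "{B}" "\<lambda>_. 1"] assms by simp

lemma borel_measurable_noise: "B \<in> noise_sets \<Longrightarrow> F B \<in> borel_measurable M"
  using noise_gaussian by (simp add: centered_gaussian_def)

lemma integrable_noise_mult:
  assumes "A \<in> noise_sets" "B \<in> noise_sets"
  shows "integrable M (\<lambda>w. F A w * F B w)"
proof -
  have i: "integrable M (\<lambda>w. (F A w)\<^sup>2 + (F B w)\<^sup>2)"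
    using assms by (auto intro!: centered_gaussian_moments(1) noise_gaussian)
  show ?thesis
  proof (rule Bochner_Integration.integrable_bound[OF i])
    show "AE w in M. norm (F A w * F B w) \<le> norm ((F A w)\<^sup>2 + (F B w)\<^sup>2)"
    proof (intro AE_I2)
      fix w
      have "2 * \<bar>F A w * F B w\<bar> \<le> (F A w)\<^sup>2 + (F B w)\<^sup>2"
        using sum_squares_bound[of "\<bar>F A w\<bar>" "\<bar>F B w\<bar>"] by (simp add: abs_mult)
      then show "norm (F A w * F B w) \<le> norm ((F A w)\<^sup>2 + (F B w)\<^sup>2)" by simp
    qed
  qed (use assms borel_measurable_noise in auto)
qed

section \<open>Covariances, past and future of the noise, and the filtration\<close>

definition noise_cov :: "(real \<times> 'a) set \<Rightarrow> (real \<times> 'a) set \<Rightarrow> real" where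
  "noise_cov A B = (LINT w|M. F A w * F B w)"

lemma noise_cov_eq:
  assumes "A \<in> noise_sets" "B \<in> noise_sets"
  shows "noise_cov A B =
    (LINT s|lborel. (LINT x|lborel. (LINT y|lborel. indicator A (s, x) * f x y * indicator B (s, y))))"
  using noise assms by (simp add: gaussian_noise_def noise_cov_def)

lemma noise_cov_commute: "noise_cov A B = noise_cov B A"
  by (simp add: noise_cov_def mult.commute)

text \<open>Closed at \<open>a\<close> here and open at \<open>a\<close> in \<open>future\<close>:
  the two share no time, and the boxes over \<open>{a<..b}\<close> used by simple processes lie in
  the future of \<open>a\<close>.\<close>

definition past :: "real \<Rightarrow> (real \<times> 'a) set set" where
  "past a = {B \<in> noise_sets. B \<subseteq> {0..a} \<times> UNIV}"

definition future :: "real \<Rightarrow> (real \<times> 'a) set set" where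
  "future a = {B \<in> noise_sets. B \<subseteq> {a<..} \<times> UNIV}"

lemma noise_cov_past_future:
  assumes "B \<in> past a" "C \<in> future a" shows "noise_cov B C = 0"
proof -
  have "indicator B (s, x) * f x y * indicator C (s, y) = 0" for s x y
  proof -
    have "\<not> ((s, x) \<in> B \<and> (s, y) \<in> C)"
    proof
      assume "(s, x) \<in> B \<and> (s, y) \<in> C"
      then have "(s, x) \<in> {0..a} \<times> UNIV" "(s, y) \<in> {a<..} \<times> UNIV"
        using assms unfolding past_def future_def by blast+
      then show False by auto
    qed
    then show ?thesis by (auto simp: indicator_def)
  qed
  moreover have "B \<in> noise_sets" "C \<in> noise_sets" using assms by (auto simp: past_def future_def)
  ultimately show ?thesis by (simp only: noise_cov_eq integral_zero)
qed

lemma filtration_sets: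
  "sets (noise_filtration M F a) = sigma_sets (space M)
     ({F B -` S \<inter> space M | B S. B \<in> past a \<and> S \<in> sets borel} \<union> null_sets M)"
proof -
  have "{F B -` S \<inter> space M | B S. B \<in> noise_sets \<and> B \<subseteq> {0..a} \<times> UNIV \<and> S \<in> sets borel}
     = {F B -` S \<inter> space M | B S. B \<in> past a \<and> S \<in> sets borel}"
    by (auto simp: past_def)
  moreover have "null_sets M \<subseteq> Pow (space M)"
    using sets.sets_into_space by (auto simp: null_sets_def)
  ultimately show ?thesis
    unfolding noise_filtration_def by (subst sets_measure_of) auto
qed

lemma filtration_space[simp]: "space (noise_filtration M F a) = space M"
  unfolding noise_filtration_def by (rule space_measure_of_conv)

lemma filtration_sets_le: "sets (noise_filtration M F a) \<subseteq> sets M"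
  unfolding filtration_sets
  by (rule sets.sigma_sets_subset)
     (auto intro!: measurable_sets borel_measurable_noise simp: past_def null_sets_def)

abbreviation adapted :: "real \<Rightarrow> ('w \<Rightarrow> real) \<Rightarrow> bool" where
  "adapted a X \<equiv> X \<in> borel_measurable (noise_filtration M F a)"

lemma filtration_measurable:
  "adapted a X \<Longrightarrow> X \<in> borel_measurable M"
  using filtration_sets_le by (auto simp: measurable_def)

lemma filtration_mono:
  assumes "adapted a X" "a \<le> b"
  shows "adapted b X"
proof -
  have "past a \<subseteq> past b" using assms(2) by (force simp: past_def)
  then have "sets (noise_filtration M F a) \<subseteq> sets (noise_filtration M F b)"
    unfolding filtration_sets by (intro sigma_sets_mono') blast
  then show ?thesis using assms(1) by (auto simp: measurable_def)
qed

lemma noise_measurable_filtration: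
  assumes "B \<in> past a" shows "adapted a (F B)"
proof (rule measurableI)
  fix S :: "real set" assume "S \<in> sets borel"
  then show "F B -` S \<inter> space (noise_filtration M F a) \<in> sets (noise_filtration M F a)"
    unfolding filtration_space filtration_sets using assms by (intro sigma_sets.Basic) auto
qed simp

text \<open>An intersection-stable generator of the filtration, on which independence can be tested.
  The null sets enter through the augmentation.\<close>

definition past_cylinders :: "real \<Rightarrow> 'w set set" where
  "past_cylinders a = {{w \<in> space M. \<forall>B\<in>\<B>. F B w \<in> S B} | \<B> S.
     finite \<B> \<and> \<B> \<subseteq> past a \<and> (\<forall>B. S B \<in> sets borel)} \<union> null_sets M"

lemma past_cylinders_sets: "past_cylinders a \<subseteq> sets M"
proof
  fix A assume A: "A \<in> past_cylinders a"
  have "{w \<in> space M. \<forall>B\<in>\<B>. F B w \<in> S B} \<in> sets M"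
    if "finite \<B>" "\<B> \<subseteq> past a" "\<forall>B. S B \<in> sets borel" for \<B> S
  proof -
    have "{w \<in> space M. F B w \<in> S B} \<in> sets M" if "B \<in> \<B>" for B
    proof -
      have "F B \<in> borel_measurable M"
        using \<open>\<B> \<subseteq> past a\<close> that by (auto simp: past_def intro: borel_measurable_noise)
      from measurable_sets[OF this, of "S B"] show ?thesis
        using \<open>\<forall>B. S B \<in> sets borel\<close> by (simp add: vimage_def Int_def conj_commute)
    qed
    then show ?thesis using \<open>finite \<B>\<close> by (rule sets.sets_Collect_finite_All)
  qed
  with A show "A \<in> sets M" by (auto simp: past_cylinders_def null_sets_def)
qed

lemma Int_stable_past_cylinders: "Int_stable (past_cylinders a)"
proof (rule Int_stableI)
  fix A B assume A: "A \<in> past_cylinders a" and B: "B \<in> past_cylinders a"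
  define cyl where "cyl A \<B> S \<longleftrightarrow> A = {w \<in> space M. \<forall>B\<in>\<B>. F B w \<in> S B} \<and>
    finite \<B> \<and> \<B> \<subseteq> past a \<and> (\<forall>B. S B \<in> sets borel)" for A \<B> S
  have "past_cylinders a = {A. \<exists>\<B> S. cyl A \<B> S} \<union> null_sets M"
    unfolding past_cylinders_def cyl_def ..
  with A B consider "A \<in> null_sets M" | "B \<in> null_sets M" | \<B>1 S1 \<B>2 S2 where "cyl A \<B>1 S1" "cyl B \<B>2 S2"
    by blast
  then show "A \<inter> B \<in> past_cylinders a"
  proof cases
    case 1
    then have "A \<inter> B \<in> null_sets M" using B past_cylinders_sets[of a] null_set_Int2 by blast
    then show ?thesis by (simp add: past_cylinders_def)
  next
    case 2
    then have "A \<inter> B \<in> null_sets M" using A past_cylinders_sets[of a] null_set_Int1 by blast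
    then show ?thesis by (simp add: past_cylinders_def)
  next
    case (3 \<B>1 S1 \<B>2 S2)
    \<comment> \<open>Constraints default to \<open>UNIV\<close> outside their own index set, so
      that both cylinders can be read over the common index set.\<close>
    define S where "S B = (if B \<in> \<B>1 then S1 B else UNIV) \<inter> (if B \<in> \<B>2 then S2 B else UNIV)" for B
    have eq: "A = {w \<in> space M. \<forall>B\<in>\<B>1. F B w \<in> S1 B}" "B = {w \<in> space M. \<forall>B\<in>\<B>2. F B w \<in> S2 B}"
      and fin: "finite (\<B>1 \<union> \<B>2)" "\<B>1 \<union> \<B>2 \<subseteq> past a" and "\<forall>B. S1 B \<in> sets borel" "\<forall>B. S2 B \<in> sets borel"
      using 3 unfolding cyl_def by simp_all
    then have S: "\<forall>B. S B \<in> sets borel" by (simp add: S_def)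
    have "A \<inter> B = {w \<in> space M. \<forall>B\<in>\<B>1 \<union> \<B>2. F B w \<in> S B}"
      unfolding eq by (auto simp: S_def)
    with fin S show ?thesis
      unfolding past_cylinders_def by (intro UnI1 CollectI exI[of _ "\<B>1 \<union> \<B>2"] exI[of _ S] conjI)
  qed
qed

lemma filtration_sets_cylinders: "sets (noise_filtration M F a) \<subseteq> sigma_sets (space M) (past_cylinders a)"
  unfolding filtration_sets
proof (rule sigma_sets_mono', safe)
  fix B :: "(real \<times> 'a) set" and S :: "real set" assume "B \<in> past a" "S \<in> sets borel"
  then show "F B -` S \<inter> space M \<in> past_cylinders a"
    unfolding past_cylinders_def
    by (intro UnI1 CollectI exI[of _ "{B}"] exI[of _ "\<lambda>_. S"]) auto
qed (auto simp: past_cylinders_def)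

text \<open>Both combinations and their sum are Gaussian, so it suffices that they are uncorrelated.\<close>

lemma char_past_future:
  fixes c k :: "(real \<times> 'a) set \<Rightarrow> real"
  assumes B: "finite \<B>" "\<B> \<subseteq> past a" and C: "finite \<C>" "\<C> \<subseteq> future a"
  defines "U \<equiv> \<lambda>w. \<Sum>B\<in>\<B>. c B * F B w" and "V \<equiv> \<lambda>w. \<Sum>C\<in>\<C>. k C * F C w"
  shows "(LINT w|M. iexp (U w) * iexp (V w)) = (LINT w|M. iexp (U w)) * (LINT w|M. iexp (V w))"
proof -
  have Bn: "\<B> \<subseteq> noise_sets" and Cn: "\<C> \<subseteq> noise_sets" using B C by (auto simp: past_def future_def)
  have gU: "centered_gaussian M U" unfolding U_def by (rule noise_combination[OF B(1) Bn])
  have gV: "centered_gaussian M V" unfolding V_def by (rule noise_combination[OF C(1) Cn])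
  \<comment> \<open>The coefficients are added over the union because the two families may overlap:
    the empty set belongs both to the past and to the future.\<close>
  have UV: "U w + V w = (\<Sum>B\<in>\<B> \<union> \<C>. ((if B \<in> \<B> then c B else 0) + (if B \<in> \<C> then k B else 0)) * F B w)" for w
  proof -
    have "U w = (\<Sum>B\<in>\<B> \<union> \<C>. (if B \<in> \<B> then c B else 0) * F B w)"
      unfolding U_def by (rule sum.mono_neutral_cong_left) (use B C in auto)
    moreover have "V w = (\<Sum>B\<in>\<B> \<union> \<C>. (if B \<in> \<C> then k B else 0) * F B w)"
      unfolding V_def by (rule sum.mono_neutral_cong_left) (use B C in auto)
    ultimately show ?thesis by (simp add: sum.distrib distrib_right)
  qed
  have gUV: "centered_gaussian M (\<lambda>w. U w + V w)"
    unfolding UV by (rule noise_combination) (use B C Bn Cn in auto)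
  have UVmult: "U w * V w = (\<Sum>B\<in>\<B>. \<Sum>C\<in>\<C>. c B * k C * (F B w * F C w))" for w
    unfolding U_def V_def sum_product by (simp add: mult_ac)
  have ii: "integrable M (\<lambda>w. c B * k C * (F B w * F C w))" if "B \<in> \<B>" "C \<in> \<C>" for B C
    using that Bn Cn by (intro integrable_mult_right integrable_noise_mult) auto
  have iUV: "integrable M (\<lambda>w. U w * V w)" unfolding UVmult by (intro Bochner_Integration.integrable_sum ii)
  have "(LINT w|M. U w * V w) = (\<Sum>B\<in>\<B>. LINT w|M. (\<Sum>C\<in>\<C>. c B * k C * (F B w * F C w)))"
    unfolding UVmult by (intro Bochner_Integration.integral_sum Bochner_Integration.integrable_sum ii)
  also have "\<dots> = (\<Sum>B\<in>\<B>. \<Sum>C\<in>\<C>. LINT w|M. c B * k C * (F B w * F C w))"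
    by (intro sum.cong refl Bochner_Integration.integral_sum ii)
  also have "\<dots> = (\<Sum>B\<in>\<B>. \<Sum>C\<in>\<C>. c B * k C * noise_cov B C)"
    by (simp add: noise_cov_def)
  also have "\<dots> = 0"
  proof (intro sum.neutral ballI)
    fix B C assume "B \<in> \<B>" "C \<in> \<C>"
    then have "noise_cov B C = 0" using assms by (intro noise_cov_past_future[of B a]) auto
    then show "c B * k C * noise_cov B C = 0" by simp
  qed
  finally have EUV: "(LINT w|M. U w * V w) = 0" .
  have "(LINT w|M. (U w + V w)\<^sup>2) = (LINT w|M. (U w)\<^sup>2 + (V w)\<^sup>2 + 2 * (U w * V w))"
    by (simp add: power2_sum mult.assoc)
  also have "\<dots> = (LINT w|M. (U w)\<^sup>2) + (LINT w|M. (V w)\<^sup>2)"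
    using centered_gaussian_moments(1)[OF gU] centered_gaussian_moments(1)[OF gV] iUV by (simp add: EUV)
  finally have v: "(LINT w|M. (U w + V w)\<^sup>2) = (LINT w|M. (U w)\<^sup>2) + (LINT w|M. (V w)\<^sup>2)" .
  have "(LINT w|M. iexp (U w) * iexp (V w)) = (LINT w|M. iexp (U w + V w))"
    by (simp add: exp_add[symmetric] distrib_left)
  also have "\<dots> = complex_of_real (exp (- ((LINT w|M. (U w)\<^sup>2) + (LINT w|M. (V w)\<^sup>2)) / 2))"
    using centered_gaussian_moments(4)[OF gUV] v by simp
  also have "\<dots> = (LINT w|M. iexp (U w)) * (LINT w|M. iexp (V w))"
    unfolding centered_gaussian_moments(4)[OF gU] centered_gaussian_moments(4)[OF gV] of_real_mult[symmetric] exp_add[symmetric]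
    by (simp add: field_simps)
  finally show ?thesis .
qed


text \<open>\<open>char_past_future\<close> gives factorisation for exponentials of noise variables.
  Each exponential is exchanged for an indicator by the uniqueness theorem, one past variable at a
  time, and finally for \<open>V\<close>.\<close>

lemma cylinder_independent:
  fixes k :: "(real \<times> 'a) set \<Rightarrow> real"
  assumes B: "finite \<B>" "\<B> \<subseteq> past a" and S: "\<And>B. S B \<in> sets borel"
    and C: "finite \<C>" "\<C> \<subseteq> future a" and T: "T \<in> sets borel"
  defines "A \<equiv> {w \<in> space M. \<forall>B\<in>\<B>. F B w \<in> S B}" and "V \<equiv> \<lambda>w. \<Sum>C\<in>\<C>. k C * F C w"
  shows "prob (A \<inter> (V -` T \<inter> space M)) = prob A * prob (V -` T \<inter> space M)"
proof -
  note [measurable] = S T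
  have FB[measurable]: "F B \<in> borel_measurable M" if "B \<in> \<B>" for B
    using that B by (auto simp: past_def intro: borel_measurable_noise)
  have "F C \<in> borel_measurable M" if "C \<in> \<C>" for C
    using that C by (auto simp: future_def intro: borel_measurable_noise)
  then have V[measurable]: "V \<in> borel_measurable M"
    unfolding V_def by (intro borel_measurable_sum borel_measurable_times) auto
  have A: "A \<in> sets M"
    using past_cylinders_sets[of a] B S unfolding past_cylinders_def A_def by blast
  note [measurable] = A
  let ?E = "\<lambda>v. LINT w|M. iexp (v * V w)"
  \<comment> \<open>Centering the exponential of \<open>V\<close> turns factorisation into the
    vanishing of an integral, which is the form that the uniqueness lemma accepts.\<close>
  define \<psi> where "\<psi> v w = iexp (v * V w) - ?E v" for v w
  have [measurable]: "\<psi> v \<in> borel_measurable M" for v unfolding \<psi>_def by measurable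
  have iV: "integrable M (\<lambda>w. iexp (v * V w))" for v
    by (rule integrable_const_bound[where B=1]) auto
  have \<psi>_le: "norm (\<psi> v w) \<le> 2" for v w
  proof -
    have "norm (?E v) \<le> (LINT w|M. norm (iexp (v * V w)))"
      by (rule integral_norm_bound)
    also have "\<dots> = 1" by (simp add: prob_space)
    finally have "norm (?E v) \<le> 1" .
    moreover have "norm (\<psi> v w) \<le> norm (iexp (v * V w)) + norm (?E v)"
      unfolding \<psi>_def by (rule norm_triangle_ineq4)
    ultimately show ?thesis by simp
  qed
  define ind where "ind B w = complex_of_real (indicator (S B) (F B w))" for B w
  have ind_m[measurable]: "ind B \<in> borel_measurable M" if "B \<in> \<B>" for B
    unfolding ind_def using FB[OF that] by measurable
  \<comment> \<open>Variables in \<open>\<D>\<close> already enter through indicators, those outside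
    \<open>\<E>\<close> still through exponentials. With \<open>\<E>\<close> larger than
    \<open>\<D>\<close> by one element, that variable is left out, ready to be tested against all
    its exponentials.\<close>
  define Y where "Y \<D> \<E> c v w = (\<Prod>B\<in>\<D>. ind B w) * (iexp (\<Sum>B\<in>\<B> - \<E>. c B * F B w) * \<psi> v w)"
    for \<D> \<E> and c :: "(real \<times> 'a) set \<Rightarrow> real" and v w
  have iY: "integrable M (Y \<D> \<E> c v)"
    if D: "\<D> \<subseteq> \<B>" for \<D> \<E> v and c :: "(real \<times> 'a) set \<Rightarrow> real"
  proof (rule integrable_const_bound[where B=2])
    have "(\<lambda>w. \<Prod>B\<in>\<D>. ind B w) \<in> borel_measurable M"
      using D by (intro borel_measurable_prod ind_m) auto
    moreover have "(\<lambda>w. \<Sum>B\<in>\<B> - \<E>. c B * F B w) \<in> borel_measurable M"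
      by (intro borel_measurable_sum borel_measurable_times FB) auto
    ultimately show "(Y \<D> \<E> c v) \<in> borel_measurable M"
      unfolding Y_def by measurable
    show "AE w in M. norm (Y \<D> \<E> c v w) \<le> 2"
    proof (intro AE_I2)
      fix w
      have "norm (\<Prod>B\<in>\<D>. ind B w) \<le> 1"
        unfolding prod_norm[symmetric] by (intro prod_le_1) (auto simp: ind_def indicator_def)
      then have "norm (\<Prod>B\<in>\<D>. ind B w) * norm (\<psi> v w) \<le> 1 * 2"
        by (intro mult_mono \<psi>_le) auto
      then show "norm (Y \<D> \<E> c v w) \<le> 2"
        by (simp add: Y_def norm_mult)
    qed
  qed
  have base: "(LINT w|M. iexp (\<Sum>B\<in>\<B>. c B * F B w) * \<psi> v w) = 0" for c v
  proof -
    let ?U = "\<lambda>w. \<Sum>B\<in>\<B>. c B * F B w"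
    have [measurable]: "?U \<in> borel_measurable M"
      by (intro borel_measurable_sum borel_measurable_times FB) auto
    have vV: "v * V w = (\<Sum>C\<in>\<C>. (v * k C) * F C w)" for w
      unfolding V_def by (simp add: sum_distrib_left mult.assoc)
    have i1: "integrable M (\<lambda>w. iexp (?U w) * iexp (v * V w))"
      by (rule integrable_const_bound[where B=1]) (auto simp: norm_mult)
    have i2: "integrable M (\<lambda>w. iexp (?U w))"
      by (rule integrable_const_bound[where B=1]) auto
    have "(LINT w|M. iexp (?U w) * \<psi> v w)
      = (LINT w|M. iexp (?U w) * iexp (v * V w) - iexp (?U w) * ?E v)"
      by (simp only: \<psi>_def right_diff_distrib)
    also have "\<dots> = (LINT w|M. iexp (?U w) * iexp (v * V w)) - (LINT w|M. iexp (?U w)) * ?E v"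
      by (subst Bochner_Integration.integral_diff[OF i1 integrable_mult_left[OF i2]]) (simp only: integral_mult_left_zero)
    also have "\<dots> = 0"
      unfolding vV using char_past_future[OF B C, of c "\<lambda>C. v * k C"] by simp
    finally show ?thesis .
  qed
  \<comment> \<open>The statement is for all coefficients \<open>c\<close>, since the induction step
    varies the coefficient of the variable that is being exchanged.\<close>
  have "\<forall>c. (LINT w|M. Y \<D> \<D> c v w) = 0" if "finite \<D>" "\<D> \<subseteq> \<B>" for \<D> v
    using that
  proof (induction \<D> rule: finite_induct)
    case empty
    then show ?case using base by (simp add: Y_def)
  next
    case (insert B0 \<D>)
    have B0: "B0 \<in> \<B>" and D: "\<D> \<subseteq> \<B>" using insert.prems by auto
    show ?case
    proof
      fix c :: "(real \<times> 'a) set \<Rightarrow> real"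
      let ?R = "Y \<D> (insert B0 \<D>) c v"
      have "(LINT w|M. complex_of_real (indicator (S B0) (F B0 w)) * ?R w) = 0"
      proof (rule char_zero_imp_indicator_zero[OF iY[OF D] FB[OF B0] _ S])
        fix c0
        have "iexp (c0 * F B0 w) * ?R w = Y \<D> \<D> (c(B0 := c0)) v w" for w
        proof -
          have d: "\<B> - insert B0 \<D> = (\<B> - \<D>) - {B0}" by auto
          have "(\<Sum>B\<in>\<B> - \<D>. (c(B0 := c0)) B * F B w)
            = c0 * F B0 w + (\<Sum>B\<in>\<B> - insert B0 \<D>. (c(B0 := c0)) B * F B w)"
            unfolding d using B(1) B0 insert.hyps by (subst sum.remove[of "\<B> - \<D>" B0]) auto
          also have "(\<Sum>B\<in>\<B> - insert B0 \<D>. (c(B0 := c0)) B * F B w) = (\<Sum>B\<in>\<B> - insert B0 \<D>. c B * F B w)"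
            by (intro sum.cong) auto
          finally have "iexp (\<Sum>B\<in>\<B> - \<D>. (c(B0 := c0)) B * F B w)
              = iexp (c0 * F B0 w) * iexp (\<Sum>B\<in>\<B> - insert B0 \<D>. c B * F B w)"
            by (simp only: of_real_add distrib_left exp_add)
          moreover have "e * (p * (r * y)) = p * ((e * r) * y)" for e p r y :: complex by simp
          ultimately show ?thesis unfolding Y_def by metis
        qed
        then show "(LINT w|M. iexp (c0 * F B0 w) * ?R w) = 0"
          using insert.IH[OF D] by simp
      qed
      then show "(LINT w|M. Y (insert B0 \<D>) (insert B0 \<D>) c v w) = 0"
        unfolding Y_def using insert.hyps by (simp add: ind_def mult.assoc)
    qed
  qed
  from this[OF B(1) subset_refl] have Y0: "(LINT w|M. Y \<B> \<B> (\<lambda>_. 0) v w) = 0" for v by blast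
  let ?a = "\<lambda>w. complex_of_real (indicator A w)" and ?T = "V -` T \<inter> space M"
  have YA: "Y \<B> \<B> c v w = ?a w * \<psi> v w" if w: "w \<in> space M" for c v w
  proof -
    have "(\<Prod>B\<in>\<B>. ind B w) = ?a w"
    proof (cases "w \<in> A")
      case True then show ?thesis by (auto simp: ind_def A_def intro!: prod.neutral)
    next
      case False
      then obtain B where "B \<in> \<B>" "F B w \<notin> S B" using w by (auto simp: A_def)
      then have "\<exists>B\<in>\<B>. ind B w = 0" by (auto simp: ind_def intro!: bexI[of _ B])
      then show ?thesis using False B(1) by (simp add: prod_zero_iff)
    qed
    then show ?thesis by (simp add: Y_def)
  qed
  \<comment> \<open>The same exchange for \<open>V\<close>, now with the centered indicator of
    \<open>A\<close> as the weight.\<close>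
  have "(LINT w|M. indicator T (V w) * (indicator A w - prob A)) = 0"
  proof (rule char_zero_imp_indicator_zero_real[OF _ V _ T])
    show "integrable M (\<lambda>w. indicator A w - prob A)" by (auto simp: emeasure_eq_measure)
    fix v
    have iA: "integrable M (\<lambda>w. ?a w)"
      by (rule integrable_const_bound[where B=1]) (auto simp: indicator_def)
    have iAV: "integrable M (\<lambda>w. ?a w * iexp (v * V w))"
      by (rule integrable_const_bound[where B=1]) (auto simp: indicator_def)
    have "0 = (LINT w|M. ?a w * \<psi> v w)"
      using Y0[of v] YA by (simp cong: Bochner_Integration.integral_cong)
    also have "\<dots> = (LINT w|M. ?a w * iexp (v * V w)
        - ?a w * ?E v)"
      by (simp only: \<psi>_def right_diff_distrib)
    also have "\<dots> = (LINT w|M. ?a w * iexp (v * V w))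
        - (LINT w|M. ?a w) * ?E v"
      by (subst Bochner_Integration.integral_diff[OF iAV integrable_mult_left[OF iA]]) (simp only: integral_mult_left_zero)
    also have "(LINT w|M. ?a w) = complex_of_real (prob A)"
      by (subst integral_complex_of_real) simp
    finally have e: "(LINT w|M. ?a w * iexp (v * V w))
        = complex_of_real (prob A) * ?E v" by simp
    have "(LINT w|M. iexp (v * V w) * of_real (indicator A w - prob A))
      = (LINT w|M. ?a w * iexp (v * V w) - complex_of_real (prob A) * iexp (v * V w))"
      by (intro LINT_cong) (simp only: of_real_diff right_diff_distrib mult.commute)
    also have "\<dots> = 0"
      by (subst Bochner_Integration.integral_diff[OF iAV integrable_mult_right[OF iV]]) (simp only: integral_mult_right_zero e diff_self)
    finally show "(LINT w|M. iexp (v * V w) * of_real (indicator A w - prob A)) = 0" .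
  qed
  also have "(LINT w|M. indicator T (V w) * (indicator A w - prob A))
     = (LINT w|M. indicator (A \<inter> ?T) w - prob A * indicator ?T w)"
    by (intro LINT_cong) (auto simp: indicator_def)
  also have "\<dots> = prob (A \<inter> ?T) - prob A * prob ?T"
    by (subst Bochner_Integration.integral_diff) (auto simp: emeasure_eq_measure Int_assoc)
  finally show ?thesis by simp
qed

text \<open>Independence on the generator \<open>past_cylinders\<close> extends to the generated
  sigma-algebra, because the generator and the preimages under \<open>V\<close> are both
  intersection-stable.\<close>

lemma indep_past_future:
  fixes k :: "(real \<times> 'a) set \<Rightarrow> real"
  assumes C: "finite \<C>" "\<C> \<subseteq> future a" and X: "adapted a X"
  shows "indep_var borel X borel (\<lambda>w. \<Sum>C\<in>\<C>. k C * F C w)"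
proof -
  define V where "V w = (\<Sum>C\<in>\<C>. k C * F C w)" for w
  have "F C \<in> borel_measurable M" if "C \<in> \<C>" for C
    using that C by (auto simp: future_def intro: borel_measurable_noise)
  then have V[measurable]: "V \<in> borel_measurable M"
    unfolding V_def by (intro borel_measurable_sum borel_measurable_times) auto
  let ?V = "{V -` T \<inter> space M | T. T \<in> sets borel}"
  have "indep_set (past_cylinders a) ?V"
    unfolding indep_sets2_eq
  proof (intro conjI ballI)
    show "?V \<subseteq> events" by auto
    fix A D assume A: "A \<in> past_cylinders a" and D: "D \<in> ?V"
    then obtain T where T: "T \<in> sets borel" "D = V -` T \<inter> space M" by auto
    have "D \<in> sets M" using T by auto
    show "prob (A \<inter> D) = prob A * prob D"
    proof (cases "A \<in> null_sets M")
      case True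
      then have "A \<inter> D \<in> null_sets M" using \<open>D \<in> sets M\<close> null_set_Int2 by blast
      then show ?thesis using True by (simp add: measure_eq_0_null_sets)
    next
      case False
      then obtain \<B> S where "finite \<B>" "\<B> \<subseteq> past a" "\<forall>B. S B \<in> sets borel" "A = {w \<in> space M. \<forall>B\<in>\<B>. F B w \<in> S B}"
        using A unfolding past_cylinders_def by blast
      then show ?thesis
        using cylinder_independent[of \<B> a S \<C> T k] C T unfolding V_def by auto
    qed
  qed (rule past_cylinders_sets)
  moreover have "Int_stable ?V"
  proof (rule Int_stableI)
    fix A B assume "A \<in> ?V" "B \<in> ?V"
    then obtain S T where "S \<in> sets borel" "A = V -` S \<inter> space M" "T \<in> sets borel" "B = V -` T \<inter> space M" by auto
    then show "A \<inter> B \<in> ?V" by (intro CollectI exI[of _ "S \<inter> T"]) auto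
  qed
  ultimately have ind: "indep_set (sigma_sets (space M) (past_cylinders a)) (sigma_sets (space M) ?V)"
    using Int_stable_past_cylinders by (intro indep_set_sigma_sets)
  have "sigma_sets (space M) {X -` A \<inter> space M | A. A \<in> sets borel} \<subseteq> sigma_sets (space M) (past_cylinders a)"
  proof (rule sigma_sets_mono)
    show "{X -` A \<inter> space M | A. A \<in> sets borel} \<subseteq> sigma_sets (space M) (past_cylinders a)"
      using measurable_sets[OF X] filtration_sets_cylinders[of a] by auto
  qed
  with ind have "indep_set (sigma_sets (space M) {X -` A \<inter> space M | A. A \<in> sets borel}) (sigma_sets (space M) ?V)"
    unfolding indep_sets2_eq by blast
  then have "indep_var borel X borel V"
    unfolding indep_var_eq using filtration_measurable[OF X] V by simp
  then show ?thesis unfolding V_def .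
qed

section \<open>Expectations of products of past variables and future noise\<close>

lemma expectation_past_future:
  assumes X: "adapted a X" "integrable M X" and C: "C \<in> future a"
  shows "integrable M (\<lambda>w. X w * F C w)" and "(LINT w|M. X w * F C w) = 0"
proof -
  have "indep_var borel X borel (F C)"
    using indep_past_future[of "{C}" a X "\<lambda>_. 1"] X C by simp
  moreover have "centered_gaussian M (F C)" using C by (intro noise_gaussian) (simp add: future_def)
  note g = centered_gaussian_moments[OF this]
  ultimately show "integrable M (\<lambda>w. X w * F C w)" "(LINT w|M. X w * F C w) = 0"
    using indep_var_integrable[of X "F C"] indep_var_lebesgue_integral[of X "F C"] X(2) g by auto
qed

lemma expectation_past_future_square:
  fixes k :: "(real \<times> 'a) set \<Rightarrow> real"
  assumes X: "adapted a X" "integrable M X" and C: "finite \<C>" "\<C> \<subseteq> future a"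
  defines "V \<equiv> \<lambda>w. \<Sum>C\<in>\<C>. k C * F C w"
  shows "integrable M (\<lambda>w. X w * (V w)\<^sup>2)" and "(LINT w|M. X w * (V w)\<^sup>2) = (LINT w|M. X w) * (LINT w|M. (V w)\<^sup>2)"
proof -
  have "indep_var borel X borel V"
    unfolding V_def by (rule indep_past_future[OF C X(1)])
  from indep_var_compose[OF this, of "\<lambda>x. x" borel "\<lambda>x. x\<^sup>2" borel]
  have "indep_var borel X borel (\<lambda>w. (V w)\<^sup>2)" by (simp add: comp_def)
  moreover have "centered_gaussian M V"
    unfolding V_def using C by (intro noise_combination) (auto simp: future_def)
  note g = centered_gaussian_moments(1)[OF this]
  ultimately show "integrable M (\<lambda>w. X w * (V w)\<^sup>2)" "(LINT w|M. X w * (V w)\<^sup>2) = (LINT w|M. X w) * (LINT w|M. (V w)\<^sup>2)"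
    using indep_var_integrable[of X "\<lambda>w. (V w)\<^sup>2"] indep_var_lebesgue_integral[of X "\<lambda>w. (V w)\<^sup>2"] X(2) by auto
qed

text \<open>Polarisation: independence is available for linear combinations of the noise, so the
  product is recovered from the squares of \<open>F C\<close>, \<open>F C'\<close> and their sum.
  Equal sets are treated apart because the set \<open>{C, C'}\<close> would then collapse.\<close>

lemma expectation_past_future2:
  assumes X: "adapted a X" "integrable M X" and C: "C \<in> future a" "C' \<in> future a"
  shows "integrable M (\<lambda>w. X w * (F C w * F C' w))" (is ?I)
    and "(LINT w|M. X w * (F C w * F C' w)) = (LINT w|M. X w) * noise_cov C C'" (is ?E)
proof -
  have n: "C \<in> noise_sets" "C' \<in> noise_sets" using C by (auto simp: future_def)
  have one: "integrable M (\<lambda>w. X w * (F C w)\<^sup>2)"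
    "(LINT w|M. X w * (F C w)\<^sup>2) = (LINT w|M. X w) * noise_cov C C" if "C \<in> future a" for C
    using expectation_past_future_square[OF X, of "{C}" "\<lambda>_. 1"] that
    by (simp_all add: noise_cov_def power2_eq_square)
  have "?I \<and> ?E"
  proof (cases "C = C'")
    case True then show ?thesis using one[OF C(1)] by (simp add: power2_eq_square)
  next
    case False
    define V where "V w = F C w + F C' w" for w
    have V: "V = (\<lambda>w. \<Sum>D\<in>{C, C'}. 1 * F D w)" using False by (auto simp: V_def)
    have sq: "integrable M (\<lambda>w. X w * (V w)\<^sup>2)" "(LINT w|M. X w * (V w)\<^sup>2) = (LINT w|M. X w) * (LINT w|M. (V w)\<^sup>2)"
      unfolding V by (rule expectation_past_future_square[OF X]; use C in auto)+
    have i: "integrable M (\<lambda>w. F C w * F C w)" "integrable M (\<lambda>w. F C' w * F C' w)" "integrable M (\<lambda>w. F C w * F C' w)"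
      using n by (auto intro: integrable_noise_mult)
    have "(LINT w|M. (V w)\<^sup>2) = (LINT w|M. F C w * F C w + F C' w * F C' w + 2 * (F C w * F C' w))"
      by (simp add: V_def power2_eq_square algebra_simps)
    also have "\<dots> = noise_cov C C + noise_cov C' C' + 2 * noise_cov C C'"
      using i by (simp add: noise_cov_def)
    finally have V2: "(LINT w|M. (V w)\<^sup>2) = noise_cov C C + noise_cov C' C' + 2 * noise_cov C C'" .
    have eq: "X w * (F C w * F C' w) = (X w * (V w)\<^sup>2 - X w * (F C w)\<^sup>2 - X w * (F C' w)\<^sup>2) / 2" for w
      by (simp add: V_def power2_eq_square algebra_simps)
    show ?thesis unfolding eq
      using sq one[OF C(1)] one[OF C(2)] by (simp add: V2 algebra_simps)
  qed
  then show ?I ?E by auto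
qed

end

section \<open>The isometry of the Walsh integral\<close>

lemma (in pair_sigma_finite)
  fixes u :: "'a \<Rightarrow> real" and v :: "'b \<Rightarrow> real"
  assumes u: "integrable M1 u" and v: "integrable M2 v"
  shows integrable_pair_mult: "integrable (M1 \<Otimes>\<^sub>M M2) (\<lambda>(x, y). u x * v y)"
    and integral_pair_mult: "(LINT (x, y)|(M1 \<Otimes>\<^sub>M M2). u x * v y) = (\<integral>x. u x \<partial>M1) * (\<integral>y. v y \<partial>M2)"
proof -
  have [measurable]: "u \<in> borel_measurable M1" "v \<in> borel_measurable M2" using u v by auto
  show i: "integrable (M1 \<Otimes>\<^sub>M M2) (\<lambda>(x, y). u x * v y)"
  proof (rule Fubini_integrable)
    show "integrable M1 (\<lambda>x. \<integral>y. norm (case (x, y) of (x, y) \<Rightarrow> u x * v y) \<partial>M2)"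
      using u by (simp add: abs_mult)
    show "AE x in M1. integrable M2 (\<lambda>y. case (x, y) of (x, y) \<Rightarrow> u x * v y)"
      using v by simp
  qed measurable
  show "(LINT (x, y)|(M1 \<Otimes>\<^sub>M M2). u x * v y) = (\<integral>x. u x \<partial>M1) * (\<integral>y. v y \<partial>M2)"
    unfolding integral_fst'[OF i, symmetric] by simp
qed

abbreviation lborel2 :: "('a::euclidean_space \<times> 'a) measure" where
  "lborel2 \<equiv> lborel \<Otimes>\<^sub>M lborel"

abbreviation lborel3 :: "(real \<times> 'a::euclidean_space \<times> 'a) measure" where
  "lborel3 \<equiv> lborel \<Otimes>\<^sub>M lborel2"

section \<open>Spatial covariances and integrals of elementary processes\<close>

context colored_noise begin

text \<open>Written with \<open>\<bar>f\<bar>\<close> to match Walsh's form; by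
  \<open>AE_f_eq\<close> the absolute value does not change the integral.\<close>

definition spatial_cov :: "'a set \<Rightarrow> 'a set \<Rightarrow> real" where
  "spatial_cov A B = (LINT (y, z)|lborel2. indicator A y * \<bar>f y z\<bar> * indicator B z)"

text \<open>If all points of both sets have norm at most \<open>R\<close>, their differences lie in
  \<open>cball 0 (2 * R)\<close>, where \<open>g\<close> is integrable. So off the diagonal
  \<open>f\<close> is dominated by a translate of one integrable function, uniformly over the first
  set, which has finite measure.\<close>

lemma integrable_spatial_cov:
  assumes A: "A \<in> bounded_borel" and B: "B \<in> bounded_borel"
  shows "integrable lborel2 (\<lambda>(y, z). indicator A y * \<bar>f y z\<bar> * indicator B z)"
proof -
  have [measurable]: "A \<in> sets borel" "B \<in> sets borel" and "bounded A" "bounded B"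
    using A B by (auto simp: bounded_borel_def)
  then have "bounded (A \<union> B)" by simp
  then obtain R where R: "\<And>x. x \<in> A \<union> B \<Longrightarrow> norm x \<le> R" unfolding bounded_iff by blast
  define k where "k x = indicator (cball 0 (2 * R)) x *\<^sub>R g x" for x
  have ik: "integrable lborel k"
    using g_int compact_cball[of "0::'a" "2 * R"] by (simp add: locally_integrable_def set_integrable_def k_def[abs_def])
  then have [measurable]: "k \<in> borel_measurable borel" by auto
  let ?C = "\<integral>\<^sup>+x. ennreal \<bar>k x\<bar> \<partial>lborel"
  have nk: "?C < \<infinity>"
    using ik by (simp add: integrable_iff_bounded)
  have "(\<integral>\<^sup>+w. ennreal (norm (case w of (y, z) \<Rightarrow> indicator A y * \<bar>f y z\<bar> * indicator B z)) \<partial>lborel2)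
      = (\<integral>\<^sup>+y. \<integral>\<^sup>+z. ennreal (indicator A y * \<bar>f y z\<bar> * indicator B z) \<partial>lborel \<partial>lborel)"
    by (subst lborel.nn_integral_fst[symmetric]) (auto simp: abs_mult)
  also have "\<dots> \<le> (\<integral>\<^sup>+y. indicator A y * ?C \<partial>lborel)"
  proof (intro nn_integral_mono)
    fix y
    show "(\<integral>\<^sup>+z. ennreal (indicator A y * \<bar>f y z\<bar> * indicator B z) \<partial>lborel) \<le> indicator A y * ?C"
    proof (cases "y \<in> A")
      case True
      have "AE z in lborel. ennreal (indicator A y * \<bar>f y z\<bar> * indicator B z) \<le> ennreal \<bar>k (y - z)\<bar>"
        using AE_lborel_singleton[of y]
      proof eventually_elim
        case (elim z)
        show ?case
        proof (cases "z \<in> B")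
          case zB: True
          have "norm (y - z) \<le> norm y + norm z" by (rule norm_triangle_ineq4)
          also have "\<dots> \<le> 2 * R" using R[of y] R[of z] True zB by auto
          finally have "k (y - z) = g (y - z)" by (simp add: k_def)
          then show ?thesis using f_le[of y z] f_pos[of y z] elim True zB by (auto intro!: ennreal_leI)
        qed simp
      qed
      then have "(\<integral>\<^sup>+z. ennreal (indicator A y * \<bar>f y z\<bar> * indicator B z) \<partial>lborel) \<le> (\<integral>\<^sup>+z. ennreal \<bar>k (y - z)\<bar> \<partial>lborel)"
        by (rule nn_integral_mono_AE)
      also have "\<dots> = ?C"
        by (rule nn_integral_lborel_reflect) measurable
      finally show ?thesis using True by simp
    qed simp
  qed
  also have "\<dots> = emeasure lborel A * ?C"
    by (subst nn_integral_multc) auto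
  also have "\<dots> < \<infinity>"
    using nk emeasure_bounded_finite[OF \<open>bounded A\<close>] by (simp add: ennreal_mult_less_top)
  finally show ?thesis by (intro integrableI_bounded) auto
qed

lemma spatial_cov_eq:
  assumes A: "A \<in> bounded_borel" and B: "B \<in> bounded_borel"
  shows "(LINT y|lborel. (LINT z|lborel. indicator A y * f y z * indicator B z)) = spatial_cov A B"
proof -
  have [measurable]: "A \<in> sets borel" "B \<in> sets borel"
    using A B by (auto simp: bounded_borel_def)
  have "(LINT z|lborel. indicator A y * f y z * indicator B z) = (LINT z|lborel. indicator A y * \<bar>f y z\<bar> * indicator B z)" for y
  proof (rule integral_cong_AE)
    have [measurable]: "(\<lambda>z. f y z) \<in> borel_measurable borel" by measurable
    show "(\<lambda>z. indicator A y * f y z * indicator B z) \<in> borel_measurable lborel"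
      "(\<lambda>z. indicator A y * \<bar>f y z\<bar> * indicator B z) \<in> borel_measurable lborel" by measurable
    show "AE z in lborel. indicator A y * f y z * indicator B z = indicator A y * \<bar>f y z\<bar> * indicator B z"
      using AE_f_eq[of y] by eventually_elim simp
  qed
  then show ?thesis
    unfolding spatial_cov_def lborel_pair.integral_fst'[OF integrable_spatial_cov[OF A B], symmetric]
    by simp
qed

lemma box_noise_sets:
  assumes "0 \<le> a" "A \<in> bounded_borel"
  shows "{a<..b} \<times> A \<in> noise_sets"
  using assms by (auto simp: noise_sets_def bounded_borel_def bounded_Times
      simp flip: borel_prod intro!: pair_measureI)

lemma noise_cov_box:
  assumes "0 \<le> a" "A \<in> bounded_borel" "0 \<le> a'" "A' \<in> bounded_borel"
  shows "noise_cov ({a<..b} \<times> A) ({a'<..b'} \<times> A') = measure lborel ({a<..b} \<inter> {a'<..b'}) * spatial_cov A A'"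
proof -
  have "noise_cov ({a<..b} \<times> A) ({a'<..b'} \<times> A')
    = (LINT s|lborel. (LINT y|lborel. (LINT z|lborel. indicator ({a<..b} \<inter> {a'<..b'}) s * (indicator A y * f y z * indicator A' z))))"
    unfolding noise_cov_eq[OF box_noise_sets[OF assms(1,2)] box_noise_sets[OF assms(3,4)]]
    by (intro LINT_cong) (auto simp: indicator_def)
  also have "\<dots> = measure lborel ({a<..b} \<inter> {a'<..b'}) * spatial_cov A A'"
    by (simp add: spatial_cov_eq[OF assms(2,4)] flip: Int_greaterThanAtMost)
  finally show ?thesis .
qed

text \<open>The symmetry is that of the noise covariance, read off from boxes over the unit time
  interval; it is not visible from the integral formula.\<close>

lemma spatial_cov_commute:
  assumes "A \<in> bounded_borel" "B \<in> bounded_borel"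
  shows "spatial_cov A B = spatial_cov B A"
  using noise_cov_box[of 0 A 0 B 1 1] noise_cov_box[of 0 B 0 A 1 1] noise_cov_commute assms
  by (simp add: noise_cov_commute)

text \<open>Additivity is not part of \<open>gaussian_noise\<close>, but the covariances force the
  defect to have second moment 0.\<close>

lemma noise_additive:
  assumes "0 \<le> a" "a \<le> c" "c \<le> b" and A: "A \<in> bounded_borel"
  shows "AE w in M. F ({a<..b} \<times> A) w = F ({a<..c} \<times> A) w + F ({c<..b} \<times> A) w"
proof -
  let ?U = "{a<..b} \<times> A" and ?V = "{a<..c} \<times> A" and ?W = "{c<..b} \<times> A"
  have c0: "0 \<le> c" using assms by simp
  have n: "?U \<in> noise_sets" "?V \<in> noise_sets" "?W \<in> noise_sets"
    using assms by (auto intro!: box_noise_sets)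
  note i = integrable_noise_mult[OF n(1) n(1)] integrable_noise_mult[OF n(2) n(2)] integrable_noise_mult[OF n(3) n(3)]
    integrable_noise_mult[OF n(1) n(2)] integrable_noise_mult[OF n(1) n(3)] integrable_noise_mult[OF n(2) n(3)]
  let ?D = "\<lambda>w. (F ?U w - F ?V w - F ?W w)\<^sup>2"
  have eq: "?D = (\<lambda>w. F ?U w * F ?U w + F ?V w * F ?V w + F ?W w * F ?W w
      - 2 * (F ?U w * F ?V w) - 2 * (F ?U w * F ?W w) + 2 * (F ?V w * F ?W w))"
    by (rule ext) (simp add: power2_eq_square algebra_simps)
  have iD: "integrable M ?D" unfolding eq by (simp add: i)
  have "{a<..b} \<inter> {a<..c} = {a<..c}" "{a<..b} \<inter> {c<..b} = {c<..b}" "{a<..c} \<inter> {c<..b} = {}"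
    using assms by auto
  then have cov: "noise_cov ?U ?U = (b - a) * spatial_cov A A" "noise_cov ?V ?V = (c - a) * spatial_cov A A"
    "noise_cov ?W ?W = (b - c) * spatial_cov A A" "noise_cov ?U ?V = (c - a) * spatial_cov A A"
    "noise_cov ?U ?W = (b - c) * spatial_cov A A" "noise_cov ?V ?W = 0"
    using assms c0 by (simp_all add: noise_cov_box)
  have "(LINT w|M. ?D w) = noise_cov ?U ?U + noise_cov ?V ?V + noise_cov ?W ?W
    - 2 * noise_cov ?U ?V - 2 * noise_cov ?U ?W + 2 * noise_cov ?V ?W"
    unfolding eq noise_cov_def by (simp add: i)
  also have "\<dots> = 0" unfolding cov by (simp add: algebra_simps)
  finally have "AE w in M. ?D w = 0"
    using integral_nonneg_eq_0_iff_AE[OF iD] by simp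
  then show ?thesis by eventually_elim simp
qed

text \<open>The box that starts first is cut at \<open>c = min b a'\<close>. Its part before
  \<open>c\<close> is known at time \<open>a'\<close>, hence orthogonal to the other box; its part
  after \<open>c\<close> is, like the other box, in the future of \<open>a'\<close>, so that
  \<open>X w * X' w\<close> splits off by independence. If \<open>b \<le> a'\<close> the second part
  is empty.\<close>

lemma expectation_elementary_ordered:
  assumes ab: "0 \<le> a" "a \<le> b" "a \<le> a'" and A: "A \<in> bounded_borel" "A' \<in> bounded_borel"
    and X: "adapted a X" "\<And>w. w \<in> space M \<Longrightarrow> \<bar>X w\<bar> \<le> C"
    and X': "adapted a' X'" "\<And>w. w \<in> space M \<Longrightarrow> \<bar>X' w\<bar> \<le> C'"
  shows "integrable M (\<lambda>w. (X w * F ({a<..b} \<times> A) w) * (X' w * F ({a'<..b'} \<times> A') w))" (is ?I)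
    and "(LINT w|M. (X w * F ({a<..b} \<times> A) w) * (X' w * F ({a'<..b'} \<times> A') w))
      = (LINT w|M. X w * X' w) * measure lborel ({a<..b} \<inter> {a'<..b'}) * spatial_cov A A'" (is ?E)
proof -
  define c where "c = min b a'"
  have c: "a \<le> c" "c \<le> b" "c \<le> a'" "0 \<le> c" using ab by (auto simp: c_def)
  let ?U = "{a<..b} \<times> A" and ?V = "{a<..c} \<times> A" and ?W = "{c<..b} \<times> A" and ?C = "{a'<..b'} \<times> A'"
  have n: "?U \<in> noise_sets" "?V \<in> noise_sets" "?W \<in> noise_sets" "?C \<in> noise_sets"
    using ab c A by (auto intro!: box_noise_sets)
  note [measurable] = borel_measurable_noise[OF n(1)] borel_measurable_noise[OF n(2)] borel_measurable_noise[OF n(3)]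
    borel_measurable_noise[OF n(4)] filtration_measurable[OF X(1)] filtration_measurable[OF X'(1)]
  have V: "?V \<in> past a'" using n c ab by (auto simp: past_def)
  have W: "?W \<in> future a'" using n by (auto simp: future_def c_def)
  have Cf: "?C \<in> future a'" using n by (auto simp: future_def)
  define Y where "Y w = X w * X' w" for w
  have Ya: "Y \<in> borel_measurable (noise_filtration M F a')"
    unfolding Y_def using filtration_mono[OF X(1) ab(3)] X'(1) by measurable
  have Y_le: "\<bar>Y w\<bar> \<le> \<bar>C\<bar> * \<bar>C'\<bar>" if "w \<in> space M" for w
    unfolding Y_def abs_mult using X(2)[OF that] X'(2)[OF that] by (intro mult_mono) auto
  have Ym [measurable]: "Y \<in> borel_measurable M" by (rule filtration_measurable[OF Ya])
  have iY: "integrable M Y"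
    using Y_le by (intro integrable_const_bound[where B="\<bar>C\<bar> * \<bar>C'\<bar>"]) auto
  have YV: "(\<lambda>w. Y w * F ?V w) \<in> borel_measurable (noise_filtration M F a')"
    using Ya noise_measurable_filtration[OF V] by measurable
  have iV: "integrable M (F ?V)" by (rule centered_gaussian_moments(2)[OF noise_gaussian[OF n(2)]])
  have iYV: "integrable M (\<lambda>w. Y w * F ?V w)"
  proof (rule Bochner_Integration.integrable_bound[OF integrable_mult_right[OF iV, of "\<bar>C\<bar> * \<bar>C'\<bar>"]])
    show "AE w in M. norm (Y w * F ?V w) \<le> norm (\<bar>C\<bar> * \<bar>C'\<bar> * F ?V w)"
      using Y_le by (auto simp: abs_mult intro!: mult_right_mono)
  qed measurable
  note first = expectation_past_future[OF YV iYV Cf]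
  note second = expectation_past_future2[OF Ya iY W Cf]
  have AE: "AE w in M. (X w * F ?U w) * (X' w * F ?C w) = Y w * F ?V w * F ?C w + Y w * (F ?W w * F ?C w)"
    using noise_additive[OF ab(1) c(1,2) A(1)] by eventually_elim (simp add: Y_def algebra_simps)
  show ?I
    by (rule integrable_cong_AE_imp[OF Bochner_Integration.integrable_add[OF first(1) second(1)]])
       (use AE in \<open>auto simp: eq_commute\<close>)
  have "(LINT w|M. (X w * F ?U w) * (X' w * F ?C w)) = (LINT w|M. Y w * F ?V w * F ?C w + Y w * (F ?W w * F ?C w))"
    by (rule integral_cong_AE) (use AE in auto)
  also have "\<dots> = (LINT w|M. Y w) * noise_cov ?W ?C"
    unfolding Bochner_Integration.integral_add[OF first(1) second(1)] first(2) second(2) by simp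
  also have "noise_cov ?W ?C = measure lborel ({c<..b} \<inter> {a'<..b'}) * spatial_cov A A'"
    using c ab A by (intro noise_cov_box) auto
  also have "{c<..b} \<inter> {a'<..b'} = {a<..b} \<inter> {a'<..b'}" using c ab by (auto simp: c_def)
  finally show ?E by (simp add: Y_def mult.assoc)
qed

lemma expectation_elementary:
  assumes "0 \<le> a" "a \<le> b" and A: "A \<in> bounded_borel"
    and X: "adapted a X" "\<exists>C. \<forall>w\<in>space M. \<bar>X w\<bar> \<le> C"
    and "0 \<le> a'" "a' \<le> b'" and A': "A' \<in> bounded_borel"
    and X': "adapted a' X'" "\<exists>C. \<forall>w\<in>space M. \<bar>X' w\<bar> \<le> C"
  shows "integrable M (\<lambda>w. (X w * F ({a<..b} \<times> A) w) * (X' w * F ({a'<..b'} \<times> A') w))" (is ?I)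
    and "(LINT w|M. (X w * F ({a<..b} \<times> A) w) * (X' w * F ({a'<..b'} \<times> A') w))
      = (LINT w|M. X w * X' w) * measure lborel ({a<..b} \<inter> {a'<..b'}) * spatial_cov A A'" (is ?E)
proof -
  obtain C C' where C: "\<And>w. w \<in> space M \<Longrightarrow> \<bar>X w\<bar> \<le> C" "\<And>w. w \<in> space M \<Longrightarrow> \<bar>X' w\<bar> \<le> C'"
    using X X' by blast
  have "?I \<and> ?E"
  proof (cases "a \<le> a'")
    case True
    then show ?thesis
      using expectation_elementary_ordered[OF assms(1,2) True A A' X(1) C(1) X'(1) C(2)] by simp
  next
    case False
    then have "a' \<le> a" by simp
    note e = expectation_elementary_ordered[OF assms(6,7) this A' A X'(1) C(2) X(1) C(1), of b]
    show ?thesis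
      using e spatial_cov_commute[OF A A'] by (simp only: mult.commute Int_commute)
  qed
  then show ?I ?E by auto
qed


text \<open>Positive definiteness of \<open>f\<close>, read off from \<open>E (\<Sum> c F)\<^sup>2 \<ge> 0\<close> for boxes over one time interval.\<close>

lemma simple_spatial_form:
  fixes u v :: "'a \<Rightarrow> real"
  assumes u: "simple_function borel u" and v: "simple_function borel v" and K: "bounded K" "K \<in> sets borel"
  shows "integrable lborel2 (\<lambda>(y, z). (u y * indicator K y) * \<bar>f y z\<bar> * (v z * indicator K z))" (is ?i)
    and "0 \<le> (LINT (y, z)|lborel2. (u y * indicator K y) * \<bar>f y z\<bar> * (u z * indicator K z))" (is "0 \<le> ?q")
proof -
  define L where "L k c = k -` {c} \<inter> K" for k :: "'a \<Rightarrow> real" and c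
  have L: "L k c \<in> bounded_borel" if "simple_function borel k" for k c
    using simple_functionD(2)[OF that, of "{c}"] K
    by (auto simp: L_def bounded_borel_def intro: bounded_subset[OF K(1)])
  have fin: "finite (k ` UNIV)" if "simple_function borel k" for k :: "'a \<Rightarrow> real"
    using simple_functionD(1)[OF that] by simp
  have rep: "k y * indicator K y = (\<Sum>c\<in>k ` UNIV. c * indicator (L k c) y)" if "simple_function borel k" for k :: "'a \<Rightarrow> real" and y
  proof -
    have "(\<Sum>c\<in>k ` UNIV. c * indicator (L k c) y) = (\<Sum>c\<in>{k y}. c * indicator (L k c) y)"
      using fin[OF that] by (intro sum.mono_neutral_right) (auto simp: L_def indicator_def)
    then show ?thesis by (simp add: L_def indicator_def)
  qed
  have eq: "(\<lambda>(y, z). (u y * indicator K y) * \<bar>f y z\<bar> * (v z * indicator K z))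
      = (\<lambda>x. \<Sum>c\<in>u ` UNIV. \<Sum>d\<in>v ` UNIV. c * d * (case x of (y, z) \<Rightarrow> indicator (L u c) y * \<bar>f y z\<bar> * indicator (L v d) z))"
    if "simple_function borel u" "simple_function borel v" for u v :: "'a \<Rightarrow> real"
  proof
    fix x :: "'a \<times> 'a"
    show "(case x of (y, z) \<Rightarrow> (u y * indicator K y) * \<bar>f y z\<bar> * (v z * indicator K z))
      = (\<Sum>c\<in>u ` UNIV. \<Sum>d\<in>v ` UNIV. c * d * (case x of (y, z) \<Rightarrow> indicator (L u c) y * \<bar>f y z\<bar> * indicator (L v d) z))"
      unfolding case_prod_beta rep[OF that(1)] rep[OF that(2)] sum_distrib_right sum_distrib_left
      by (subst sum.swap) (simp add: mult_ac)
  qed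
  have int: "integrable lborel2 (\<lambda>x. c * d * (case x of (y, z) \<Rightarrow> indicator (L u c) y * \<bar>f y z\<bar> * indicator (L v d) z))"
    if "simple_function borel u" "simple_function borel v" for u v c d
    by (intro integrable_mult_right integrable_spatial_cov L that)
  show ?i
    unfolding eq[OF u v] by (intro Bochner_Integration.integrable_sum int u v)
  define B where "B c = {0<..1::real} \<times> L u c" for c
  have Bn: "B c \<in> noise_sets" for c unfolding B_def by (intro box_noise_sets L u) simp
  have cov: "noise_cov (B c) (B d) = spatial_cov (L u c) (L u d)" for c d
    unfolding B_def using L[OF u] by (subst noise_cov_box) auto
  have "?q
      = (\<Sum>c\<in>u ` UNIV. \<Sum>d\<in>u ` UNIV. c * d * noise_cov (B c) (B d))"
    unfolding eq[OF u u] cov spatial_cov_def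
    by (subst Bochner_Integration.integral_sum, intro Bochner_Integration.integrable_sum int u,
        subst Bochner_Integration.integral_sum, intro int u, simp)
  also have "\<dots> = (\<Sum>c\<in>u ` UNIV. \<Sum>d\<in>u ` UNIV. LINT w|M. c * d * (F (B c) w * F (B d) w))"
    by (simp add: noise_cov_def)
  also have "\<dots> = (LINT w|M. (\<Sum>c\<in>u ` UNIV. \<Sum>d\<in>u ` UNIV. c * d * (F (B c) w * F (B d) w)))"
    using integrable_noise_mult[OF Bn Bn]
    by (subst Bochner_Integration.integral_sum, intro Bochner_Integration.integrable_sum integrable_mult_right, simp,
        subst Bochner_Integration.integral_sum, intro integrable_mult_right, simp, simp)
  also have "\<dots> = (LINT w|M. (\<Sum>c\<in>u ` UNIV. c * F (B c) w)\<^sup>2)"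
    by (simp add: power2_eq_square sum_product mult_ac)
  also have "0 \<le> \<dots>" by simp
  finally show "0 \<le> ?q" .
qed

definition spatial_form :: "('a \<Rightarrow> real) \<Rightarrow> ('a \<Rightarrow> real) \<Rightarrow> ennreal" where
  "spatial_form \<phi> \<psi> = (\<integral>\<^sup>+x. (case x of (y, z) \<Rightarrow> ennreal (\<bar>\<phi> y\<bar> * \<bar>f y z\<bar> * \<bar>\<psi> z\<bar>)) \<partial>lborel2)"

text \<open>Positive definiteness at \<open>u - v\<close> bounds the sum of the two mixed terms, and
  the one not wanted is nonnegative. Simple functions cut off to a bounded set keep all terms
  finite, so that the square can be expanded in the reals.\<close>

lemma spatial_form_simple_le:
  assumes u: "simple_function borel u" "\<And>y. 0 \<le> u y" and v: "simple_function borel v" "\<And>y. 0 \<le> v y"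
    and K: "bounded K" "K \<in> sets borel"
  shows "spatial_form (\<lambda>y. u y * indicator K y) (\<lambda>y. v y * indicator K y)
    \<le> spatial_form (\<lambda>y. u y * indicator K y) (\<lambda>y. u y * indicator K y)
      + spatial_form (\<lambda>y. v y * indicator K y) (\<lambda>y. v y * indicator K y)"
proof -
  define k where "k u v = (\<lambda>(y, z). (u y * indicator K y) * \<bar>f y z\<bar> * (v z * indicator K z))" for u v :: "'a \<Rightarrow> real"
  define q where "q u v = (LINT x|lborel2. k u v x)" for u v
  have i: "integrable lborel2 (k u v)" if "simple_function borel u" "simple_function borel v" for u v
    unfolding k_def by (rule simple_spatial_form(1)[OF that K])
  have s: "simple_function borel (\<lambda>y. u y - v y)" using u v by (intro simple_function_diff)
  have k: "k (\<lambda>y. u y - v y) (\<lambda>y. u y - v y) = (\<lambda>x. k u u x - k u v x - k v u x + k v v x)"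
    unfolding k_def by (rule ext) (auto simp: algebra_simps)
  have "0 \<le> q (\<lambda>y. u y - v y) (\<lambda>y. u y - v y)"
    unfolding q_def k_def by (rule simple_spatial_form(2)[OF s s K])
  also have "\<dots> = q u u - q u v - q v u + q v v"
    unfolding q_def k using i[OF u(1) u(1)] i[OF u(1) v(1)] i[OF v(1) u(1)] i[OF v(1) v(1)]
    by simp
  finally have le: "q u v + q v u \<le> q u u + q v v" by simp
  have nn: "0 \<le> q u v" if "\<And>y. 0 \<le> u y" "\<And>y. 0 \<le> v y" for u v
    unfolding q_def k_def using that by (intro integral_nonneg_AE AE_I2) auto
  have sf: "spatial_form (\<lambda>y. u y * indicator K y) (\<lambda>y. v y * indicator K y) = ennreal (q u v)"
    if "simple_function borel u" "simple_function borel v" "\<And>y. 0 \<le> u y" "\<And>y. 0 \<le> v y" for u v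
    unfolding q_def spatial_form_def using that
    by (subst nn_integral_eq_integral[symmetric, OF i]) (auto simp: k_def abs_mult intro!: nn_integral_cong)
  have "q u v \<le> q u u + q v v" using le nn[of v u, OF v(2) u(2)] by simp
  then show ?thesis
    using u v nn by (simp add: sf ennreal_plus[symmetric] del: ennreal_plus)
qed

lemma spatial_form_mono:
  assumes "\<And>y. \<bar>\<phi> y\<bar> \<le> \<bar>\<phi>' y\<bar>" "\<And>y. \<bar>\<psi> y\<bar> \<le> \<bar>\<psi>' y\<bar>"
  shows "spatial_form \<phi> \<psi> \<le> spatial_form \<phi>' \<psi>'"
  unfolding spatial_form_def
  using assms by (intro nn_integral_mono) (auto intro!: ennreal_leI mult_mono)

text \<open>A pointwise inequality for products is of no use here, since \<open>f\<close> couples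
  two different points; the bound rests on positive definiteness. It passes to general functions by
  Fatou's lemma along simple functions cut off to growing balls.\<close>

lemma spatial_form_le:
  assumes [measurable]: "\<phi> \<in> borel_measurable borel" "\<psi> \<in> borel_measurable borel"
  shows "spatial_form \<phi> \<psi> \<le> spatial_form \<phi> \<phi> + spatial_form \<psi> \<psi>"
proof -
  have ex: "\<exists>s. (\<forall>i. simple_function borel (s i)) \<and> (\<forall>i y. 0 \<le> s i y) \<and> (\<forall>i y. s i y \<le> \<bar>\<phi> y\<bar>) \<and> (\<forall>y. (\<lambda>i. s i y) \<longlonglongrightarrow> \<bar>\<phi> y\<bar>)"
    if [measurable]: "\<phi> \<in> borel_measurable borel" for \<phi> :: "'a \<Rightarrow> real"
  proof -
    have "\<exists>s. incseq s \<and> (\<forall>i. simple_function borel (s i)) \<and> (\<forall>y. bdd_above (range (\<lambda>i. s i y))) \<and>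
        (\<forall>i y. 0 \<le> s i y) \<and> (\<lambda>y. \<bar>\<phi> y\<bar>) = (SUP i. s i)"
      by (rule borel_measurable_implies_simple_function_sequence_real) auto
    then obtain s where s: "incseq s" "\<And>i. simple_function borel (s i)" "\<And>y. bdd_above (range (\<lambda>i. s i y))"
      "\<And>i y. 0 \<le> s i y" "(\<lambda>y. \<bar>\<phi> y\<bar>) = (SUP i. s i)" by blast
    have lim: "(\<lambda>i. s i y) \<longlonglongrightarrow> \<bar>\<phi> y\<bar>" for y
    proof -
      have "\<bar>\<phi> y\<bar> = (SUP i. s i) y" by (rule fun_cong[OF s(5)])
      also have "\<dots> = (SUP i. s i y)" by (simp add: image_image)
      finally have e: "\<bar>\<phi> y\<bar> = (SUP i. s i y)" .
      have "incseq (\<lambda>i. s i y)" using s(1) by (auto simp: incseq_def le_fun_def)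
      then show ?thesis unfolding e by (intro LIMSEQ_incseq_SUP s(3))
    qed
    have "s i y \<le> \<bar>\<phi> y\<bar>" for i y
    proof -
      have "incseq (\<lambda>i. s i y)" using s(1) by (auto simp: incseq_def le_fun_def)
      then show ?thesis using lim by (rule incseq_le)
    qed
    then show ?thesis using s lim by blast
  qed
  obtain s where s: "\<And>i. simple_function borel (s i)" "\<And>i y. 0 \<le> s i y" "\<And>i y. s i y \<le> \<bar>\<phi> y\<bar>"
    "\<And>y. (\<lambda>i. s i y) \<longlonglongrightarrow> \<bar>\<phi> y\<bar>" using ex[OF assms(1)] by blast
  obtain r where r: "\<And>i. simple_function borel (r i)" "\<And>i y. 0 \<le> r i y" "\<And>i y. r i y \<le> \<bar>\<psi> y\<bar>"
    "\<And>y. (\<lambda>i. r i y) \<longlonglongrightarrow> \<bar>\<psi> y\<bar>" using ex[OF assms(2)] by blast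
  define K where "K i = cball (0::'a) (real i)" for i
  have K: "bounded (K i)" "K i \<in> sets borel" for i by (auto simp: K_def)
  note [measurable] = borel_measurable_simple_function[OF s(1)] borel_measurable_simple_function[OF r(1)] K(2)
  have Klim: "(\<lambda>i. x i * indicator (K i) y) \<longlonglongrightarrow> l" if "x \<longlonglongrightarrow> l" for x :: "nat \<Rightarrow> real" and l y
  proof (rule Lim_transform_eventually[OF that])
    obtain m :: nat where "norm y \<le> real m" using real_arch_simple by blast
    then have "\<forall>i\<ge>m. x i = x i * indicator (K i) y" by (auto simp: K_def)
    then show "\<forall>\<^sub>F i in sequentially. x i = x i * indicator (K i) y" by (auto simp: eventually_sequentially)
  qed
  let ?s = "\<lambda>i y. s i y * indicator (K i) y" and ?r = "\<lambda>i y. r i y * indicator (K i) y"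
  let ?g = "\<lambda>i x. case x of (y, z) \<Rightarrow> ennreal (\<bar>?s i y\<bar> * \<bar>f y z\<bar> * \<bar>?r i z\<bar>)"
  have "spatial_form \<phi> \<psi> = (\<integral>\<^sup>+x. liminf (\<lambda>i. ?g i x) \<partial>lborel2)"
    unfolding spatial_form_def
  proof (intro nn_integral_cong)
    fix x :: "'a \<times> 'a"
    obtain y z where x: "x = (y, z)" by (cases x)
    have "(\<lambda>i. ?g i x) \<longlonglongrightarrow> ennreal (\<bar>\<phi> y\<bar> * \<bar>f y z\<bar> * \<bar>\<psi> z\<bar>)"
      unfolding x prod.case
      using tendsto_rabs[OF Klim[OF s(4)], of y y] tendsto_rabs[OF Klim[OF r(4)], of z z]
      by (intro tendsto_ennrealI tendsto_mult tendsto_const) auto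
    from lim_imp_Liminf[OF _ this] show "(case x of (y, z) \<Rightarrow> ennreal (\<bar>\<phi> y\<bar> * \<bar>f y z\<bar> * \<bar>\<psi> z\<bar>)) = liminf (\<lambda>i. ?g i x)"
      by (simp add: x)
  qed
  also have "\<dots> \<le> liminf (\<lambda>i. spatial_form (?s i) (?r i))"
    unfolding spatial_form_def by (rule nn_integral_liminf) measurable
  also have "\<dots> \<le> liminf (\<lambda>i. spatial_form \<phi> \<phi> + spatial_form \<psi> \<psi>)"
  proof (intro Liminf_mono always_eventually allI)
    fix i
    have "\<bar>?s i y\<bar> \<le> \<bar>\<phi> y\<bar>" "\<bar>?r i y\<bar> \<le> \<bar>\<psi> y\<bar>" for y
      using s(2,3)[of i y] r(2,3)[of i y] by (auto simp: indicator_def)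
    then have "spatial_form (?s i) (?s i) + spatial_form (?r i) (?r i) \<le> spatial_form \<phi> \<phi> + spatial_form \<psi> \<psi>"
      by (intro add_mono spatial_form_mono) auto
    with spatial_form_simple_le[OF s(1,2) r(1,2) K] show "spatial_form (?s i) (?r i) \<le> spatial_form \<phi> \<phi> + spatial_form \<psi> \<psi>"
      by (rule order_trans)
  qed
  also have "\<dots> = spatial_form \<phi> \<phi> + spatial_form \<psi> \<psi>" by (simp add: Liminf_const)
  finally show ?thesis .
qed

section \<open>Walsh's form as an integral over one product measure\<close>

definition walsh_measure :: "('w \<times> real \<times> 'a \<times> 'a) measure" where
  "walsh_measure = M \<Otimes>\<^sub>M lborel3"

definition walsh_kernel :: "(real \<Rightarrow> 'a \<Rightarrow> 'w \<Rightarrow> real) \<Rightarrow> (real \<Rightarrow> 'a \<Rightarrow> 'w \<Rightarrow> real) \<Rightarrow> 'w \<times> real \<times> 'a \<times> 'a \<Rightarrow> real" where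
  "walsh_kernel \<Phi> \<Psi> = (\<lambda>(w, s, y, z). \<Phi> s y w * \<bar>f y z\<bar> * \<Psi> s z w)"

text \<open>The polarised square of Walsh's norm, with absolute values inside so that it is always
  defined; on the diagonal it is \<open>walsh_norm2\<close> (see \<open>walsh_norm2_eq\<close>). The
  isometry itself integrates the signed \<open>walsh_kernel\<close>.\<close>

definition walsh_pair :: "(real \<Rightarrow> 'a \<Rightarrow> 'w \<Rightarrow> real) \<Rightarrow> (real \<Rightarrow> 'a \<Rightarrow> 'w \<Rightarrow> real) \<Rightarrow> ennreal" where
  "walsh_pair \<Phi> \<Psi> = (\<integral>\<^sup>+x. ennreal \<bar>walsh_kernel \<Phi> \<Psi> x\<bar> \<partial>walsh_measure)"

definition jointly :: "(real \<Rightarrow> 'a \<Rightarrow> 'w \<Rightarrow> real) \<Rightarrow> bool" where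
  "jointly \<Phi> \<longleftrightarrow> (\<lambda>(s, y, w). \<Phi> s y w) \<in> borel_measurable (borel \<Otimes>\<^sub>M borel \<Otimes>\<^sub>M M)"

lemma jointly_diff: "jointly \<Phi> \<Longrightarrow> jointly \<Psi> \<Longrightarrow> jointly (\<lambda>s y w. \<Phi> s y w - \<Psi> s y w)"
  unfolding jointly_def case_prod_beta by (rule borel_measurable_diff)

lemma jointly_cmult: "jointly \<Phi> \<Longrightarrow> jointly (\<lambda>s y w. c * \<Phi> s y w)"
  unfolding jointly_def case_prod_beta by (intro borel_measurable_times borel_measurable_const)

lemma jointly_section:
  assumes "jointly \<Phi>" "w \<in> space M"
  shows "(\<lambda>y. \<Phi> s y w) \<in> borel_measurable borel"
proof -
  have "(\<lambda>y. (s, y, w)) \<in> borel \<rightarrow>\<^sub>M borel \<Otimes>\<^sub>M borel \<Otimes>\<^sub>M M" using assms(2) by measurable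
  from measurable_compose[OF this assms(1)[unfolded jointly_def]] show ?thesis by simp
qed

lemma walsh_kernel_measurable:
  assumes "jointly \<Phi>" "jointly \<Psi>"
  shows "walsh_kernel \<Phi> \<Psi> \<in> borel_measurable walsh_measure"
proof -
  have m: "(\<lambda>x. \<Phi> (fst (snd x)) (h (snd (snd x))) (fst x)) \<in> borel_measurable (M \<Otimes>\<^sub>M lborel3)"
    if "jointly \<Phi>" and [measurable]: "h \<in> borel_measurable lborel2" for \<Phi> and h :: "'a \<times> 'a \<Rightarrow> 'a"
  proof -
    have "(\<lambda>x. (fst (snd x), h (snd (snd x)), fst x)) \<in> M \<Otimes>\<^sub>M lborel3 \<rightarrow>\<^sub>M borel \<Otimes>\<^sub>M borel \<Otimes>\<^sub>M M"
      by measurable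
    from measurable_compose[OF this that(1)[unfolded jointly_def]] show ?thesis by simp
  qed
  have "(\<lambda>x. \<Phi> (fst (snd x)) (fst (snd (snd x))) (fst x) * \<bar>f (fst (snd (snd x))) (snd (snd (snd x)))\<bar>
     * \<Psi> (fst (snd x)) (snd (snd (snd x))) (fst x)) \<in> borel_measurable walsh_measure"
    unfolding walsh_measure_def
    by (intro borel_measurable_times m assms) measurable
  then show ?thesis by (simp add: walsh_kernel_def case_prod_beta')
qed

lemma sigma_finite_space2: "sigma_finite_measure (lborel2 :: ('a \<times> 'a) measure)"
  unfolding lborel_prod by (rule sigma_finite_lborel)

lemma sigma_finite_spacetime2: "sigma_finite_measure (lborel3 :: (real \<times> 'a \<times> 'a) measure)"
  unfolding lborel_prod by (rule sigma_finite_lborel)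

lemma walsh_pair_eq_spatial_form:
  assumes "jointly \<Phi>" "jointly \<Psi>"
  shows "walsh_pair \<Phi> \<Psi> = (\<integral>\<^sup>+w. \<integral>\<^sup>+s. spatial_form (\<lambda>y. \<Phi> s y w) (\<lambda>y. \<Psi> s y w) \<partial>lborel \<partial>M)"
proof -
  note [measurable] = walsh_kernel_measurable[OF assms, unfolded walsh_measure_def]
  have "walsh_pair \<Phi> \<Psi> = (\<integral>\<^sup>+w. \<integral>\<^sup>+x. ennreal \<bar>walsh_kernel \<Phi> \<Psi> (w, x)\<bar> \<partial>lborel3 \<partial>M)"
    unfolding walsh_pair_def walsh_measure_def
    by (rule sigma_finite_measure.nn_integral_fst[OF sigma_finite_spacetime2, symmetric]) measurable
  also have "\<dots> = (\<integral>\<^sup>+w. \<integral>\<^sup>+s. \<integral>\<^sup>+x. ennreal \<bar>walsh_kernel \<Phi> \<Psi> (w, s, x)\<bar> \<partial>lborel2 \<partial>lborel \<partial>M)"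
    by (intro nn_integral_cong sigma_finite_measure.nn_integral_fst[OF sigma_finite_space2, symmetric]) measurable
  also have "\<dots> = (\<integral>\<^sup>+w. \<integral>\<^sup>+s. spatial_form (\<lambda>y. \<Phi> s y w) (\<lambda>y. \<Psi> s y w) \<partial>lborel \<partial>M)"
    unfolding spatial_form_def walsh_kernel_def
    by (intro nn_integral_cong) (auto simp: abs_mult)
  finally show ?thesis .
qed

end

text \<open>Choose \<open>l\<close> large first, then \<open>n\<close>.\<close>

lemma tendsto_zero_of_scaled_bound:
  fixes a p :: "nat \<Rightarrow> ennreal"
  assumes le: "\<And>l n. 0 < l \<Longrightarrow> p n \<le> ennreal l * a n + ennreal (1 / l) * c"
    and a: "a \<longlonglongrightarrow> 0" and c: "c < \<infinity>"
  shows "p \<longlonglongrightarrow> 0"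
proof (rule order_tendstoI)
  fix d :: ennreal assume "0 < d"
  then obtain d' where d': "0 < d'" "d' < d" using dense by blast
  then have "d' < \<infinity>" using less_top order_less_trans by fastforce
  define e where "e = enn2real d'"
  have e: "d' = ennreal e" "0 < e" using d' \<open>d' < \<infinity>\<close> by (auto simp: e_def enn2real_positive_iff less_top)
  obtain c' where c': "c = ennreal c'" "0 \<le> c'" using c by (cases c) auto
  \<comment> \<open>This makes \<open>c' / l \<le> e / 2\<close>; the summand 1 keeps
    \<open>l\<close> positive when \<open>c' = 0\<close>.\<close>
  define l where "l = (2 * c' + 1) / e"
  have l: "0 < l" using c' e by (simp add: l_def add_nonneg_pos)
  have "\<forall>\<^sub>F n in sequentially. a n < ennreal (e / (2 * l))"
    using l e by (intro order_tendstoD(2)[OF a]) simp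
  then show "\<forall>\<^sub>F n in sequentially. p n < d"
  proof eventually_elim
    case (elim n)
    have "p n \<le> ennreal l * a n + ennreal (1 / l) * c" by (rule le[OF l])
    also have "\<dots> \<le> ennreal l * ennreal (e / (2 * l)) + ennreal (1 / l) * ennreal c'"
      unfolding c'(1) using elim by (intro add_mono mult_left_mono) auto
    also have "\<dots> = ennreal (l * (e / (2 * l)) + 1 / l * c')"
      using l e c' by (simp add: ennreal_mult[symmetric] ennreal_plus[symmetric] del: ennreal_plus)
    also have "\<dots> \<le> ennreal e"
    proof (rule ennreal_leI)
      have "1 / l * c' \<le> e / 2" using c' e by (simp add: l_def field_simps add_nonneg_pos)
      moreover have "l * (e / (2 * l)) = e / 2" using l by simp
      ultimately show "l * (e / (2 * l)) + 1 / l * c' \<le> e" by linarith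
    qed
    finally show "p n < d" using d' e by simp
  qed
qed simp

text \<open>A weighted substitute for the Cauchy-Schwarz inequality, stated abstractly because it
  serves both sides of the isometry: \<open>L2_pair\<close> on measurable variables and
  \<open>walsh_pair\<close> on jointly measurable processes.\<close>

lemma tendsto_zero_of_form_bound:
  fixes p :: "'a \<Rightarrow> 'a \<Rightarrow> ennreal"
  assumes bound: "\<forall>x y l. D x \<longrightarrow> D y \<longrightarrow> 0 < l \<longrightarrow> p x y \<le> ennreal l * p x x + ennreal (1 / l) * p y y"
    and D: "\<And>n::nat. D (d n)" "\<And>n. D (e n)" "D x" "D y"
    and lim: "(\<lambda>n. p (d n) (d n)) \<longlonglongrightarrow> 0" "(\<lambda>n. p (e n) (e n)) \<longlonglongrightarrow> 0"
    and fin: "p x x < \<infinity>" "p y y < \<infinity>"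
  shows "(\<lambda>n. p (d n) (e n)) \<longlonglongrightarrow> 0" and "(\<lambda>n. p (d n) y) \<longlonglongrightarrow> 0" and "(\<lambda>n. p x (e n)) \<longlonglongrightarrow> 0"
proof -
  note le = bound[rule_format]
  have sum: "(\<lambda>n. p (d n) (d n) + p (e n) (e n)) \<longlonglongrightarrow> 0" using tendsto_add[OF lim] by simp
  have "p (d n) (e n) \<le> p (d n) (d n) + p (e n) (e n)" for n
    using le[OF D(1) D(2) zero_less_one, of n n] by simp
  then show "(\<lambda>n. p (d n) (e n)) \<longlonglongrightarrow> 0"
    by (intro tendsto_sandwich[OF _ _ tendsto_const sum] always_eventually allI) simp_all
  show "(\<lambda>n. p (d n) y) \<longlonglongrightarrow> 0"
    by (rule tendsto_zero_of_scaled_bound[OF le[OF D(1,4)] lim(1) fin(2)])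
  have "p x (e n) \<le> ennreal l * p (e n) (e n) + ennreal (1 / l) * p x x" if "0 < l" for l n
    using le[OF D(3) D(2), of "1 / l" n] that by (simp add: add.commute)
  then show "(\<lambda>n. p x (e n)) \<longlonglongrightarrow> 0"
    by (rule tendsto_zero_of_scaled_bound[OF _ lim(2) fin(1)])
qed

text \<open>Meant for products of two converging factors: the error of a product splits into error
  times error and two terms with one error each, all of which vanish by the preceding lemma.\<close>

lemma integral_LIMSEQ_of_split:
  fixes k a b c :: "nat \<Rightarrow> 'a \<Rightarrow> real"
  assumes int: "\<And>n. integrable N (k n)" "integrable N l"
    and m[measurable]: "\<And>n. a n \<in> borel_measurable N" "\<And>n. b n \<in> borel_measurable N" "\<And>n. c n \<in> borel_measurable N"
    and split: "\<And>n x. k n x - l x = a n x + b n x + c n x"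
    and lim: "(\<lambda>n. \<integral>\<^sup>+x. ennreal \<bar>a n x\<bar> \<partial>N) \<longlonglongrightarrow> 0" "(\<lambda>n. \<integral>\<^sup>+x. ennreal \<bar>b n x\<bar> \<partial>N) \<longlonglongrightarrow> 0"
      "(\<lambda>n. \<integral>\<^sup>+x. ennreal \<bar>c n x\<bar> \<partial>N) \<longlonglongrightarrow> 0"
  shows "(\<lambda>n. LINT x|N. k n x) \<longlonglongrightarrow> (LINT x|N. l x)"
proof -
  let ?s = "\<lambda>n. (\<integral>\<^sup>+x. ennreal \<bar>a n x\<bar> \<partial>N) + (\<integral>\<^sup>+x. ennreal \<bar>b n x\<bar> \<partial>N) + (\<integral>\<^sup>+x. ennreal \<bar>c n x\<bar> \<partial>N)"
  let ?d = "\<lambda>n. (LINT x|N. k n x) - (LINT x|N. l x)"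
  have s: "?s \<longlonglongrightarrow> 0" using tendsto_add[OF tendsto_add[OF lim(1,2)] lim(3)] by simp
  have "ennreal \<bar>?d n\<bar> \<le> ?s n" for n
  proof -
    have "ennreal \<bar>?d n\<bar> = ennreal (norm (LINT x|N. k n x - l x))" using int by simp
    also have "\<dots> \<le> (\<integral>\<^sup>+x. norm (k n x - l x) \<partial>N)" by (intro integral_norm_bound_ennreal) (simp add: int)
    also have "\<dots> \<le> (\<integral>\<^sup>+x. ennreal \<bar>a n x\<bar> + ennreal \<bar>b n x\<bar> + ennreal \<bar>c n x\<bar> \<partial>N)"
    proof (intro nn_integral_mono)
      fix x
      have "\<bar>k n x - l x\<bar> \<le> \<bar>a n x\<bar> + \<bar>b n x\<bar> + \<bar>c n x\<bar>" unfolding split by linarith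
      then show "ennreal (norm (k n x - l x)) \<le> ennreal \<bar>a n x\<bar> + ennreal \<bar>b n x\<bar> + ennreal \<bar>c n x\<bar>"
        by (simp add: ennreal_plus[symmetric] ennreal_leI del: ennreal_plus)
    qed
    also have "\<dots> = ?s n" by (simp add: nn_integral_add)
    finally show ?thesis .
  qed
  then have "(\<lambda>n. ennreal \<bar>?d n\<bar>) \<longlonglongrightarrow> 0"
    by (intro tendsto_sandwich[OF _ _ tendsto_const s] always_eventually allI) simp_all
  then have "(\<lambda>n. enn2real (ennreal \<bar>?d n\<bar>)) \<longlonglongrightarrow> enn2real (ennreal 0)"
    by (intro tendsto_enn2real) auto
  then have "?d \<longlonglongrightarrow> 0" by (simp add: tendsto_rabs_zero_iff)
  then show ?thesis by (simp add: LIM_zero_iff)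
qed

lemma sum_list_product:
  fixes u :: "'a \<Rightarrow> real" and v :: "'b \<Rightarrow> real"
  shows "(\<Sum>x\<leftarrow>xs. u x) * (\<Sum>y\<leftarrow>ys. v y) = (\<Sum>x\<leftarrow>xs. \<Sum>y\<leftarrow>ys. u x * v y)"
  by (induction xs) (simp_all add: distrib_right sum_list_const_mult)

lemma sum_list_product3:
  fixes u :: "'a \<Rightarrow> real" and v :: "'b \<Rightarrow> real"
  shows "(\<Sum>x\<leftarrow>xs. u x) * c * (\<Sum>y\<leftarrow>ys. v y) = (\<Sum>x\<leftarrow>xs. \<Sum>y\<leftarrow>ys. u x * c * v y)"
  using sum_list_product[of "\<lambda>x. u x * c" xs v ys] by (simp add: sum_list_mult_const)

lemma integral_sum_list:
  fixes h :: "'b \<Rightarrow> 'a \<Rightarrow> real"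
  assumes "\<And>e. e \<in> set S \<Longrightarrow> integrable M (h e)"
  shows "integrable M (\<lambda>x. \<Sum>e\<leftarrow>S. h e x)" and "(LINT x|M. (\<Sum>e\<leftarrow>S. h e x)) = (\<Sum>e\<leftarrow>S. LINT x|M. h e x)"
  using assms by (induction S) auto

context colored_noise begin

lemma spatial_form_section_measurable:
  assumes "jointly \<Phi>" "jointly \<Psi>"
  shows "w \<in> space M \<Longrightarrow> (\<lambda>s. spatial_form (\<lambda>y. \<Phi> s y w) (\<lambda>y. \<Psi> s y w)) \<in> borel_measurable lborel"
    and "(\<lambda>w. \<integral>\<^sup>+s. spatial_form (\<lambda>y. \<Phi> s y w) (\<lambda>y. \<Psi> s y w) \<partial>lborel) \<in> borel_measurable M"
proof -
  note [measurable] = walsh_kernel_measurable[OF assms, unfolded walsh_measure_def]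
  have sf: "spatial_form (\<lambda>y. \<Phi> s y w) (\<lambda>y. \<Psi> s y w) = (\<integral>\<^sup>+x. ennreal \<bar>walsh_kernel \<Phi> \<Psi> (w, s, x)\<bar> \<partial>lborel2)" for s w
    unfolding spatial_form_def walsh_kernel_def by (intro nn_integral_cong) (auto simp: abs_mult)
  have m: "(\<lambda>x. ennreal \<bar>walsh_kernel \<Phi> \<Psi> (w, x)\<bar>) \<in> borel_measurable lborel3" if "w \<in> space M" for w
    using that by measurable
  show "(\<lambda>s. spatial_form (\<lambda>y. \<Phi> s y w) (\<lambda>y. \<Psi> s y w)) \<in> borel_measurable lborel" if "w \<in> space M"
    unfolding sf using sigma_finite_measure.borel_measurable_nn_integral_fst[OF sigma_finite_space2 m[OF that]] .
  have m2: "(\<lambda>x. ennreal \<bar>walsh_kernel \<Phi> \<Psi> x\<bar>) \<in> borel_measurable (M \<Otimes>\<^sub>M lborel3)"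
    by measurable
  have "(\<lambda>w. \<integral>\<^sup>+x. ennreal \<bar>walsh_kernel \<Phi> \<Psi> (w, x)\<bar> \<partial>lborel3) \<in> borel_measurable M"
    using sigma_finite_measure.borel_measurable_nn_integral_fst[OF sigma_finite_spacetime2 m2] .
  also have "?this \<longleftrightarrow> (\<lambda>w. \<integral>\<^sup>+s. spatial_form (\<lambda>y. \<Phi> s y w) (\<lambda>y. \<Psi> s y w) \<partial>lborel) \<in> borel_measurable M"
    unfolding sf
    by (intro measurable_cong sigma_finite_measure.nn_integral_fst[OF sigma_finite_space2 m, symmetric])
  finally show "(\<lambda>w. \<integral>\<^sup>+s. spatial_form (\<lambda>y. \<Phi> s y w) (\<lambda>y. \<Psi> s y w) \<partial>lborel) \<in> borel_measurable M" .
qed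

lemma walsh_pair_le:
  assumes "jointly \<Phi>" "jointly \<Psi>"
  shows "walsh_pair \<Phi> \<Psi> \<le> walsh_pair \<Phi> \<Phi> + walsh_pair \<Psi> \<Psi>"
proof -
  let ?q = "\<lambda>\<Phi> \<Psi> s w. spatial_form (\<lambda>y. \<Phi> s y w) (\<lambda>y. \<Psi> s y w)"
  note m = spatial_form_section_measurable
  have "walsh_pair \<Phi> \<Psi> = (\<integral>\<^sup>+w. \<integral>\<^sup>+s. ?q \<Phi> \<Psi> s w \<partial>lborel \<partial>M)"
    by (rule walsh_pair_eq_spatial_form[OF assms])
  also have "\<dots> \<le> (\<integral>\<^sup>+w. \<integral>\<^sup>+s. ?q \<Phi> \<Phi> s w + ?q \<Psi> \<Psi> s w \<partial>lborel \<partial>M)"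
    by (intro nn_integral_mono spatial_form_le jointly_section[OF assms(1)] jointly_section[OF assms(2)])
  also have "\<dots> = (\<integral>\<^sup>+w. (\<integral>\<^sup>+s. ?q \<Phi> \<Phi> s w \<partial>lborel) + (\<integral>\<^sup>+s. ?q \<Psi> \<Psi> s w \<partial>lborel) \<partial>M)"
    by (intro nn_integral_cong nn_integral_add m assms)
  also have "\<dots> = walsh_pair \<Phi> \<Phi> + walsh_pair \<Psi> \<Psi>"
    unfolding walsh_pair_eq_spatial_form[OF assms(1) assms(1)] walsh_pair_eq_spatial_form[OF assms(2) assms(2)]
    by (intro nn_integral_add m assms)
  finally show ?thesis .
qed

text \<open>\<open>walsh_pair_le\<close> for the processes rescaled by \<open>sqrt l\<close> and
  \<open>1 / sqrt l\<close>. The weight makes the form small when one argument vanishes in norm and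
  the other is merely finite.\<close>

lemma walsh_pair_scaled_le:
  assumes \<Phi>: "jointly \<Phi>" and \<Psi>: "jointly \<Psi>" and l: "0 < l"
  shows "walsh_pair \<Phi> \<Psi> \<le> ennreal l * walsh_pair \<Phi> \<Phi> + ennreal (1 / l) * walsh_pair \<Psi> \<Psi>"
proof -
  let ?A = "\<lambda>s y w. sqrt l * \<Phi> s y w" and ?B = "\<lambda>s y w. (1 / sqrt l) * \<Psi> s y w"
  have j: "jointly ?A" "jointly ?B" using \<Phi> \<Psi> by (intro jointly_cmult; simp)+
  have k: "walsh_kernel (\<lambda>s y w. c * \<Phi> s y w) (\<lambda>s y w. d * \<Psi> s y w) x = (c * d) * walsh_kernel \<Phi> \<Psi> x" for c d \<Phi> \<Psi> x
    by (simp add: walsh_kernel_def case_prod_beta)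
  have s: "walsh_pair (\<lambda>s y w. c * \<Phi> s y w) (\<lambda>s y w. d * \<Psi> s y w) = ennreal \<bar>c * d\<bar> * walsh_pair \<Phi> \<Psi>"
    if "jointly \<Phi>" "jointly \<Psi>" for c d \<Phi> \<Psi>
    unfolding walsh_pair_def k using walsh_kernel_measurable[OF that]
    by (subst nn_integral_cmult[symmetric]) (auto simp: abs_mult ennreal_mult)
  have "walsh_pair ?A ?B \<le> walsh_pair ?A ?A + walsh_pair ?B ?B" by (rule walsh_pair_le[OF j])
  then show "walsh_pair \<Phi> \<Psi> \<le> ennreal l * walsh_pair \<Phi> \<Phi> + ennreal (1 / l) * walsh_pair \<Psi> \<Psi>"
    unfolding s[OF \<Phi> \<Phi>] s[OF \<Psi> \<Psi>] s[OF \<Phi> \<Psi>] using l by simp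
qed

lemma walsh_norm2_eq:
  assumes "jointly \<Phi>" shows "walsh_norm2 M f \<Phi> = walsh_pair \<Phi> \<Phi>"
  unfolding walsh_norm2_def walsh_pair_eq_spatial_form[OF assms assms]
proof (intro nn_integral_cong)
  fix w s assume "w \<in> space M"
  note [measurable] = jointly_section[OF assms this, of s]
  show "(\<integral>\<^sup>+y. \<integral>\<^sup>+z. ennreal (\<bar>\<Phi> s y w\<bar> * \<bar>f y z\<bar> * \<bar>\<Phi> s z w\<bar>) \<partial>lborel \<partial>lborel)
      = spatial_form (\<lambda>y. \<Phi> s y w) (\<lambda>y. \<Phi> s y w)"
    unfolding spatial_form_def by (subst lborel.nn_integral_fst[symmetric]) simp_all
qed

section \<open>The isometry for simple processes\<close>

definition elementary :: "real \<times> real \<times> 'a set \<times> ('w \<Rightarrow> real) \<Rightarrow> real \<Rightarrow> 'a \<Rightarrow> 'w \<Rightarrow> real" where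
  "elementary = (\<lambda>(a, b, A, X) s y w. X w * indicator {a<..b} s * indicator A y)"

definition elementary_integral :: "real \<times> real \<times> 'a set \<times> ('w \<Rightarrow> real) \<Rightarrow> 'w \<Rightarrow> real" where
  "elementary_integral = (\<lambda>(a, b, A, X) w. X w * F ({a<..b} \<times> A) w)"

lemma simple_value_eq: "simple_value S s y w = (\<Sum>e\<leftarrow>S. elementary e s y w)"
  unfolding simple_value_def elementary_def by (simp add: case_prod_beta')

lemma simple_integral_eq: "simple_integral F S w = (\<Sum>e\<leftarrow>S. elementary_integral e w)"
  unfolding simple_integral_def elementary_integral_def by (simp add: case_prod_beta')

lemma jointly_elementary:
  assumes "A \<in> bounded_borel" "X \<in> borel_measurable M"
  shows "jointly (elementary (a, b, A, X))"
proof -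
  have [measurable]: "A \<in> sets borel" "X \<in> borel_measurable M" using assms by (auto simp: bounded_borel_def)
  show ?thesis unfolding jointly_def elementary_def prod.case by measurable
qed

lemma jointly_simple_value:
  assumes "simple_process M F S" shows "jointly (simple_value S)"
proof -
  have "jointly (elementary e)" if "e \<in> set S" for e
  proof -
    obtain a b A X where e: "e = (a, b, A, X)" by (cases e)
    with assms that have "A \<in> bounded_borel" "adapted a X"
      by (auto simp: simple_process_def)
    then show ?thesis unfolding e by (intro jointly_elementary filtration_measurable)
  qed
  then have "jointly (\<lambda>s y w. \<Sum>e\<leftarrow>S. elementary e s y w)"
  proof (induction S)
    case Nil
    then show ?case by (simp add: jointly_def)
  next
    case (Cons e S)
    then have "jointly (elementary e)" "jointly (\<lambda>s y w. \<Sum>e\<leftarrow>S. elementary e s y w)" by auto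
    then show ?case unfolding jointly_def case_prod_beta by simp
  qed
  then show ?thesis unfolding simple_value_eq[abs_def] .
qed

text \<open>Both sides factor into the expectation of \<open>X w * X' w\<close>, the length of the
  common time interval and a spatial covariance.\<close>

lemma elementary_isometry:
  assumes S: "simple_process M F S" "e \<in> set S" and S': "simple_process M F S'" "e' \<in> set S'"
  shows "integrable M (\<lambda>w. elementary_integral e w * elementary_integral e' w)" (is ?I)
    and "integrable walsh_measure (walsh_kernel (elementary e) (elementary e'))" (is ?K)
    and "(LINT w|M. elementary_integral e w * elementary_integral e' w)
      = (LINT x|walsh_measure. walsh_kernel (elementary e) (elementary e') x)" (is "_ = ?W")
proof -
  obtain a b A X a' b' A' X' where eq: "e = (a, b, A, X)" "e' = (a', b', A', X')" by (cases e; cases e')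
  have e: "0 \<le> a" "a \<le> b" "A \<in> bounded_borel" "adapted a X" "\<exists>C. \<forall>w\<in>space M. \<bar>X w\<bar> \<le> C"
    using S by (auto simp: eq simple_process_def)
  have e': "0 \<le> a'" "a' \<le> b'" "A' \<in> bounded_borel" "adapted a' X'" "\<exists>C. \<forall>w\<in>space M. \<bar>X' w\<bar> \<le> C"
    using S' by (auto simp: eq simple_process_def)
  note E = expectation_elementary[OF e e']
  show ?I using E(1) by (simp add: eq elementary_integral_def)
  interpret P1: pair_sigma_finite "lborel :: real measure" "lborel2 :: ('a \<times> 'a) measure"
    by (intro pair_sigma_finite.intro sigma_finite_space2 sigma_finite_lborel)
  interpret P2: pair_sigma_finite M "lborel3 :: (real \<times> 'a \<times> 'a) measure"
    by (intro pair_sigma_finite.intro sigma_finite_spacetime2) (rule sigma_finite_measure_axioms)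
  let ?T = "\<lambda>s. indicator ({a<..b} \<inter> {a'<..b'}) s :: real"
  let ?U = "\<lambda>(y, z). indicator A y * \<bar>f y z\<bar> * indicator A' z"
  let ?XX = "\<lambda>w. X w * X' w"
  have k: "walsh_kernel (elementary e) (elementary e')
      = (\<lambda>(w, x). ?XX w * (case x of (s, h) \<Rightarrow> ?T s * ?U h))"
    unfolding eq walsh_kernel_def elementary_def by (auto simp: indicator_def fun_eq_iff)
  obtain C C' where C: "\<And>w. w \<in> space M \<Longrightarrow> \<bar>X w\<bar> \<le> C" "\<And>w. w \<in> space M \<Longrightarrow> \<bar>X' w\<bar> \<le> C'"
    using e e' by blast
  have iX: "integrable M ?XX"
  proof (rule integrable_const_bound[where B="\<bar>C\<bar> * \<bar>C'\<bar>"])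
    show "AE w in M. norm (X w * X' w) \<le> \<bar>C\<bar> * \<bar>C'\<bar>"
      unfolding real_norm_def abs_mult
      using C by (intro AE_I2 mult_mono) (auto intro: order_trans[OF _ abs_ge_self])
  qed (use filtration_measurable[OF e(4)] filtration_measurable[OF e'(4)] in measurable)
  have iT: "integrable lborel ?T"
    by (intro integrable_real_indicator emeasure_bounded_finite bounded_Int disjI1) auto
  have iU: "integrable lborel2 ?U" using integrable_spatial_cov[OF e(3) e'(3)] .
  have iTU: "integrable lborel3 (\<lambda>(s, h). ?T s * ?U h)"
    by (rule P1.integrable_pair_mult[OF iT iU])
  show ?K unfolding k walsh_measure_def by (rule P2.integrable_pair_mult[OF iX iTU])
  have "?W = (LINT w|M. ?XX w) * ((LINT s|lborel. ?T s) * (LINT h|lborel2. ?U h))"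
    unfolding k walsh_measure_def P2.integral_pair_mult[OF iX iTU] P1.integral_pair_mult[OF iT iU] ..
  then show "(LINT w|M. elementary_integral e w * elementary_integral e' w) = ?W"
    using E(2) by (simp add: eq elementary_integral_def spatial_cov_def)
qed

lemma simple_isometry:
  assumes S: "simple_process M F S" and S': "simple_process M F S'"
  shows "integrable M (\<lambda>w. simple_integral F S w * simple_integral F S' w)"
    and "integrable walsh_measure (walsh_kernel (simple_value S) (simple_value S'))"
    and "(LINT w|M. simple_integral F S w * simple_integral F S' w)
      = (LINT x|walsh_measure. walsh_kernel (simple_value S) (simple_value S') x)"
proof -
  note i = elementary_isometry[OF S _ S']
  have p: "simple_integral F S w * simple_integral F S' w = (\<Sum>e\<leftarrow>S. \<Sum>e'\<leftarrow>S'. elementary_integral e w * elementary_integral e' w)" for w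
    unfolding simple_integral_eq by (rule sum_list_product)
  have k: "walsh_kernel (simple_value S) (simple_value S') = (\<lambda>x. \<Sum>e\<leftarrow>S. \<Sum>e'\<leftarrow>S'. walsh_kernel (elementary e) (elementary e') x)"
    unfolding walsh_kernel_def simple_value_eq[abs_def]
    by (rule ext) (simp only: case_prod_beta sum_list_product3)
  show "integrable M (\<lambda>w. simple_integral F S w * simple_integral F S' w)"
    unfolding p by (intro integral_sum_list(1) i)
  show "integrable walsh_measure (walsh_kernel (simple_value S) (simple_value S'))"
    unfolding k by (intro integral_sum_list(1) i)
  have "(LINT w|M. simple_integral F S w * simple_integral F S' w)
      = (\<Sum>e\<leftarrow>S. \<Sum>e'\<leftarrow>S'. LINT w|M. elementary_integral e w * elementary_integral e' w)"
    unfolding p by (subst integral_sum_list(2), intro integral_sum_list(1) i, assumption+)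
      (intro arg_cong[where f=sum_list] map_cong refl integral_sum_list(2) i)
  also have "\<dots> = (\<Sum>e\<leftarrow>S. \<Sum>e'\<leftarrow>S'. LINT x|walsh_measure. walsh_kernel (elementary e) (elementary e') x)"
    by (intro arg_cong[where f=sum_list] map_cong refl i(3))
  also have "\<dots> = (LINT x|walsh_measure. walsh_kernel (simple_value S) (simple_value S') x)"
    unfolding k by (subst integral_sum_list(2), intro integral_sum_list(1) i, assumption+)
      (intro arg_cong[where f=sum_list] map_cong refl integral_sum_list(2)[symmetric] i)
  finally show "(LINT w|M. simple_integral F S w * simple_integral F S' w)
      = (LINT x|walsh_measure. walsh_kernel (simple_value S) (simple_value S') x)" .
qed

text \<open>Each coefficient is known at the left end of its interval, and the noise that it
  multiplies is centered and in the future of that time.\<close>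

lemma simple_integral_expectation:
  assumes S: "simple_process M F S"
  shows "integrable M (simple_integral F S)" and "(LINT w|M. simple_integral F S w) = 0"
proof -
  have e: "integrable M (elementary_integral e) \<and> (LINT w|M. elementary_integral e w) = 0" if "e \<in> set S" for e
  proof -
    obtain a b A X where e: "e = (a, b, A, X)" by (cases e)
    with S that have *: "0 \<le> a" "A \<in> bounded_borel" "adapted a X" "\<exists>C. \<forall>w\<in>space M. \<bar>X w\<bar> \<le> C"
      by (auto simp: simple_process_def)
    then obtain C where C: "\<And>w. w \<in> space M \<Longrightarrow> \<bar>X w\<bar> \<le> C" by blast
    have "integrable M X"
      using C filtration_measurable[OF *(3)] by (intro integrable_const_bound[where B=C]) auto
    moreover have "{a<..b} \<times> A \<in> future a"
      using box_noise_sets[OF *(1,2)] by (auto simp: future_def)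
    ultimately show ?thesis
      using expectation_past_future[OF *(3)] unfolding e elementary_integral_def by simp
  qed
  show "integrable M (simple_integral F S)"
    unfolding simple_integral_eq[abs_def] by (intro integral_sum_list(1)) (use e in blast)
  have "(LINT w|M. simple_integral F S w) = (\<Sum>e\<leftarrow>S. LINT w|M. elementary_integral e w)"
    unfolding simple_integral_eq by (intro integral_sum_list(2)) (use e in blast)
  also have "\<dots> = (\<Sum>e\<leftarrow>S. 0)" by (intro arg_cong[where f=sum_list] map_cong refl) (use e in blast)
  finally show "(LINT w|M. simple_integral F S w) = 0" by simp
qed

section \<open>Passage from simple processes to Walsh integrals\<close>

definition L2_pair :: "('w \<Rightarrow> real) \<Rightarrow> ('w \<Rightarrow> real) \<Rightarrow> ennreal" where
  "L2_pair X Y = (\<integral>\<^sup>+w. ennreal \<bar>X w * Y w\<bar> \<partial>M)"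

lemma L2_pair_scaled_le:
  assumes [measurable]: "X \<in> borel_measurable M" "Y \<in> borel_measurable M" and l: "0 < l"
  shows "L2_pair X Y \<le> ennreal l * L2_pair X X + ennreal (1 / l) * L2_pair Y Y"
proof -
  have le: "\<bar>x * y\<bar> \<le> l * \<bar>x * x\<bar> + 1 / l * \<bar>y * y\<bar>" for x y :: real
  proof -
    have "2 * (sqrt l * \<bar>x\<bar>) * (\<bar>y\<bar> / sqrt l) \<le> (sqrt l * \<bar>x\<bar>)\<^sup>2 + (\<bar>y\<bar> / sqrt l)\<^sup>2"
      by (rule sum_squares_bound)
    then have "2 * \<bar>x * y\<bar> \<le> l * x\<^sup>2 + 1 / l * y\<^sup>2"
      using l by (simp add: power_mult_distrib power_divide abs_mult)
    then show ?thesis by (simp add: power2_eq_square)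
  qed
  have "L2_pair X Y \<le> (\<integral>\<^sup>+w. ennreal l * ennreal \<bar>X w * X w\<bar> + ennreal (1 / l) * ennreal \<bar>Y w * Y w\<bar> \<partial>M)"
    unfolding L2_pair_def using le l
    by (intro nn_integral_mono) (simp add: ennreal_mult[symmetric] ennreal_plus[symmetric] ennreal_leI del: ennreal_plus)
  also have "\<dots> = ennreal l * L2_pair X X + ennreal (1 / l) * L2_pair Y Y"
    unfolding L2_pair_def by (subst nn_integral_add) (auto simp: nn_integral_cmult)
  finally show ?thesis .
qed

lemma L2_pair_integrable:
  assumes "X \<in> borel_measurable M" "Y \<in> borel_measurable M" "L2_pair X X < \<infinity>" "L2_pair Y Y < \<infinity>"
  shows "integrable M (\<lambda>w. X w * Y w)"
proof (rule integrableI_bounded)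
  have "L2_pair X Y \<le> L2_pair X X + L2_pair Y Y" using L2_pair_scaled_le[OF assms(1,2) zero_less_one] by simp
  also have "\<dots> < \<infinity>" using assms(3,4) by simp
  finally show "(\<integral>\<^sup>+w. ennreal (norm (X w * Y w)) \<partial>M) < \<infinity>" by (simp add: L2_pair_def)
qed (use assms in measurable)

definition walsh_approx :: "(real \<Rightarrow> 'a \<Rightarrow> 'w \<Rightarrow> real) \<Rightarrow> ('w \<Rightarrow> real) \<Rightarrow> (nat \<Rightarrow> ('a, 'w) simple_process) \<Rightarrow> bool" where
  "walsh_approx \<Phi> I S \<longleftrightarrow> (\<forall>n. simple_process M F (S n)) \<and>
     (\<lambda>n. walsh_pair (\<lambda>s y w. simple_value (S n) s y w - \<Phi> s y w) (\<lambda>s y w. simple_value (S n) s y w - \<Phi> s y w)) \<longlonglongrightarrow> 0 \<and>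
     (\<lambda>n. L2_pair (\<lambda>w. simple_integral F (S n) w - I w) (\<lambda>w. simple_integral F (S n) w - I w)) \<longlonglongrightarrow> 0"

lemma walsh_approxD:
  assumes "walsh_approx \<Phi> I S"
  shows "simple_process M F (S n)"
    and "(\<lambda>n. walsh_pair (\<lambda>s y w. simple_value (S n) s y w - \<Phi> s y w) (\<lambda>s y w. simple_value (S n) s y w - \<Phi> s y w)) \<longlonglongrightarrow> 0"
    and "(\<lambda>n. L2_pair (\<lambda>w. simple_integral F (S n) w - I w) (\<lambda>w. simple_integral F (S n) w - I w)) \<longlonglongrightarrow> 0"
  using assms by (auto simp: walsh_approx_def)

lemma walsh_integralE:
  assumes "has_walsh_integral M f F \<Phi> I"
  obtains S where "walsh_approx \<Phi> I S" and "jointly \<Phi>" and "walsh_pair \<Phi> \<Phi> < \<infinity>" and "I \<in> borel_measurable M" and "L2_pair I I < \<infinity>"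
proof -
  have j: "jointly \<Phi>" and I[measurable]: "I \<in> borel_measurable M"
    using assms by (auto simp: has_walsh_integral_def jointly_def)
  obtain S where S: "\<And>n. simple_process M F (S n)"
    "(\<lambda>n. walsh_norm2 M f (\<lambda>s y w. simple_value (S n) s y w - \<Phi> s y w)) \<longlonglongrightarrow> 0"
    "(\<lambda>n::nat. \<integral>\<^sup>+w. ennreal ((simple_integral F (S n) w - I w)\<^sup>2) \<partial>M) \<longlonglongrightarrow> 0"
    using assms unfolding has_walsh_integral_def by blast
  let ?d = "\<lambda>n w. simple_integral F (S n) w - I w"
  have dd: "L2_pair (?d n) (?d n) = (\<integral>\<^sup>+w. ennreal ((?d n w)\<^sup>2) \<partial>M)" for n
    by (simp add: L2_pair_def power2_eq_square)
  have lim: "(\<lambda>n. L2_pair (?d n) (?d n)) \<longlonglongrightarrow> 0" using S(3) by (simp add: dd)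
  have [measurable]: "simple_integral F (S n) \<in> borel_measurable M" for n
    using simple_integral_expectation(1)[OF S(1)] by auto
  \<comment> \<open>Square integrability of \<open>I\<close> is not part of
    \<open>has_walsh_integral\<close>; it follows from a single approximant at finite distance, by
    expanding the square of \<open>?s - ?d n\<close>.\<close>
  have "\<forall>\<^sub>F n in sequentially. L2_pair (?d n) (?d n) < 1" by (rule order_tendstoD(2)[OF lim]) simp
  then obtain n where n: "L2_pair (?d n) (?d n) < 1" by (auto simp: eventually_sequentially)
  let ?s = "simple_integral F (S n)"
  have "L2_pair (?d n) (?d n) < \<infinity>" by (rule order_less_trans[OF n]) simp
  moreover have "L2_pair ?s ?s < \<infinity>"
    using simple_isometry(1)[OF S(1) S(1), of n n] by (simp add: L2_pair_def integrable_iff_bounded)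
  ultimately have "integrable M (\<lambda>w. ?d n w * ?d n w)" "integrable M (\<lambda>w. ?d n w * ?s w)"
    "integrable M (\<lambda>w. ?s w * ?s w)"
    by (auto intro!: L2_pair_integrable)
  then have "integrable M (\<lambda>w. ?d n w * ?d n w - 2 * (?d n w * ?s w)
      + ?s w * ?s w)" by simp
  also have "(\<lambda>w. ?d n w * ?d n w - 2 * (?d n w * ?s w)
      + ?s w * ?s w) = (\<lambda>w. I w * I w)"
    by (rule ext) (simp add: algebra_simps)
  finally have I2: "L2_pair I I < \<infinity>" by (simp add: L2_pair_def integrable_iff_bounded)
  have "walsh_pair \<Phi> \<Phi> < \<infinity>" using assms walsh_norm2_eq[OF j] by (simp add: has_walsh_integral_def)
  moreover have "walsh_approx \<Phi> I S"
    unfolding walsh_approx_def using S(1) lim S(2)[unfolded walsh_norm2_eq[OF jointly_diff[OF jointly_simple_value[OF S(1)] j]]]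
    by blast
  ultimately show ?thesis by (intro that[OF _ j _ I I2])
qed

text \<open>Stated for two integrands because the solution at two points is driven by the same noise
  through different kernels. Both sides are limits of the identity for simple processes.\<close>

theorem walsh_isometry:
  assumes "has_walsh_integral M f F \<Phi> I" "has_walsh_integral M f F \<Psi> J"
  shows "integrable M (\<lambda>w. I w * J w)" and "integrable walsh_measure (walsh_kernel \<Phi> \<Psi>)"
    and "(LINT w|M. I w * J w) = (LINT x|walsh_measure. walsh_kernel \<Phi> \<Psi> x)"
proof -
  obtain S where S: "walsh_approx \<Phi> I S" and \<Phi>: "jointly \<Phi>" "walsh_pair \<Phi> \<Phi> < \<infinity>"
    and I[measurable]: "I \<in> borel_measurable M" and I2: "L2_pair I I < \<infinity>"
    using walsh_integralE[OF assms(1)] by blast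
  obtain R where R: "walsh_approx \<Psi> J R" and \<Psi>: "jointly \<Psi>" "walsh_pair \<Psi> \<Psi> < \<infinity>"
    and J[measurable]: "J \<in> borel_measurable M" and J2: "L2_pair J J < \<infinity>"
    using walsh_integralE[OF assms(2)] by blast
  note sp = walsh_approxD(1)[OF S] and rp = walsh_approxD(1)[OF R]
  note S = walsh_approxD(2,3)[OF S] and R = walsh_approxD(2,3)[OF R]
  note iso = simple_isometry[OF sp rp]
  let ?d = "\<lambda>n w. simple_integral F (S n) w - I w" and ?e = "\<lambda>n w. simple_integral F (R n) w - J w"
  have m [measurable]: "?d n \<in> borel_measurable M" "?e n \<in> borel_measurable M" for n
    using simple_integral_expectation(1)[OF sp] simple_integral_expectation(1)[OF rp] I J
    by (auto intro!: borel_measurable_diff)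
  show iIJ: "integrable M (\<lambda>w. I w * J w)" by (rule L2_pair_integrable[OF I J I2 J2])
  have "\<forall>X Y l. X \<in> borel_measurable M \<longrightarrow> Y \<in> borel_measurable M \<longrightarrow> 0 < l \<longrightarrow>
      L2_pair X Y \<le> ennreal l * L2_pair X X + ennreal (1 / l) * L2_pair Y Y"
    by (simp add: L2_pair_scaled_le)
  note lim = tendsto_zero_of_form_bound[of "\<lambda>X. X \<in> borel_measurable M" L2_pair, OF this m I J S(2) R(2) I2 J2]
  have l1: "(\<lambda>n. LINT w|M. simple_integral F (S n) w * simple_integral F (R n) w) \<longlonglongrightarrow> (LINT w|M. I w * J w)"
  proof (rule integral_LIMSEQ_of_split[OF iso(1) iIJ, where a="\<lambda>n w. ?d n w * ?e n w"
        and b="\<lambda>n w. ?d n w * J w" and c="\<lambda>n w. I w * ?e n w"])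
    show "simple_integral F (S n) w * simple_integral F (R n) w - I w * J w
      = ?d n w * ?e n w + ?d n w * J w + I w * ?e n w" for n w by (simp add: algebra_simps)
    show "(\<lambda>n. \<integral>\<^sup>+w. ennreal \<bar>?d n w * ?e n w\<bar> \<partial>M) \<longlonglongrightarrow> 0"
      "(\<lambda>n. \<integral>\<^sup>+w. ennreal \<bar>?d n w * J w\<bar> \<partial>M) \<longlonglongrightarrow> 0" "(\<lambda>n. \<integral>\<^sup>+w. ennreal \<bar>I w * ?e n w\<bar> \<partial>M) \<longlonglongrightarrow> 0"
      using lim unfolding L2_pair_def .
  qed measurable
  let ?D = "\<lambda>n s y w. simple_value (S n) s y w - \<Phi> s y w" and ?E = "\<lambda>n s y w. simple_value (R n) s y w - \<Psi> s y w"
  have j: "jointly (?D n)" "jointly (?E n)" for n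
    by (intro jointly_diff jointly_simple_value sp rp \<Phi> \<Psi>)+
  have "\<forall>X Y l. jointly X \<longrightarrow> jointly Y \<longrightarrow> 0 < l \<longrightarrow>
      walsh_pair X Y \<le> ennreal l * walsh_pair X X + ennreal (1 / l) * walsh_pair Y Y"
    by (simp add: walsh_pair_scaled_le)
  note lim = tendsto_zero_of_form_bound[of jointly walsh_pair, OF this j \<Phi>(1) \<Psi>(1) S(1) R(1) \<Phi>(2) \<Psi>(2)]
  have "walsh_pair \<Phi> \<Psi> \<le> walsh_pair \<Phi> \<Phi> + walsh_pair \<Psi> \<Psi>" by (rule walsh_pair_le[OF \<Phi>(1) \<Psi>(1)])
  also have "\<dots> < \<infinity>" using \<Phi>(2) \<Psi>(2) by simp
  finally show iK: "integrable walsh_measure (walsh_kernel \<Phi> \<Psi>)"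
    using walsh_kernel_measurable[OF \<Phi>(1) \<Psi>(1)] by (intro integrableI_bounded) (auto simp: walsh_pair_def)
  have l2: "(\<lambda>n. LINT x|walsh_measure. walsh_kernel (simple_value (S n)) (simple_value (R n)) x)
      \<longlonglongrightarrow> (LINT x|walsh_measure. walsh_kernel \<Phi> \<Psi> x)"
  proof (rule integral_LIMSEQ_of_split[OF iso(2) iK, where a="\<lambda>n. walsh_kernel (?D n) (?E n)"
        and b="\<lambda>n. walsh_kernel (?D n) \<Psi>" and c="\<lambda>n. walsh_kernel \<Phi> (?E n)"])
    show "walsh_kernel (simple_value (S n)) (simple_value (R n)) x - walsh_kernel \<Phi> \<Psi> x
      = walsh_kernel (?D n) (?E n) x + walsh_kernel (?D n) \<Psi> x + walsh_kernel \<Phi> (?E n) x" for n x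
      by (simp add: walsh_kernel_def case_prod_beta algebra_simps)
    show "(\<lambda>n. \<integral>\<^sup>+x. ennreal \<bar>walsh_kernel (?D n) (?E n) x\<bar> \<partial>walsh_measure) \<longlonglongrightarrow> 0"
      "(\<lambda>n. \<integral>\<^sup>+x. ennreal \<bar>walsh_kernel (?D n) \<Psi> x\<bar> \<partial>walsh_measure) \<longlonglongrightarrow> 0"
      "(\<lambda>n. \<integral>\<^sup>+x. ennreal \<bar>walsh_kernel \<Phi> (?E n) x\<bar> \<partial>walsh_measure) \<longlonglongrightarrow> 0"
      using lim unfolding walsh_pair_def .
  qed (intro walsh_kernel_measurable j \<Phi> \<Psi>)+
  show "(LINT w|M. I w * J w) = (LINT x|walsh_measure. walsh_kernel \<Phi> \<Psi> x)"
    by (rule LIMSEQ_unique[OF l1]) (simp only: iso(3) l2)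
qed

lemma walsh_integral_moments:
  assumes "has_walsh_integral M f F \<Phi> I"
  shows "integrable M (\<lambda>w. (I w)\<^sup>2)" and "integrable M I" and "(LINT w|M. I w) = 0"
proof -
  obtain S where S: "walsh_approx \<Phi> I S" and I[measurable]: "I \<in> borel_measurable M"
    using walsh_integralE[OF assms] by blast
  note sp = walsh_approxD(1)[OF S] and S = walsh_approxD(3)[OF S]
  note e = simple_integral_expectation[OF sp]
  show sq: "integrable M (\<lambda>w. (I w)\<^sup>2)" using walsh_isometry(1)[OF assms assms] by (simp add: power2_eq_square)
  show iI: "integrable M I" by (rule square_integrable_imp_integrable[OF I sq])
  let ?d = "\<lambda>n w. simple_integral F (S n) w - I w"
  have m [measurable]: "?d n \<in> borel_measurable M" for n using e(1) I by (auto intro!: borel_measurable_diff)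
  \<comment> \<open>Pairing with the constant 1 turns convergence in mean square into convergence in
    mean.\<close>
  have lim: "(\<lambda>n. L2_pair (?d n) (\<lambda>_. 1)) \<longlonglongrightarrow> 0"
    by (rule tendsto_zero_of_scaled_bound[OF L2_pair_scaled_le[OF m borel_measurable_const] S])
      (simp_all add: L2_pair_def emeasure_space_1)
  have "(\<lambda>n. LINT w|M. simple_integral F (S n) w) \<longlonglongrightarrow> (LINT w|M. I w)"
    by (rule integral_LIMSEQ_of_split[OF e(1) iI, where a="?d" and b="\<lambda>_ _. 0" and c="\<lambda>_ _. 0"])
      (use lim in \<open>simp_all add: L2_pair_def\<close>)
  then show "(LINT w|M. I w) = 0" by (simp add: e(2) LIMSEQ_const_iff)
qed

end

section \<open>Blow-up of the two-point moments\<close>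

text \<open>An elementary form of Jensen's inequality, losing a factor inside the power but valid
  also for infinite expectations: with \<open>b = (a / 2) powr \<gamma>\<close> one has
  \<open>x powr (1 + \<gamma>) \<ge> b * (x - a / 2)\<close> for \<open>x \<ge> 0\<close>, trivially
  for \<open>x \<le> a / 2\<close>.\<close>

lemma (in prob_space) moment_lower_bound:
  fixes v :: "'a \<Rightarrow> real"
  assumes [measurable]: "v \<in> borel_measurable M" and v: "\<And>w. 0 \<le> v w" and a: "0 < a" and \<gamma>: "0 < \<gamma>"
    and le: "ennreal a \<le> (\<integral>\<^sup>+w. ennreal (v w) \<partial>M)"
  shows "ennreal ((a / 2) powr (1 + \<gamma>)) \<le> (\<integral>\<^sup>+w. ennreal (v w powr (1 + \<gamma>)) \<partial>M)"
proof -
  define b where "b = (a / 2) powr \<gamma>"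
  have b: "0 \<le> b" "(a / 2) powr (1 + \<gamma>) = b * (a / 2)" using a by (auto simp: b_def powr_add)
  have pw: "b * x \<le> x powr (1 + \<gamma>) + b * (a / 2)" if "0 \<le> x" for x
  proof (cases "x \<le> a / 2")
    case True
    then have "b * x \<le> b * (a / 2)" using b by (intro mult_left_mono)
    then show ?thesis using powr_ge_zero[of x "1 + \<gamma>"] by linarith
  next
    case False
    then have "b * x \<le> x powr \<gamma> * x"
      unfolding b_def using a \<gamma> by (intro mult_right_mono powr_mono2) auto
    also have "\<dots> = x powr (1 + \<gamma>)" using False a by (simp add: powr_add)
    finally show ?thesis using b a by (simp add: add_increasing2)
  qed
  have "ennreal (b * (a / 2)) + ennreal (b * (a / 2)) = ennreal b * ennreal a"
    using a b by (simp add: ennreal_mult[symmetric] ennreal_plus[symmetric] del: ennreal_plus)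
  also have "\<dots> \<le> ennreal b * (\<integral>\<^sup>+w. ennreal (v w) \<partial>M)" by (intro mult_left_mono le) simp
  also have "\<dots> = (\<integral>\<^sup>+w. ennreal (b * v w) \<partial>M)"
    using v b by (simp add: nn_integral_cmult ennreal_mult)
  also have "\<dots> \<le> (\<integral>\<^sup>+w. ennreal (v w powr (1 + \<gamma>)) + ennreal (b * (a / 2)) \<partial>M)"
    using pw v a b by (intro nn_integral_mono) (simp add: ennreal_plus[symmetric] ennreal_leI del: ennreal_plus)
  also have "\<dots> = ennreal (b * (a / 2)) + (\<integral>\<^sup>+w. ennreal (v w powr (1 + \<gamma>)) \<partial>M)"
    by (subst nn_integral_add) (auto simp: emeasure_space_1 add.commute)
  finally show ?thesis unfolding b(2) by (simp only: ennreal_add_left_cancel_le) simp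
qed

context colored_noise begin

text \<open>The terms linear in \<open>I\<close> or \<open>J\<close> have expectation 0, so
  \<open>E X Y\<close> is \<open>m * k\<close> plus the isometry term, and nonnegative integrands
  identify the latter with \<open>walsh_pair\<close>.\<close>

lemma walsh_two_point:
  assumes \<Phi>: "has_walsh_integral M f F \<Phi> I" "\<And>s y w. 0 \<le> \<Phi> s y w"
    and \<Psi>: "has_walsh_integral M f F \<Psi> J" "\<And>s y w. 0 \<le> \<Psi> s y w"
    and X: "X \<in> borel_measurable M" "AE w in M. X w = m + I w"
    and Y: "Y \<in> borel_measurable M" "AE w in M. Y w = k + J w"
    and mk: "0 \<le> m" "0 \<le> k"
  shows "ennreal (m * k) + walsh_pair \<Phi> \<Psi> \<le> L2_pair X Y"
proof -
  note iso = walsh_isometry[OF \<Phi>(1) \<Psi>(1)] and mI = walsh_integral_moments[OF \<Phi>(1)] and mJ = walsh_integral_moments[OF \<Psi>(1)]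
  have [measurable]: "I \<in> borel_measurable M" "J \<in> borel_measurable M" using mI(2) mJ(2) by auto
  note [measurable] = X(1) Y(1)
  have knn: "0 \<le> walsh_kernel \<Phi> \<Psi> x" for x
    using \<Phi>(2) \<Psi>(2) by (simp add: walsh_kernel_def case_prod_beta)
  have wp: "walsh_pair \<Phi> \<Psi> = ennreal (LINT x|walsh_measure. walsh_kernel \<Phi> \<Psi> x)"
    unfolding walsh_pair_def using knn iso(2) by (simp add: nn_integral_eq_integral)
  have eq: "(m + I w) * (k + J w) = m * k + k * I w + m * J w + I w * J w" for w
    by (simp add: algebra_simps)
  have i: "integrable M (\<lambda>w. (m + I w) * (k + J w))" unfolding eq using mI mJ iso by simp
  have "(LINT w|M. (m + I w) * (k + J w)) = m * k + (LINT x|walsh_measure. walsh_kernel \<Phi> \<Psi> x)"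
    unfolding eq using mI mJ iso by (simp add: prob_space)
  then have "ennreal (m * k) + walsh_pair \<Phi> \<Psi> = ennreal (LINT w|M. (m + I w) * (k + J w))"
    unfolding wp using mk knn by (simp add: ennreal_plus[symmetric] integral_nonneg_AE del: ennreal_plus)
  also have "\<dots> \<le> ennreal (norm (LINT w|M. (m + I w) * (k + J w)))" by (intro ennreal_leI) simp
  also have "\<dots> \<le> (\<integral>\<^sup>+w. norm ((m + I w) * (k + J w)) \<partial>M)" by (rule integral_norm_bound_ennreal[OF i])
  also have "\<dots> = L2_pair X Y"
    unfolding L2_pair_def by (rule nn_integral_cong_AE) (use X(2) Y(2) in \<open>eventually_elim, simp\<close>)
  finally show ?thesis .
qed

text \<open>Moves the expectation innermost, where a moment bound for fixed \<open>s\<close>,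
  \<open>y\<close>, \<open>z\<close> can be inserted.\<close>

lemma walsh_pair_Fubini:
  assumes "jointly \<Phi>" "jointly \<Psi>"
  shows "walsh_pair \<Phi> \<Psi> = (\<integral>\<^sup>+s. \<integral>\<^sup>+y. \<integral>\<^sup>+z. \<integral>\<^sup>+w. ennreal \<bar>\<Phi> s y w * \<bar>f y z\<bar> * \<Psi> s z w\<bar> \<partial>M \<partial>lborel \<partial>lborel \<partial>lborel)"
proof -
  note [measurable] = walsh_kernel_measurable[OF assms, unfolded walsh_measure_def]
  interpret P: pair_sigma_finite M "lborel3 :: (real \<times> 'a \<times> 'a) measure"
    by (intro pair_sigma_finite.intro sigma_finite_spacetime2) (rule sigma_finite_measure_axioms)
  have m: "(\<lambda>x. ennreal \<bar>walsh_kernel \<Phi> \<Psi> x\<bar>) \<in> borel_measurable (M \<Otimes>\<^sub>M lborel3)"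
    by measurable
  have m1: "(\<lambda>x. \<integral>\<^sup>+w. ennreal \<bar>walsh_kernel \<Phi> \<Psi> (w, x)\<bar> \<partial>M) \<in> borel_measurable lborel3"
    by measurable
  have m2: "(\<lambda>k. \<integral>\<^sup>+w. ennreal \<bar>walsh_kernel \<Phi> \<Psi> (w, s, k)\<bar> \<partial>M) \<in> borel_measurable lborel2" for s
    by measurable
  have "walsh_pair \<Phi> \<Psi> = (\<integral>\<^sup>+x. \<integral>\<^sup>+w. ennreal \<bar>walsh_kernel \<Phi> \<Psi> (w, x)\<bar> \<partial>M \<partial>lborel3)"
    unfolding walsh_pair_def walsh_measure_def by (rule P.nn_integral_snd[OF m, symmetric])
  also have "\<dots> = (\<integral>\<^sup>+s. \<integral>\<^sup>+k. \<integral>\<^sup>+w. ennreal \<bar>walsh_kernel \<Phi> \<Psi> (w, s, k)\<bar> \<partial>M \<partial>lborel2 \<partial>lborel)"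
    by (rule sigma_finite_measure.nn_integral_fst[OF sigma_finite_space2 m1, symmetric])
  also have "\<dots> = (\<integral>\<^sup>+s. \<integral>\<^sup>+y. \<integral>\<^sup>+z. \<integral>\<^sup>+w. ennreal \<bar>walsh_kernel \<Phi> \<Psi> (w, s, y, z)\<bar> \<partial>M \<partial>lborel \<partial>lborel \<partial>lborel)"
    by (intro nn_integral_cong lborel.nn_integral_fst[OF m2, symmetric])
  finally show ?thesis by (simp add: walsh_kernel_def)
qed

text \<open>One step of the recursion. Only times in \<open>{s0<..<t}\<close> and points of
  \<open>B\<close> are kept: each kernel contributes mass \<open>1 / 2\<close>, the correlation
  contributes \<open>K\<close>, the time integral \<open>t - s0\<close>, and
  \<open>moment_lower_bound\<close> the power of \<open>a / 2\<close>.\<close>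

lemma walsh_pair_lower_bound:
  fixes G :: "real \<Rightarrow> 'a \<Rightarrow> real" and \<sigma> :: "real \<Rightarrow> real" and u :: "real \<Rightarrow> 'a \<Rightarrow> 'w \<Rightarrow> real"
  defines "\<Phi> \<equiv> \<lambda>t x s y w. indicator {0<..<t} s * (G (t - s) (x - y) * \<sigma> (u s y w))"
  assumes j: "jointly (\<Phi> t x)" "jointly (\<Phi> t x')"
    and s0: "0 \<le> s0" "s0 < t" and a: "0 < a" and \<gamma>: "0 < \<gamma>" and K: "0 < K"
    and \<sigma>: "\<And>v. \<bar>v\<bar> powr (1 + \<gamma>) \<le> \<sigma> v"
    and B: "B \<in> sets borel" "\<And>y z. y \<in> B \<Longrightarrow> z \<in> B \<Longrightarrow> y \<noteq> z \<Longrightarrow> K \<le> f y z"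
    and G: "\<And>r y. 0 < r \<Longrightarrow> 0 \<le> G r y" "\<And>r. 0 < r \<Longrightarrow> G r \<in> borel_measurable borel"
    and u: "\<And>s y. s0 < s \<Longrightarrow> s < t \<Longrightarrow> u s y \<in> borel_measurable M"
    and mass: "\<And>r. 0 < r \<Longrightarrow> r < t - s0 \<Longrightarrow> ennreal (1 / 2) \<le> (\<integral>\<^sup>+y. ennreal (G r (x - y)) * indicator B y \<partial>lborel)"
      "\<And>r. 0 < r \<Longrightarrow> r < t - s0 \<Longrightarrow> ennreal (1 / 2) \<le> (\<integral>\<^sup>+y. ennreal (G r (x' - y)) * indicator B y \<partial>lborel)"
    and le: "\<And>s y z. s0 < s \<Longrightarrow> s < t \<Longrightarrow> y \<in> B \<Longrightarrow> z \<in> B \<Longrightarrow> ennreal a \<le> L2_pair (u s y) (u s z)"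
  shows "ennreal (K / 4 * (t - s0) * (a / 2) powr (1 + \<gamma>)) \<le> walsh_pair (\<Phi> t x) (\<Phi> t x')"
proof -
  note [measurable] = B(1)
  let ?Q = "\<lambda>s y z. \<integral>\<^sup>+w. ennreal \<bar>\<Phi> t x s y w * \<bar>f y z\<bar> * \<Phi> t x' s z w\<bar> \<partial>M"
  let ?k = "\<lambda>s y z. G (t - s) (x - y) * K * G (t - s) (x' - z)"
  define b where "b = (a / 2) powr (1 + \<gamma>)"
  have b0: "0 \<le> b" by (simp add: b_def)
  have pointwise: "ennreal (G (t - s) (x - y)) * indicator B y * (ennreal (K * b) * (ennreal (G (t - s) (x' - z)) * indicator B z))
      \<le> ?Q s y z"
    if s: "s0 < s" "s < t" and yz: "y \<noteq> z" for s y z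
  proof (cases "y \<in> B \<and> z \<in> B")
    case True
    note [measurable] = u[OF s]
    have g: "0 \<le> G (t - s) (x - y)" "0 \<le> G (t - s) (x' - z)" using G(1) s by auto
    have Kf: "K \<le> \<bar>f y z\<bar>" using B(2)[of y z] True yz by auto
    have "ennreal b \<le> (\<integral>\<^sup>+w. ennreal (\<bar>u s y w * u s z w\<bar> powr (1 + \<gamma>)) \<partial>M)"
      unfolding b_def using le[OF s, unfolded L2_pair_def] True a \<gamma> by (intro moment_lower_bound) auto
    then have "ennreal (?k s y z) * ennreal b
      \<le> ennreal (?k s y z) * (\<integral>\<^sup>+w. ennreal (\<bar>u s y w * u s z w\<bar> powr (1 + \<gamma>)) \<partial>M)"
      by (intro mult_left_mono) auto
    also have "\<dots> = (\<integral>\<^sup>+w. ennreal (?k s y z * \<bar>u s y w * u s z w\<bar> powr (1 + \<gamma>)) \<partial>M)"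
      using g K by (subst nn_integral_cmult[symmetric]) (auto simp: ennreal_mult)
    also have "\<dots> \<le> ?Q s y z"
    proof (intro nn_integral_mono ennreal_leI)
      fix w
      have sg: "0 \<le> \<sigma> v" for v using \<sigma>[of v] powr_ge_zero order_trans by blast
      have "\<bar>u s y w * u s z w\<bar> powr (1 + \<gamma>) = \<bar>u s y w\<bar> powr (1 + \<gamma>) * \<bar>u s z w\<bar> powr (1 + \<gamma>)"
        by (simp add: abs_mult powr_mult)
      also have "\<dots> \<le> \<sigma> (u s y w) * \<sigma> (u s z w)" by (intro mult_mono \<sigma>) (auto simp: sg)
      finally have "?k s y z * \<bar>u s y w * u s z w\<bar> powr (1 + \<gamma>)
        \<le> G (t - s) (x - y) * \<bar>f y z\<bar> * G (t - s) (x' - z) * (\<sigma> (u s y w) * \<sigma> (u s z w))"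
        using g K Kf by (intro mult_mono) auto
      also have "\<dots> = \<Phi> t x s y w * \<bar>f y z\<bar> * \<Phi> t x' s z w"
        using s s0 by (simp add: \<Phi>_def)
      also have "\<dots> \<le> \<bar>\<Phi> t x s y w * \<bar>f y z\<bar> * \<Phi> t x' s z w\<bar>" by simp
      finally show "?k s y z * \<bar>u s y w * u s z w\<bar> powr (1 + \<gamma>)
        \<le> \<bar>\<Phi> t x s y w * \<bar>f y z\<bar> * \<Phi> t x' s z w\<bar>" .
    qed
    finally show ?thesis using True g K b0 by (simp add: ennreal_mult[symmetric] mult_ac)
  qed auto
  have inner: "ennreal (K * b / 4) \<le> (\<integral>\<^sup>+y. \<integral>\<^sup>+z. ?Q s y z \<partial>lborel \<partial>lborel)"
    if s: "s0 < s" "s < t" for s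
  proof -
    have [measurable]: "G (t - s) \<in> borel_measurable borel" using G(2) s by simp
    let ?g = "\<lambda>y. ennreal (G (t - s) (x - y)) * indicator B y" and ?h = "\<lambda>z. ennreal (G (t - s) (x' - z)) * indicator B z"
    have "ennreal (K * b / 4) = ennreal (1 / 2) * (ennreal (K * b) * ennreal (1 / 2))"
      using K b0 by (simp add: ennreal_mult[symmetric] del: ennreal_divide_numeral ennreal_half)
    also have "\<dots> \<le> (\<integral>\<^sup>+y. ?g y \<partial>lborel) * (ennreal (K * b) * (\<integral>\<^sup>+z. ?h z \<partial>lborel))"
      using s by (intro mult_mono mass) auto
    also have "\<dots> = (\<integral>\<^sup>+y. ?g y * (ennreal (K * b) * (\<integral>\<^sup>+z. ?h z \<partial>lborel)) \<partial>lborel)"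
      by (subst nn_integral_multc) auto
    also have "\<dots> = (\<integral>\<^sup>+y. \<integral>\<^sup>+z. ?g y * (ennreal (K * b) * ?h z) \<partial>lborel \<partial>lborel)"
      by (simp add: nn_integral_cmult)
    also have "\<dots> \<le> (\<integral>\<^sup>+y. \<integral>\<^sup>+z. ?Q s y z \<partial>lborel \<partial>lborel)"
    proof (rule nn_integral_mono, rule nn_integral_mono_AE)
      fix y
      \<comment> \<open>The lower bound on \<open>f\<close> is available off the diagonal only; for
        fixed \<open>y\<close> the point \<open>z = y\<close> is a null set.\<close>
      show "AE z in lborel. ?g y * (ennreal (K * b) * ?h z) \<le> ?Q s y z"
        using AE_lborel_singleton[of y] by eventually_elim (rule pointwise[OF s], simp)
    qed
    finally show ?thesis .
  qed
  have "ennreal (K / 4 * (t - s0) * (a / 2) powr (1 + \<gamma>)) = ennreal (K * b / 4) * emeasure lborel {s0<..<t}"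
    using s0 K b0 by (simp add: b_def ennreal_mult[symmetric] mult_ac del: ennreal_divide_numeral)
  also have "\<dots> = (\<integral>\<^sup>+s. ennreal (K * b / 4) * indicator {s0<..<t} s \<partial>lborel)"
    by (simp add: nn_integral_cmult_indicator)
  also have "\<dots> \<le> walsh_pair (\<Phi> t x) (\<Phi> t x')"
    unfolding walsh_pair_Fubini[OF j]
    by (intro nn_integral_mono) (use inner in \<open>auto simp: indicator_def\<close>)
  finally show ?thesis .
qed

end


lemma kernel_mean_lower_bound:
  fixes G u0 :: "'a::euclidean_space \<Rightarrow> real"
  assumes G: "G \<in> borel_measurable borel" "\<And>y. 0 \<le> G y" "integrable lborel G"
    and mass: "ennreal (1 / 2) \<le> (\<integral>\<^sup>+y. ennreal (G (x - y)) * indicator B y \<partial>lborel)"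
    and u0: "u0 \<in> borel_measurable borel" "bounded (range u0)" "\<And>y. k \<le> u0 y" and k: "0 \<le> k"
  shows "k / 2 \<le> (LINT y|lborel. G (x - y) * u0 y)"
proof -
  note [measurable] = G(1) u0(1)
  have "(\<integral>\<^sup>+y. ennreal (G (x - y)) \<partial>lborel) = (\<integral>\<^sup>+y. ennreal (G y) \<partial>lborel)"
    by (rule nn_integral_lborel_reflect[of "\<lambda>y. ennreal (G y)"]) measurable
  also have "\<dots> < \<infinity>" using G by (simp add: nn_integral_eq_integral)
  finally have iG: "integrable lborel (\<lambda>y. G (x - y))" using G(2) by (intro integrableI_nonneg) auto
  obtain C where C: "\<And>y. \<bar>u0 y\<bar> \<le> C" using u0(2) by (auto simp: bounded_iff)
  \<comment> \<open>Without integrability the Bochner integral would be 0 by convention and the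
    lower bound would fail; boundedness of \<open>u0\<close> supplies it.\<close>
  have iGu: "integrable lborel (\<lambda>y. G (x - y) * u0 y)"
  proof (rule Bochner_Integration.integrable_bound[OF integrable_mult_left[OF iG, of C]])
    have "0 \<le> C" using C[of 0] abs_ge_zero order_trans by blast
    then show "AE y in lborel. norm (G (x - y) * u0 y) \<le> norm (G (x - y) * C)"
      using G(2) C by (intro AE_I2) (simp add: abs_mult mult_left_mono)
  qed measurable
  have "ennreal (1 / 2) \<le> (\<integral>\<^sup>+y. ennreal (G (x - y)) \<partial>lborel)"
    by (rule order_trans[OF mass nn_integral_mono]) (auto simp: indicator_def)
  also have "\<dots> = ennreal (LINT y|lborel. G (x - y))" using G(2) by (intro nn_integral_eq_integral iG) auto
  finally have "1 / 2 \<le> (LINT y|lborel. G (x - y))"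
    using G(2) by (subst (asm) ennreal_le_iff) (auto intro: integral_nonneg_AE)
  then have "k * (1 / 2) \<le> k * (LINT y|lborel. G (x - y))" using k by (rule mult_left_mono)
  also have "\<dots> = (LINT y|lborel. G (x - y) * k)" by simp
  also have "\<dots> \<le> (LINT y|lborel. G (x - y) * u0 y)"
    by (rule integral_mono[OF _ iGu]) (use iG G(2) u0(3) in \<open>auto intro: mult_left_mono\<close>)
  finally show ?thesis by simp
qed

theorem theorem1p5:
  fixes \<nu> \<alpha> \<beta> \<gamma> t0 :: real
    and p :: "real \<Rightarrow> 'a::euclidean_space \<Rightarrow> real"
    and N :: "'v measure" and D :: "real \<Rightarrow> 'v \<Rightarrow> real" and fE :: "real \<Rightarrow> real \<Rightarrow> real"
    and \<sigma> :: "real \<Rightarrow> real"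
    and f :: "'a \<Rightarrow> 'a \<Rightarrow> real" and g :: "'a \<Rightarrow> real" and g_hat :: "'a \<Rightarrow> complex"
    and M :: "'w measure" and F :: "(real \<times> 'a) set \<Rightarrow> 'w \<Rightarrow> real"
  assumes "0 < \<nu>" "0 < \<beta>" "\<beta> < 1" "0 < \<alpha>" "\<alpha> < 2"
    and "stable_density \<nu> \<alpha> p"
    and "stable_subordinator N \<beta> D"
    and "first_passage_density N D fE"
    and "\<forall>x. \<exists>e>0. \<exists>L. L-lipschitz_on (cball x e) \<sigma>"
    and "0 < \<gamma>" "\<forall>x. \<sigma> x \<ge> \<bar>x\<bar> powr (1 + \<gamma>)"
    and "(\<lambda>(x, y). f x y) \<in> borel_measurable borel"
    and "\<forall>x y. x \<noteq> y \<longrightarrow> f x y \<le> g (x - y)"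
    and "locally_integrable g"
    and "is_fourier_transform g g_hat"
    and "integrable lborel (\<lambda>\<xi>. g_hat \<xi> / complex_of_real (1 + norm \<xi> powr \<alpha>))"
    and "\<forall>R>0. \<exists>K>0. \<forall>x\<in>ball 0 R. \<forall>y\<in>ball 0 R. x \<noteq> y \<longrightarrow> K \<le> f x y"
    and "gaussian_noise M f F"
    and "0 < t0"
  shows "\<exists>\<kappa>\<^sub>0>0. \<forall>u0 T u.
           u0 \<in> borel_measurable borel \<and> (\<forall>x. 0 \<le> u0 x) \<and> bounded (range u0) \<and>
           (INF x. u0 x) \<ge> \<kappa>\<^sub>0 \<and>
           mild_solution M f F (time_changed_kernel p fE) \<sigma> u0 T u \<longrightarrow>
           (\<forall>x t. t0 \<le> t \<and> ereal t < T \<longrightarrow> (\<integral>\<^sup>+\<omega>. ennreal ((u t x \<omega>)\<^sup>2) \<partial>M) = \<infinity>)"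
proof -
  note p = assms(6) and D = assms(7) and fE = assms(8)
  define G where "G = time_changed_kernel p fE"
  have f_pos: "0 < f x y" if "x \<noteq> y" for x y
  proof -
    define R where "R = norm x + norm y + 1"
    have "0 < R" by (simp add: R_def add_nonneg_pos)
    then obtain K where "0 < K" "\<forall>x\<in>ball 0 R. \<forall>y\<in>ball 0 R. x \<noteq> y \<longrightarrow> K \<le> f x y" using assms(17) by blast
    moreover have "x \<in> ball 0 R" "y \<in> ball 0 R" by (auto simp: R_def add.commute add_strict_increasing)
    ultimately show ?thesis using that by force
  qed
  interpret prob_space M using assms(18) by (simp add: gaussian_noise_def)
  interpret colored_noise M f g F
    by unfold_locales (use assms(12,13,14,18) f_pos in auto)
  have G_nonneg: "0 \<le> G r y" and G_meas: "G r \<in> borel_measurable borel" and G_int: "integrable lborel (G r)"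
    if "0 < r" for r y
    unfolding G_def using time_changed_kernel_nonneg[OF p fE that] time_changed_kernel_eq[OF p D fE that] by auto
  obtain c where c: "0 < c"
    "\<And>t \<rho> x. 0 < t \<Longrightarrow> 0 < \<rho> \<Longrightarrow> t powr \<beta> \<le> c * \<rho> powr \<alpha> \<Longrightarrow>
       ennreal (1 / 2) \<le> (\<integral>\<^sup>+y. ennreal (G t (x - y)) * indicator (ball x \<rho>) y \<partial>lborel)"
    unfolding G_def using time_changed_kernel_ball[OF p D fE \<open>0 < \<nu>\<close> \<open>0 < \<alpha>\<close>] by blast

  \<comment> \<open>The radii \<open>\<rho> n\<close> are chosen such that \<open>(r n)\<^bsup>\<beta>\<^esup> = c (\<rho> n)\<^bsup>\<alpha>\<^esup>\<close>, and \<open>R n\<close> is the sum of \<open>\<rho> k\<close> over \<open>k \<ge> n\<close>.\<close>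
  define \<theta> where "\<theta> = 2 powr (- \<beta> / \<alpha>)"
  have \<theta>: "0 < \<theta>" "\<theta> < 1" using assms(2,4) by (auto simp: \<theta>_def powr_less_one)
  define \<rho>0 where "\<rho>0 = (t0 powr \<beta> / c) powr (1 / \<alpha>)"
  define \<rho> where "\<rho> n = \<rho>0 * \<theta> ^ n" for n :: nat
  define R where "R n = \<rho>0 * \<theta> ^ n / (1 - \<theta>)" for n :: nat
  \<comment> \<open>Since \<open>r 0 = t0\<close>, the times \<open>\<tau> n\<close> start at 0 and
    increase to \<open>t0\<close>, with steps \<open>\<tau> (Suc n) - \<tau> n = r (Suc n)\<close>.
    Halving \<open>r\<close> forces the ratio \<open>\<theta>\<close> for \<open>\<rho>\<close>, and
    \<open>\<theta> < 1\<close> makes the total gap finite.\<close>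
  define r where "r n = t0 / 2 ^ n" for n :: nat
  define \<tau> where "\<tau> n = t0 - r n" for n :: nat
  have \<rho>0: "0 < \<rho>0" using c(1) \<open>0 < t0\<close> by (simp add: \<rho>0_def)
  have \<rho>_pos: "0 < \<rho> n" for n using \<rho>0 \<theta> by (simp add: \<rho>_def)
  have R_pos: "0 < R n" for n using \<rho>0 \<theta> by (simp add: R_def)
  have R_Suc: "R n = R (Suc n) + \<rho> n" for n
    using \<theta> by (simp add: R_def \<rho>_def field_simps)
  have R_le: "R n \<le> R 0" for n
    using \<rho>0 \<theta> by (auto simp: R_def intro!: divide_right_mono mult_left_le power_le_one)
  have r_pos: "0 < r n" for n using \<open>0 < t0\<close> by (simp add: r_def)
  have r_le: "r n \<le> t0" for n using \<open>0 < t0\<close> by (simp add: r_def divide_le_eq)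
  have r_Suc: "r n = 2 * r (Suc n)" for n by (simp add: r_def)
  have r_powr: "s powr \<beta> \<le> c * \<rho> n powr \<alpha>" if "0 < s" "s \<le> r n" for s n
  proof -
    have "s powr \<beta> \<le> r n powr \<beta>" using that assms(2) by (intro powr_mono2) auto
    also have "\<dots> = t0 powr \<beta> * (2 powr (- \<beta>)) ^ n"
    proof -
      have "r n = t0 * 2 powr (- real n)"
        by (simp add: r_def powr_minus powr_realpow divide_inverse)
      then show ?thesis using \<open>0 < t0\<close> by (simp add: powr_mult powr_powr powr_power mult.commute)
    qed
    also have "\<dots> = c * \<rho> n powr \<alpha>"
    proof -
      have "(\<theta> ^ n) powr \<alpha> = (2 powr (- \<beta>)) ^ n"
        using \<theta> assms(4) by (simp add: \<theta>_def powr_power powr_powr mult.commute)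
      moreover have "\<rho>0 powr \<alpha> = t0 powr \<beta> / c"
        using assms(4) c(1) by (simp add: \<rho>0_def powr_powr)
      ultimately show ?thesis using c(1) \<rho>0 \<theta> by (simp add: \<rho>_def powr_mult)
    qed
    finally show ?thesis .
  qed
  \<comment> \<open>The gap between the radii \<open>R (Suc n)\<close> and \<open>R n\<close> is
    \<open>\<rho> n\<close>, so a ball of radius \<open>\<rho> n\<close> around a point of the
    smaller ball stays in the larger one.\<close>
  have mass: "ennreal (1 / 2) \<le> (\<integral>\<^sup>+y. ennreal (G s (x - y)) * indicator (ball 0 (R n)) y \<partial>lborel)"
    if "0 < s" "s \<le> r n" "x \<in> ball 0 (R (Suc n))" for s n x
  proof -
    have "ball x (\<rho> n) \<subseteq> ball 0 (R n)"
      using that(3) R_Suc[of n] by (simp add: ball_subset_ball_iff)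
    then show ?thesis
      by (intro order_trans[OF c(2)[OF that(1) \<rho>_pos r_powr[OF that(1,2)], of x] nn_integral_mono])
        (auto simp: indicator_def)
  qed
  \<comment> \<open>All balls of the recursion lie in the first one, so a single \<open>K\<close>
    serves every step.\<close>
  have "\<exists>K>0. \<forall>x\<in>ball 0 (R 0). \<forall>y\<in>ball 0 (R 0). x \<noteq> y \<longrightarrow> K \<le> f x y"
    by (rule assms(17)[THEN spec, THEN mp, OF R_pos])
  then obtain K where K: "0 < K" "\<And>x y. x \<in> ball 0 (R 0) \<Longrightarrow> y \<in> ball 0 (R 0) \<Longrightarrow> x \<noteq> y \<Longrightarrow> K \<le> f x y"
    by blast

  \<comment> \<open>\<open>A\<close> makes \<open>a n = A q\<^sup>n\<close> an exact solution of \<open>a (n + 1) = K / 4 \<cdot> r (n + 1) \<cdot> (a n / 2)\<^bsup>1 + \<gamma>\<^esup>\<close>.\<close>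
  define q where "q = 2 powr (1 / \<gamma>)"
  \<comment> \<open>\<open>b\<close> collects the constants: \<open>K / 4 * r (Suc n) * (x / 2) powr
    (1 + \<gamma>) = b / 2 ^ n * x powr (1 + \<gamma>)\<close> for \<open>x > 0\<close>. At
    \<open>x = A * q ^ n\<close> the relation \<open>q powr \<gamma> = 2\<close> cancels
    \<open>2 ^ n\<close>, and \<open>b * A powr \<gamma> = q\<close> determines
    \<open>A\<close>.\<close>
  define b where "b = K * t0 / (8 * 2 powr (1 + \<gamma>))"
  define A where "A = (q / b) powr (1 / \<gamma>)"
  define a where "a n = A * q ^ n" for n :: nat
  have q: "1 < q" using assms(10) by (simp add: q_def)
  have b: "0 < b" using K(1) \<open>0 < t0\<close> by (simp add: b_def)
  have A: "0 < A" using q b by (simp add: A_def)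
  have a_pos: "0 < a n" for n using A q by (simp add: a_def)
  have a_Suc: "K / 4 * r (Suc n) * (a n / 2) powr (1 + \<gamma>) = a (Suc n)" for n
  proof -
    have "K / 4 * r (Suc n) * (a n / 2) powr (1 + \<gamma>) = b / 2 ^ n * a n powr (1 + \<gamma>)"
      using a_pos[of n] by (simp add: b_def r_def powr_divide field_simps)
    also have "a n powr (1 + \<gamma>) = a n * (A powr \<gamma> * (q ^ n) powr \<gamma>)"
      using A q a_pos[of n] by (simp add: powr_add a_def powr_mult)
    also have "A powr \<gamma> = q / b" using assms(10) q b by (simp add: A_def powr_powr)
    also have "(q ^ n) powr \<gamma> = 2 ^ n"
      using assms(10) by (simp add: q_def powr_power powr_powr powr_realpow)
    finally show ?thesis using b by (simp add: a_def)
  qed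
  \<comment> \<open>The deterministic part of the solution is at least \<open>\<kappa> / 2\<close>
    at each point, so the product over two points is at least
    \<open>(\<kappa> / 2)\<^sup>2 = A = a 0\<close>, which starts the recursion.\<close>
  define \<kappa> where "\<kappa> = 2 * sqrt A"
  have \<kappa>: "0 < \<kappa>" "\<kappa> / 2 * (\<kappa> / 2) = A" using A by (auto simp: \<kappa>_def)

  have no_solution: False
    if u0: "u0 \<in> borel_measurable borel" "bounded (range u0)" "\<And>y. \<kappa> \<le> u0 y"
      and T: "ereal t0 < T" and sol: "mild_solution M f F G \<sigma> u0 T u" for u0 T u
  proof -
    define \<Phi> where "\<Phi> = (\<lambda>t x s y w. indicator {0<..<t} s * (G (t - s) (x - y) * \<sigma> (u s y w)))"
    have \<Phi>_nonneg: "0 \<le> \<Phi> t x s y w" for t x s y w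
      using assms(11)[rule_format, of "u s y w"] powr_ge_zero[of "\<bar>u s y w\<bar>" "1 + \<gamma>"] G_nonneg[of "t - s"]
      by (auto simp: \<Phi>_def indicator_def simp del: powr_ge_zero)
    have ex: "\<exists>I. has_walsh_integral M f F (\<Phi> t x) I \<and> (AE w in M. u t x w = (LINT y|lborel. G t (x - y) * u0 y) + I w)"
      and u_meas: "u t x \<in> borel_measurable M" if "0 < t" "t \<le> t0" for t x
    proof -
      have "ereal t < T" using T that by (meson ereal_less_eq(3) order_le_less_trans)
      with sol[unfolded mild_solution_def, THEN spec, THEN spec, of t x] that(1)
      have *: "u t x \<in> borel_measurable (noise_filtration M F t) \<and>
        (\<exists>I. has_walsh_integral M f F (\<Phi> t x) I \<and> (AE w in M. u t x w = (LINT y|lborel. G t (x - y) * u0 y) + I w))"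
        unfolding \<Phi>_def by simp
      from *[THEN conjunct2] show "\<exists>I. has_walsh_integral M f F (\<Phi> t x) I \<and> (AE w in M. u t x w = (LINT y|lborel. G t (x - y) * u0 y) + I w)" .
      show "u t x \<in> borel_measurable M" by (rule filtration_measurable[OF *[THEN conjunct1]])
    qed
    define m where "m t x = (LINT y|lborel. G t (x - y) * u0 y)" for t x
    define I where "I t x = (SOME I. has_walsh_integral M f F (\<Phi> t x) I \<and> (AE w in M. u t x w = m t x + I w))" for t x
    have I: "has_walsh_integral M f F (\<Phi> t x) (I t x)" "AE w in M. u t x w = m t x + I t x w"
      if t: "0 < t" "t \<le> t0" for t x
      using someI_ex[OF ex[OF t, of x, folded m_def]] unfolding I_def by (rule conjunct1, rule conjunct2)
    have J: "\<kappa> / 2 \<le> m t x" if t: "0 < t" "t \<le> t0" for t x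
      unfolding m_def using c(2)[OF t(1) \<rho>_pos r_powr[OF t(1), of 0], of x] t \<kappa>
      by (intro kernel_mean_lower_bound[where B="ball x (\<rho> 0)"] G_meas G_nonneg G_int u0) (auto simp: r_def)
    have two_point: "ennreal A + walsh_pair (\<Phi> t x) (\<Phi> t x') \<le> L2_pair (u t x) (u t x')"
      if t: "0 < t" "t \<le> t0" for t x x'
    proof -
      have "A \<le> m t x * m t x'"
        unfolding \<kappa>(2)[symmetric] using J[OF t] \<kappa>(1) by (intro mult_mono) (auto intro: order_trans[OF _ J[OF t]])
      then have "ennreal A + walsh_pair (\<Phi> t x) (\<Phi> t x') \<le> ennreal (m t x * m t x') + walsh_pair (\<Phi> t x) (\<Phi> t x')"
        by (intro add_mono ennreal_leI) auto
      also have "\<dots> \<le> L2_pair (u t x) (u t x')"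
        by (rule walsh_two_point[OF I(1)[OF t] \<Phi>_nonneg I(1)[OF t] \<Phi>_nonneg u_meas[OF t] I(2)[OF t] u_meas[OF t] I(2)[OF t]])
          (use \<kappa>(1) in \<open>auto intro: order_trans[OF _ J[OF t]]\<close>)
      finally show ?thesis .
    qed
    have growth: "ennreal (a n) \<le> L2_pair (u t x) (u t x')"
      if "\<tau> n < t" "t \<le> t0" "x \<in> ball 0 (R n)" "x' \<in> ball 0 (R n)" for n t x x'
      using that
    proof (induction n arbitrary: t x x')
      case 0
      then have "0 < t" by (simp add: \<tau>_def r_def)
      from two_point[OF this 0(2), of x x'] show ?case
        by (rule order_trans[rotated]) (simp add: a_def add_increasing2)
    next
      case (Suc n)
      \<comment> \<open>As \<open>t\<close> exceeds
        \<open>\<tau> (Suc n) = \<tau> n + r (Suc n)\<close>, the induction hypothesis covers all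
        times in \<open>{s0<..<t}\<close>. The elapsed time there is at most
        \<open>r (Suc n)\<close>, hence at most \<open>r n\<close>, so \<open>mass\<close> applies
        with index \<open>n\<close>.\<close>
      define s0 where "s0 = t - r (Suc n)"
      have s0: "\<tau> n \<le> s0" "0 \<le> s0" "s0 < t" and t: "0 < t"
        using Suc.prems(1) r_Suc[of n] r_pos[of "Suc n"] r_le[of n] unfolding s0_def \<tau>_def by linarith+
      have jt: "jointly (\<Phi> t x)" for x
        using I(1)[OF t Suc.prems(2), of x] by (simp add: has_walsh_integral_def jointly_def)
      have rs: "t - s0 \<le> r n" using r_Suc[of n] r_pos[of "Suc n"] by (simp add: s0_def)
      have "ennreal (a (Suc n)) = ennreal (K / 4 * (t - s0) * (a n / 2) powr (1 + \<gamma>))"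
        by (simp add: a_Suc[symmetric] s0_def)
      also have "\<dots> \<le> walsh_pair (\<Phi> t x) (\<Phi> t x')"
        unfolding \<Phi>_def
      proof (rule walsh_pair_lower_bound[where G=G and \<sigma>=\<sigma> and u=u and B="ball 0 (R n)" and ?s0.0=s0])
        show "jointly (\<lambda>s y w. indicat_real {0<..<t} s * (G (t - s) (x - y) * \<sigma> (u s y w)))"
          "jointly (\<lambda>s y w. indicat_real {0<..<t} s * (G (t - s) (x' - y) * \<sigma> (u s y w)))"
          using jt[of x] jt[of x'] by (simp_all add: \<Phi>_def)
        show "K \<le> f y z" if "y \<in> ball 0 (R n)" "z \<in> ball 0 (R n)" "y \<noteq> z" for y z
          using that R_le[of n] by (intro K(2)) auto
        show "ennreal (1 / 2) \<le> (\<integral>\<^sup>+y. ennreal (G s (x - y)) * indicator (ball 0 (R n)) y \<partial>lborel)"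
          "ennreal (1 / 2) \<le> (\<integral>\<^sup>+y. ennreal (G s (x' - y)) * indicator (ball 0 (R n)) y \<partial>lborel)"
          if "0 < s" "s < t - s0" for s
          by (rule mass; use that rs Suc.prems in simp)+
        show "u s y \<in> borel_measurable M" if "s0 < s" "s < t" for s y
          using that s0 Suc.prems(2) by (intro u_meas) auto
        show "ennreal (a n) \<le> L2_pair (u s y) (u s z)"
          if "s0 < s" "s < t" "y \<in> ball 0 (R n)" "z \<in> ball 0 (R n)" for s y z
          using that s0 Suc.prems(2) by (intro Suc.IH) auto
      qed (use s0 a_pos assms(10,11) K G_nonneg G_meas in auto)
      also have "\<dots> \<le> ennreal A + walsh_pair (\<Phi> t x) (\<Phi> t x')" by simp
      also have "\<dots> \<le> L2_pair (u t x) (u t x')" by (rule two_point[OF t Suc.prems(2)])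
      finally show ?case .
    qed
    \<comment> \<open>The contradiction occurs at time \<open>t0\<close> and the origin, which
      satisfy the conditions of \<open>growth\<close> for every \<open>n\<close>: the second moment
      there is finite by the isometry, yet at least every \<open>a n\<close>.\<close>
    note t0 = \<open>0 < t0\<close> order_refl[of t0]
    note mI = walsh_integral_moments[OF I(1)[OF t0, of 0]]
    have [measurable]: "I t0 0 \<in> borel_measurable M" using mI(2) by auto
    have "integrable M (\<lambda>w. (m t0 0 + I t0 0 w)\<^sup>2)" using mI by (simp add: power2_sum)
    then have "(\<integral>\<^sup>+w. ennreal ((m t0 0 + I t0 0 w)\<^sup>2) \<partial>M) < \<infinity>" by (simp add: nn_integral_eq_integral)
    also have "(\<integral>\<^sup>+w. ennreal ((m t0 0 + I t0 0 w)\<^sup>2) \<partial>M) = L2_pair (u t0 0) (u t0 0)"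
      unfolding L2_pair_def by (rule nn_integral_cong_AE) (use I(2)[OF t0, of 0] in \<open>eventually_elim, simp add: power2_eq_square\<close>)
    finally obtain C where C: "L2_pair (u t0 0) (u t0 0) = ennreal C" "0 \<le> C"
      by (cases "L2_pair (u t0 0) (u t0 0)") auto
    have "a n \<le> C" for n
      using growth[of n t0 0 0] C r_pos[of n] R_pos[of n] by (simp add: \<tau>_def)
    moreover obtain n where "C / A < q ^ n" using real_arch_pow[OF q] by blast
    ultimately show False using A by (auto simp: a_def field_simps not_le[symmetric])
  qed
  show ?thesis
  proof (intro exI[of _ \<kappa>] conjI allI impI)
    fix u0 T u x t
    assume h: "u0 \<in> borel_measurable borel \<and> (\<forall>x. 0 \<le> u0 x) \<and> bounded (range u0) \<and> (INF x. u0 x) \<ge> \<kappa> \<and>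
        mild_solution M f F (time_changed_kernel p fE) \<sigma> u0 T u" and t: "t0 \<le> t \<and> ereal t < T"
    have "bdd_below (range u0)" using h by (intro bounded_imp_bdd_below) simp
    then have "\<kappa> \<le> u0 y" for y using h cINF_lower[of u0 UNIV y] by (auto intro: order_trans)
    moreover have "ereal t0 < T" using t by (meson ereal_less_eq(3) order_le_less_trans)
    ultimately show "(\<integral>\<^sup>+w. ennreal ((u t x w)\<^sup>2) \<partial>M) = \<infinity>"
      using no_solution[of u0 T u] h by (auto simp: G_def)
  qed (rule \<kappa>(1))
qed

end
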